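(* Let $f\in\mathcal{E}$ and define the entire function $\vartheta(x)=\sum_{n=0}^\infty\left(\sum_{j=1}^{n+1}f(j)\right)\frac{x^n}{n!}$. Then for $z\in\mathbb{C}$ with $\Re(z)>0$, $$\sum_z f=\frac{1}{\Gamma(1-z)}\left(\sum_{n=0}^\infty\Big(\sum_{j=1}^{n+1}f(j)\Big)\frac{(-1)^n}{n!\,(n+1-z)}+\int_1^\infty\vartheta(-x)x^{-z}\,dx\right),$$ where at positive integers $z$ the right-hand side is understood as its limiting value.
   Context: The space $\mathcal{E}$ consists of all functions $f$ holomorphic on $\{z\in\mathbb{C}:\Re(z)>0\}$ such that for every $y\in\mathbb{R}$ the limit of $f(z)$ as $\Re(z)\to0^+$ along $\Im(z)=y$ exists and is finite, and such that there exist real $\alpha,\rho,C$ with $0\le\alpha<\pi/2$, $\rho\geq 0$, $C>0$ and $|f(z)|<Ce^{\alpha|\Im(z)|+\rho|\Re(z)|}$ for $\Re(z)>0$. For $f\in\mathcal{E}$ and $\Re(z)>0$, the indefinite sum $\sum_z f$ (a subscript $z$ with no limits) is defined, for any $\sigma>0$, by $$\sum_z f=\frac{1}{\Gamma(z)}\int_0^\infty t^{z-1}e^{-t}\int_0^t\frac{e^x}{2\pi i}\int_{\sigma-i\infty}^{\sigma+i\infty}\Gamma(\xi)f(\xi)x^{-\xi}\,d\xi\,dx\,dt .$$ Sums with explicit limits, such as $\sum_{j=1}^{n+1}$ and $\sum_{n=0}^\infty$, are ordinary sums. $\Gamma$ is Euler's Gamma function. *)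

theory Defs
  imports "HOL-Complex_Analysis.Complex_Analysis"
begin

definition space_E :: "(complex \<Rightarrow> complex) set" where
  "space_E = {f. f holomorphic_on {z. Re z > 0} \<and>
     (\<forall>y::real. \<exists>l. ((\<lambda>x. f (Complex x y)) \<longlongrightarrow> l) (at_right 0)) \<and>
     (\<exists>\<alpha> \<rho> C :: real. 0 \<le> \<alpha> \<and> \<alpha> < pi / 2 \<and> 0 \<le> \<rho> \<and> 0 < C \<and>
        (\<forall>z. Re z > 0 \<longrightarrow> norm (f z) < C * exp (\<alpha> * \<bar>Im z\<bar> + \<rho> * \<bar>Re z\<bar>)))}"

text \<open>
  All integrals below are Lebesgue integrals. The contour integral from \<open>\<sigma> - \<i>\<infinity>\<close> to
  \<open>\<sigma> + \<i>\<infinity>\<close> is written in the parametrisation \<open>\<xi> = \<sigma> + \<i> y\<close>, \<open>d\<xi> = \<i> dy\<close>.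
\<close>

definition vertical_integrable :: "real \<Rightarrow> (complex \<Rightarrow> complex) \<Rightarrow> bool" where
  "vertical_integrable \<sigma> g \<longleftrightarrow> integrable lborel (\<lambda>y::real. g (Complex \<sigma> y))"

definition vertical_integral :: "real \<Rightarrow> (complex \<Rightarrow> complex) \<Rightarrow> complex" where
  "vertical_integral \<sigma> g = \<i> * (LINT y|lborel. g (Complex \<sigma> y))"

definition indef_sum_kernel :: "(complex \<Rightarrow> complex) \<Rightarrow> real \<Rightarrow> complex \<Rightarrow> complex" where
  "indef_sum_kernel f x \<xi> = Gamma \<xi> * f \<xi> * of_real x powr (- \<xi>)"

definition indef_sum_inner :: "real \<Rightarrow> (complex \<Rightarrow> complex) \<Rightarrow> real \<Rightarrow> complex" where
  "indef_sum_inner \<sigma> f x =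
     of_real (exp x) / (2 * of_real pi * \<i>) * vertical_integral \<sigma> (indef_sum_kernel f x)"

definition indef_sum_outer :: "real \<Rightarrow> (complex \<Rightarrow> complex) \<Rightarrow> complex \<Rightarrow> real \<Rightarrow> complex" where
  "indef_sum_outer \<sigma> f z t =
     of_real t powr (z - 1) * of_real (exp (- t)) *
       (LINT x:{0<..<t}|lborel. indef_sum_inner \<sigma> f x)"

definition indef_sum :: "real \<Rightarrow> (complex \<Rightarrow> complex) \<Rightarrow> complex \<Rightarrow> complex" where
  "indef_sum \<sigma> f z = 1 / Gamma z * (LINT t:{0<..}|lborel. indef_sum_outer \<sigma> f z t)"

definition indef_sum_converges :: "real \<Rightarrow> (complex \<Rightarrow> complex) \<Rightarrow> complex \<Rightarrow> bool" where
  "indef_sum_converges \<sigma> f z \<longleftrightarrow>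
     (\<forall>x>0. vertical_integrable \<sigma> (indef_sum_kernel f x)) \<and>
     (\<forall>t>0. set_integrable lborel {0<..<t} (indef_sum_inner \<sigma> f)) \<and>
     set_integrable lborel {0<..} (indef_sum_outer \<sigma> f z)"

definition vartheta_term :: "(complex \<Rightarrow> complex) \<Rightarrow> complex \<Rightarrow> nat \<Rightarrow> complex" where
  "vartheta_term f x n = (\<Sum>j=1..n+1. f (of_nat j)) * (x ^ n / fact n)"

definition vartheta :: "(complex \<Rightarrow> complex) \<Rightarrow> complex \<Rightarrow> complex" where
  "vartheta f x = (\<Sum>n. vartheta_term f x n)"

definition rhs_term :: "(complex \<Rightarrow> complex) \<Rightarrow> complex \<Rightarrow> nat \<Rightarrow> complex" where
  "rhs_term f z n =
     (\<Sum>j=1..n+1. f (of_nat j)) * ((-1) ^ n / (fact n * (of_nat n + 1 - z)))"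

definition rhs_integrand :: "(complex \<Rightarrow> complex) \<Rightarrow> complex \<Rightarrow> real \<Rightarrow> complex" where
  "rhs_integrand f z x = vartheta f (- of_real x) * of_real x powr (- z)"

text \<open>
  The next expression has its intended meaning for \<open>z\<close> not a positive integer; at a
  positive integer only its limit is meaningful.
\<close>

definition rhs :: "(complex \<Rightarrow> complex) \<Rightarrow> complex \<Rightarrow> complex" where
  "rhs f z = 1 / Gamma (1 - z) *
     ((\<Sum>n. rhs_term f z n) + (LINT x:{1..}|lborel. rhs_integrand f z x))"

end

theory Submission
  imports Defs
begin

text \<open>
  Shifting the line of integration interpolates the partial sums of \<open>f\<close>: for \<open>0 < c\<close>, \<open>c\<close> not an
  integer and \<open>c - 1 < Re z < c\<close>, the function
  \<open>F z = (\<Sum>j<c. f j) + 1/(2\<i>) \<integral>\<^bsub>Re \<xi> = c\<^esub> f \<xi> (cot (\<pi> (\<xi> - z)) - cot (\<pi> \<xi>)) d\<xi>\<close>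
  does not depend on \<open>c\<close>, is holomorphic for \<open>Re z > -1\<close>, satisfies \<open>F n = f 1 + \<dots> + f n\<close> and
  \<open>F z - F (z - 1) = f z\<close>, and grows at most like \<open>exp (\<alpha> \<bar>Im z\<bar> + \<kappa> Re z)\<close> with \<open>\<alpha> < \<pi>/2\<close>.
  Both sides of the corollary equal \<open>F z\<close>.

  Since \<open>F 0 = 0\<close>, the difference equation turns the inner integrand of the indefinite sum into
  \<open>d/dx (exp x \<integral> Gamma s F s x\<^bsup>-s\<^esup> ds)\<close>, integrated over the line \<open>Re s = -1/4\<close>.
  The outer integral is split at \<open>t = 1\<close>; the two halves are integrals of
  \<open>Gamma s F s / (s - z)\<close> over vertical lines on either side of \<open>z\<close>, so that their sum is the residue
  \<open>Gamma z F z\<close> at \<open>z\<close>.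

  On the other side, \<open>\<vartheta> (-x)\<close> is the sum of the residues of \<open>Gamma s F (1 - s) x\<^bsup>-s\<^esup>\<close> at the poles of
  \<open>Gamma\<close>. The integral over \<open>x \<ge> 1\<close> becomes an integral of \<open>Gamma s F (1 - s) / (s + z - 1)\<close> over a
  vertical line, and closing that line to the left yields minus the series together with the residue
  \<open>Gamma (1 - z) F z\<close> at \<open>s = 1 - z\<close>.
\<close>

section \<open>Vertical line integrals\<close>

text \<open>Convergence rests on a competition of exponential rates along vertical lines.
  \<open>Gamma s\<close> decays at every rate below pi/2, so the interpolant of the partial sums
  must not grow faster in the imaginary direction than \<open>f\<close> does. The difference of
  cotangents achieves this: a single cotangent is merely bounded far from the real axis and would
  leave a divergent integral, whereas the difference decays like exp (-2 pi |Im \<xi>|), vanishes at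
  integer \<open>z\<close>, and costs only exp (\<alpha> |Im z|) after integration.

  The second obstacle is the point x = 0. Integrating d/dx (exp x * x powr -s) from 0 needs Re s <
  0, a line beyond the pole of \<open>Gamma\<close> at 0. The zero of the interpolant at 0 makes
  that crossing free of residues, and this is why it is built on Re z > -1 although \<open>f\<close>
  lives only on Re z > 0.

  In the real direction no sharp rate matters: midway between its poles \<open>Gamma\<close> is of
  size 1/N!, which beats exp (\<kappa> N) for every \<kappa>.\<close>

lemma set_integrable_lborel_nonneg:
  fixes f :: "real \<Rightarrow> real"
  assumes "f integrable_on S" "\<And>x. x \<in> S \<Longrightarrow> 0 \<le> f x"
    and [measurable]: "S \<in> sets borel" "f \<in> borel_measurable borel"
  shows "set_integrable lborel S f"
proof -
  have "f absolutely_integrable_on S"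
    using assms by (intro nonnegative_absolutely_integrable_1) auto
  then show ?thesis
    unfolding set_integrable_def by (subst (asm) integrable_completion) auto
qed

text \<open>Measurability of \<open>h\<close> can be left open: if \<open>h\<close> is not
  integrable its integral is 0 by convention, and \<open>g\<close> is nonnegative because it
  dominates a norm.\<close>

lemma norm_integral_le_of_bound:
  fixes h :: "'a \<Rightarrow> complex"
  assumes "integrable M g" "\<And>x. norm (h x) \<le> g x"
  shows "norm (integral\<^sup>L M h) \<le> integral\<^sup>L M g"
proof (cases "integrable M h")
  case True
  then have "norm (integral\<^sup>L M h) \<le> (LINT x|M. norm (h x))" by simp
  also have "\<dots> \<le> integral\<^sup>L M g"
    using True assms by (intro integral_mono) auto
  finally show ?thesis .
next
  case False
  have "0 \<le> integral\<^sup>L M g"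
    using assms(2) by (intro integral_nonneg_AE) (auto intro: order_trans[OF norm_ge_zero])
  then show ?thesis using False by (simp add: not_integrable_integral_eq)
qed

lemma integrable_exp_minus_abs:
  fixes d :: real
  assumes "d > 0"
  shows "integrable lborel (\<lambda>y::real. exp (- d * \<bar>y\<bar>))"
proof -
  have 1: "set_integrable lborel {0..} (\<lambda>y::real. exp (- d * y))"
    by (intro set_integrable_lborel_nonneg integrable_on_exp_minus_to_infinity assms) auto
  have 2: "integrable lborel (\<lambda>y::real. indicator {0..} y *\<^sub>R exp (- d * y))"
    using 1 unfolding set_integrable_def .
  have 3: "integrable lborel (\<lambda>y::real. indicator {0..} (0 + (-1) * y) *\<^sub>R exp (- d * (0 + (-1) * y)))"
    by (rule lborel_integrable_real_affine[OF 2]) auto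
  have "integrable lborel (\<lambda>y::real. indicator {0..} y *\<^sub>R exp (- d * y) +
          indicator {0..} (0 + (-1) * y) *\<^sub>R exp (- d * (0 + (-1) * y)))"
    using 2 3 by (rule Bochner_Integration.integrable_add)
  then show ?thesis
    by (rule Bochner_Integration.integrable_bound) (auto simp: indicator_def)
qed

lemma integrable_exp_decay:
  fixes h :: "real \<Rightarrow> complex"
  assumes cont: "continuous_on UNIV h" and d: "d > 0"
    and bd: "\<And>y. \<bar>y\<bar> \<ge> Y \<Longrightarrow> norm (h y) \<le> M * exp (- d * \<bar>y\<bar>)"
  shows "integrable lborel h"
proof -
  have "compact (h ` {-\<bar>Y\<bar>..\<bar>Y\<bar>})"
    by (intro compact_continuous_image continuous_on_subset[OF cont]) auto
  then obtain K where K: "\<And>y. y \<in> {-\<bar>Y\<bar>..\<bar>Y\<bar>} \<Longrightarrow> norm (h y) \<le> K"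
    by (meson bounded_iff compact_imp_bounded imageI)
  have K0: "0 \<le> K"
    using K[of 0] order_trans[OF norm_ge_zero[of "h 0"]] by auto
  \<comment> \<open>The second summand covers the compact part, where exp (d (|Y| - |y|)) is at
    least 1.\<close>
  define M' where "M' = \<bar>M\<bar> + K * exp (d * \<bar>Y\<bar>)"
  have "norm (h y) \<le> M' * exp (- d * \<bar>y\<bar>)" for y
  proof (cases "\<bar>y\<bar> \<ge> \<bar>Y\<bar>")
    case True
    then have "norm (h y) \<le> M * exp (- d * \<bar>y\<bar>)" by (intro bd) auto
    also have "\<dots> \<le> M' * exp (- d * \<bar>y\<bar>)"
      using K0 by (intro mult_right_mono) (auto simp: M'_def intro: add_increasing2)
    finally show ?thesis .
  next
    case False
    then have "y \<in> {-\<bar>Y\<bar>..\<bar>Y\<bar>}" by (simp add: abs_if split: if_splits)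
    then have "norm (h y) \<le> K * 1" using K[of y] by auto
    also have "\<dots> \<le> K * exp (d * (\<bar>Y\<bar> - \<bar>y\<bar>))"
      using False d K0 by (intro mult_left_mono) auto
    also have "\<dots> = K * exp (d * \<bar>Y\<bar>) * exp (- d * \<bar>y\<bar>)"
      by (simp add: algebra_simps flip: exp_add)
    also have "\<dots> \<le> M' * exp (- d * \<bar>y\<bar>)"
      by (intro mult_right_mono) (auto simp: M'_def)
    finally show ?thesis .
  qed
  then show ?thesis
    using cont
    by (intro Bochner_Integration.integrable_bound[OF integrable_mult_right[OF integrable_exp_minus_abs[OF d], of M']])
       (auto intro: borel_measurable_continuous_onI order_trans[OF _ abs_ge_self])
qed

lemma continuous_on_vertical:
  assumes "G holomorphic_on S" "\<And>y. Complex c y \<in> S"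
  shows "continuous_on UNIV (\<lambda>y. G (Complex c y))"
proof (rule continuous_on_compose2[of S G UNIV])
  show "continuous_on S G" by (rule holomorphic_on_imp_continuous_on) fact
  show "continuous_on UNIV (Complex c)"
    unfolding Complex_eq by (intro continuous_intros)
qed (use assms in auto)

lemma vertical_integral_tendsto:
  fixes h :: "real \<Rightarrow> complex"
  assumes "integrable lborel h"
  shows "(\<lambda>n. integral {- real n..real n} h) \<longlonglongrightarrow> (LINT y|lborel. h y)"
proof -
  have "(\<lambda>n. LINT y|lborel. indicator {- real n..real n} y *\<^sub>R h y) \<longlonglongrightarrow> (LINT y|lborel. h y)"
  proof (rule integral_dominated_convergence)
    show "integrable lborel (\<lambda>y. norm (h y))" using assms by auto
    show "AE y in lborel. (\<lambda>n. indicator {- real n..real n} y *\<^sub>R h y) \<longlonglongrightarrow> h y"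
    proof (intro AE_I2)
      fix y :: real
      have "eventually (\<lambda>n. real n \<ge> \<bar>y\<bar>) sequentially"
        using eventually_ge_at_top[of "nat \<lceil>\<bar>y\<bar>\<rceil>"] by eventually_elim linarith
      then have "eventually (\<lambda>n. indicator {- real n..real n} y *\<^sub>R h y = h y) sequentially"
        by eventually_elim (auto simp: indicator_def)
      then show "(\<lambda>n. indicator {- real n..real n} y *\<^sub>R h y) \<longlonglongrightarrow> h y"
        by (rule tendsto_eventually)
    qed
  qed (use assms in \<open>auto simp: indicator_def\<close>)
  moreover have "(LINT y|lborel. indicator {- real n..real n} y *\<^sub>R h y) = integral {- real n..real n} h" for n
  proof -
    have "set_integrable lborel {- real n..real n} h"
      using assms unfolding set_integrable_def by (rule integrable_mult_indicator[rotated]) auto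
    from set_borel_integral_eq_integral(2)[OF this] show ?thesis
      unfolding set_lebesgue_integral_def .
  qed
  ultimately show ?thesis by simp
qed

text \<open>Residue theorem on the rectangles of height \<open>n\<close> between the two lines; the
  exponential bound makes the horizontal sides vanish as \<open>n\<close> grows. The slightly wider
  strip between \<open>a'\<close> and \<open>b'\<close> provides an open domain around the closed
  one. The integrals are taken in dy, so the factor i of 2 pi i has cancelled.\<close>

lemma vertical_shift:
  fixes G :: "complex \<Rightarrow> complex"
  assumes ab: "a' < a" "a < b" "b < b'" and fin: "finite P"
    and hol: "G holomorphic_on {s. a' < Re s \<and> Re s < b'} - P"
    and P: "\<And>p. p \<in> P \<Longrightarrow> a < Re p \<and> Re p < b"
    and d: "d > 0"
    and bd: "\<And>s. a \<le> Re s \<Longrightarrow> Re s \<le> b \<Longrightarrow> \<bar>Im s\<bar> \<ge> Y \<Longrightarrow> norm (G s) \<le> M * exp (- d * \<bar>Im s\<bar>)"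
  shows "integrable lborel (\<lambda>y. G (Complex a y))" "integrable lborel (\<lambda>y. G (Complex b y))"
    "(LINT y|lborel. G (Complex b y)) - (LINT y|lborel. G (Complex a y)) = 2 * pi * (\<Sum>p\<in>P. residue G p)"
proof -
  define S where "S = {s. a' < Re s \<and> Re s < b'}"
  have S: "open S" "convex S"
  proof -
    have "S = {s. a' < Re s} \<inter> {s. Re s < b'}" by (auto simp: S_def)
    then show "open S" "convex S"
      by (auto intro!: open_halfspace_Re_gt open_halfspace_Re_lt convex_Int convex_halfspace_Re_gt convex_halfspace_Re_lt)
  qed
  have ca: "continuous_on UNIV (\<lambda>y. G (Complex a y))"
    by (rule continuous_on_vertical[OF hol]) (use ab P in force)
  have cb: "continuous_on UNIV (\<lambda>y. G (Complex b y))"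
    by (rule continuous_on_vertical[OF hol]) (use ab P in force)
  show ia: "integrable lborel (\<lambda>y. G (Complex a y))"
    using bd[of "Complex a _"] ab by (intro integrable_exp_decay[OF ca d, of Y M]) auto
  show ib: "integrable lborel (\<lambda>y. G (Complex b y))"
    using bd[of "Complex b _"] ab by (intro integrable_exp_decay[OF cb d, of Y M]) auto
  \<comment> \<open>Beyond the height \<open>Z\<close> the rectangle encloses every point of
    \<open>P\<close>, and its horizontal sides lie where the decay bound applies.\<close>
  define Z where "Z = Max (insert \<bar>Y\<bar> ((\<lambda>p. \<bar>Im p\<bar>) ` P))"
  have Z: "Z \<ge> Y" "Z \<ge> 0" "\<And>p. p \<in> P \<Longrightarrow> \<bar>Im p\<bar> \<le> Z"
  proof -
    have *: "\<bar>Y\<bar> \<le> Z" unfolding Z_def using fin by (intro Max_ge) auto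
    show "Z \<ge> Y" "Z \<ge> 0" using * by auto
    show "\<bar>Im p\<bar> \<le> Z" if "p \<in> P" for p
      unfolding Z_def using fin that by (intro Max_ge) auto
  qed
  define R where "R = (2 * pi * (\<Sum>p\<in>P. residue G p) :: complex)"
  have main: "norm (integral {- real n..real n} (\<lambda>y. G (Complex b y)) - integral {- real n..real n} (\<lambda>y. G (Complex a y)) - R)
      \<le> 2 * (b - a) * \<bar>M\<bar> * exp (- d * real n)" if n: "real n > Z" for n
  proof -
    define a1 a2 a3 a4 where "a1 = Complex a (- real n)" and "a2 = Complex b (- real n)"
      and "a3 = Complex b (real n)" and "a4 = Complex a (real n)"
    have img: "path_image (rectpath a1 a3) \<subseteq> S - P"
      using n Z ab P by (subst path_image_rectpath) (force simp: a1_def a3_def S_def)+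
    have segs: "closed_segment a1 a2 \<subseteq> S - P" "closed_segment a2 a3 \<subseteq> S - P" "closed_segment a3 a4 \<subseteq> S - P" "closed_segment a4 a1 \<subseteq> S - P"
      using img by (auto simp: rectpath_def Let_def a1_def a2_def a3_def a4_def path_image_join)
    have cont: "continuous_on (S - P) G"
      using hol unfolding S_def by (rule holomorphic_on_imp_continuous_on)
    have int: "G contour_integrable_on linepath a1 a2" "G contour_integrable_on linepath a2 a3"
      "G contour_integrable_on linepath a3 a4" "G contour_integrable_on linepath a4 a1"
      using segs cont by (auto intro!: contour_integrable_continuous_linepath intro: continuous_on_subset)
    have "contour_integral (rectpath a1 a3) G = 2 * pi * \<i> * (\<Sum>p\<in>P. winding_number (rectpath a1 a3) p * residue G p)"
    proof (rule Residue_theorem[of S P])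
      show "\<forall>z. z \<notin> S \<longrightarrow> winding_number (rectpath a1 a3) z = 0"
        using n Z ab by (auto intro!: winding_number_rectpath_outside simp: a1_def a3_def S_def in_cbox_complex_iff)
    qed (use S fin hol img in \<open>auto simp: S_def convex_connected\<close>)
    also have "(\<Sum>p\<in>P. winding_number (rectpath a1 a3) p * residue G p) = (\<Sum>p\<in>P. residue G p)"
    proof (rule sum.cong)
      fix p assume "p \<in> P"
      then have "p \<in> box a1 a3"
        using P[of p] Z(3)[of p] n by (auto simp: a1_def a3_def in_box_complex_iff)
      then show "winding_number (rectpath a1 a3) p * residue G p = residue G p"
        by (simp add: winding_number_rectpath)
    qed simp
    finally have eq: "contour_integral (rectpath a1 a3) G = \<i> * R" by (simp add: R_def)
    have "contour_integral (rectpath a1 a3) G = contour_integral (linepath a1 a2) G + contour_integral (linepath a2 a3) G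
        + contour_integral (linepath a3 a4) G + contour_integral (linepath a4 a1) G"
      using int by (simp add: rectpath_def Let_def a1_def a2_def a3_def a4_def contour_integrable_joinI)
    also have "contour_integral (linepath a2 a3) G = \<i> * integral {- real n..real n} (\<lambda>y. G (Complex b y))"
      using n Z by (intro contour_integral_linepath_same_Re) (auto simp: a2_def a3_def)
    also have "contour_integral (linepath a4 a1) G = - contour_integral (linepath a1 a4) G"
      by (metis contour_integral_reversepath reversepath_linepath valid_path_linepath)
    also have "contour_integral (linepath a1 a4) G = \<i> * integral {- real n..real n} (\<lambda>y. G (Complex a y))"
      using n Z by (intro contour_integral_linepath_same_Re) (auto simp: a1_def a4_def)
    finally have "\<i> * (integral {- real n..real n} (\<lambda>y. G (Complex b y)) - integral {- real n..real n} (\<lambda>y. G (Complex a y)) - R)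
        = - contour_integral (linepath a1 a2) G - contour_integral (linepath a3 a4) G"
      using eq by (simp add: algebra_simps)
    then have "norm (integral {- real n..real n} (\<lambda>y. G (Complex b y)) - integral {- real n..real n} (\<lambda>y. G (Complex a y)) - R)
        = norm (- contour_integral (linepath a1 a2) G - contour_integral (linepath a3 a4) G)"
      by (metis (no_types, lifting) mult_1 norm_ii norm_mult)
    also have "\<dots> \<le> norm (contour_integral (linepath a1 a2) G) + norm (contour_integral (linepath a3 a4) G)"
      by (metis norm_minus_cancel norm_triangle_ineq4)
    also have "\<dots> \<le> (\<bar>M\<bar> * exp (- d * real n)) * norm (a2 - a1) + (\<bar>M\<bar> * exp (- d * real n)) * norm (a4 - a3)"
    proof (intro add_mono contour_integral_bound_linepath int)
      fix s assume "s \<in> closed_segment a1 a2"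
      then have "Re s \<in> {a..b}" "Im s = - real n"
        using ab by (auto simp: closed_segment_same_Im a1_def a2_def closed_segment_eq_real_ivl)
      then have "norm (G s) \<le> M * exp (- d * real n)"
        using bd[of s] n Z by auto
      also have "\<dots> \<le> \<bar>M\<bar> * exp (- d * real n)" by (intro mult_right_mono) auto
      finally show "norm (G s) \<le> \<bar>M\<bar> * exp (- d * real n)" .
    next
      fix s assume "s \<in> closed_segment a3 a4"
      then have "Re s \<in> {a..b}" "Im s = real n"
        using ab by (auto simp: closed_segment_same_Im a3_def a4_def closed_segment_eq_real_ivl)
      then have "norm (G s) \<le> M * exp (- d * real n)"
        using bd[of s] n Z by auto
      also have "\<dots> \<le> \<bar>M\<bar> * exp (- d * real n)" by (intro mult_right_mono) auto
      finally show "norm (G s) \<le> \<bar>M\<bar> * exp (- d * real n)" .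
    qed auto
    also have "norm (a2 - a1) = b - a" using ab by (auto simp: a1_def a2_def norm_complex_def)
    also have "norm (a4 - a3) = b - a" using ab by (auto simp: a3_def a4_def norm_complex_def)
    finally show ?thesis by (simp add: algebra_simps)
  qed
  have "(\<lambda>n. integral {- real n..real n} (\<lambda>y. G (Complex b y)) - integral {- real n..real n} (\<lambda>y. G (Complex a y)) - R) \<longlonglongrightarrow> 0"
  proof (rule Lim_null_comparison)
    have "eventually (\<lambda>n. real n > Z) sequentially"
      using eventually_gt_at_top[of "nat \<lceil>Z\<rceil>"] by eventually_elim linarith
    then show "\<forall>\<^sub>F n in sequentially. norm (integral {- real n..real n} (\<lambda>y. G (Complex b y)) - integral {- real n..real n} (\<lambda>y. G (Complex a y)) - R)
        \<le> 2 * (b - a) * \<bar>M\<bar> * exp (- d * real n)"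
      by eventually_elim (rule main)
    have "(\<lambda>n. exp (- d) ^ n) \<longlonglongrightarrow> 0" using d by (intro LIMSEQ_power_zero) auto
    then have "(\<lambda>n. exp (- d * real n)) \<longlonglongrightarrow> 0"
      by (simp add: mult.commute flip: exp_of_nat_mult)
    from tendsto_mult_left[OF this, of "2 * (b - a) * \<bar>M\<bar>"]
    show "(\<lambda>n. 2 * (b - a) * \<bar>M\<bar> * exp (- d * real n)) \<longlonglongrightarrow> 0" by simp
  qed
  moreover have "(\<lambda>n. integral {- real n..real n} (\<lambda>y. G (Complex b y)) - integral {- real n..real n} (\<lambda>y. G (Complex a y)) - R)
      \<longlonglongrightarrow> (LINT y|lborel. G (Complex b y)) - (LINT y|lborel. G (Complex a y)) - R"
    by (intro tendsto_intros vertical_integral_tendsto ia ib)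
  ultimately have "(LINT y|lborel. G (Complex b y)) - (LINT y|lborel. G (Complex a y)) - R = 0"
    using LIMSEQ_unique by blast
  then show "(LINT y|lborel. G (Complex b y)) - (LINT y|lborel. G (Complex a y)) = 2 * pi * (\<Sum>p\<in>P. residue G p)"
    by (simp add: R_def)
qed

section \<open>Decay of the Gamma function on vertical lines\<close>

lemma norm_pochhammer: "norm (pochhammer (s::complex) n) = (\<Prod>i<n. norm (s + of_nat i))"
  by (simp add: pochhammer_prod prod_norm atLeast0LessThan)

text \<open>By the limit formula of Gauss each side is the limit of the products of (v + k) / |v + k
  + i y|, and every such factor increases with v. This compares \<open>Gamma\<close> inside a whole
  strip with its values on a single line further to the right.\<close>

lemma norm_Gamma_ratio_mono:
  fixes x u y :: real
  assumes "0 < x" "x \<le> u"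
  shows "norm (Gamma (Complex x y)) / Gamma x \<le> norm (Gamma (Complex u y)) / Gamma u"
proof -
  have step: "norm (Gamma_series (Complex x y) n) / Gamma_series x n \<le> norm (Gamma_series (Complex u y) n) / Gamma_series u n" 
    if n: "n > 0" for n
  proof -
    have eq: "norm (Gamma_series (Complex v y) n) / Gamma_series v n = (\<Prod>i<n+1. (v + real i) / norm (Complex v y + of_nat i))"
      if v: "v > 0" for v :: real
    proof -
      have 1: "norm (exp (Complex v y * of_real (ln (real n)))) = exp (v * ln (real n))"
        by simp
      have "norm (pochhammer (Complex v y) (n+1)) > 0"
        unfolding norm_pochhammer
      proof (intro prod_pos ballI)
        fix i show "0 < norm (Complex v y + of_nat i)"
          using v by (simp add: norm_complex_def add_pos_nonneg)
      qed
      moreover have "pochhammer v (n+1) > 0" using v by (intro pochhammer_pos) auto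
      ultimately have "norm (Gamma_series (Complex v y) n) / Gamma_series v n = pochhammer v (n+1) / norm (pochhammer (Complex v y) (n+1))"
        unfolding Gamma_series_def norm_divide norm_mult 1 
        by (simp add: norm_fact field_simps)
      also have "\<dots> = (\<Prod>i<n+1. (v + real i) / norm (Complex v y + of_nat i))"
        unfolding norm_pochhammer by (simp add: pochhammer_prod prod_dividef atLeast0LessThan)
      finally show ?thesis .
    qed
    have "(x + real i) / norm (Complex x y + of_nat i) \<le> (u + real i) / norm (Complex u y + of_nat i)" for i
    proof -
      define p q where "p = x + real i" and "q = u + real i"
      have pq: "0 < p" "p \<le> q" using assms by (auto simp: p_def q_def)
      have "p * sqrt (q\<^sup>2 + y\<^sup>2) = sqrt (p\<^sup>2 * (q\<^sup>2 + y\<^sup>2))"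
        using pq by (simp add: real_sqrt_mult)
      also have "\<dots> \<le> sqrt (q\<^sup>2 * (p\<^sup>2 + y\<^sup>2))"
        using pq by (auto simp: algebra_simps intro!: mult_right_mono power_mono)
      also have "\<dots> = q * sqrt (p\<^sup>2 + y\<^sup>2)"
        using pq by (simp add: real_sqrt_mult)
      finally have "p * sqrt (q\<^sup>2 + y\<^sup>2) \<le> q * sqrt (p\<^sup>2 + y\<^sup>2)" .
      moreover have "sqrt (p\<^sup>2 + y\<^sup>2) > 0" "sqrt (q\<^sup>2 + y\<^sup>2) > 0"
        using pq by (auto simp: add_pos_nonneg)
      ultimately show ?thesis
        unfolding norm_complex_def by (simp add: divide_simps flip: p_def q_def)
    qed
    then have "(\<Prod>i<n+1. (x + real i) / norm (Complex x y + of_nat i)) \<le> (\<Prod>i<n+1. (u + real i) / norm (Complex u y + of_nat i))"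
      using assms by (intro prod_mono) auto
    then show ?thesis using eq[of x] eq[of u] assms by simp
  qed
  have lim: "(\<lambda>n. norm (Gamma_series (Complex v y) n) / Gamma_series v n) \<longlonglongrightarrow> norm (Gamma (Complex v y)) / Gamma v"
    if "v > 0" for v :: real
    by (intro tendsto_intros) (use Gamma_real_pos[OF that] in auto)
  show ?thesis
    by (rule LIMSEQ_le[OF lim lim]) (use assms step in \<open>auto intro!: exI[of _ 1]\<close>)
qed

text \<open>The reflection formula gives |Gamma (1 + i y)|^2 = pi y / sinh (pi y), the origin of the
  critical rate pi/2. For |y| at least 1, exp (pi |y|) is at least 2, hence sinh is at least a
  quarter of the exponential.\<close>

lemma norm_Gamma_1_Im_le:
  fixes y :: real
  assumes "\<bar>y\<bar> \<ge> 1"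
  shows "(norm (Gamma (Complex 1 y)))\<^sup>2 \<le> 4 * pi * \<bar>y\<bar> * exp (- pi * \<bar>y\<bar>)"
proof -
  have y0: "y \<noteq> 0" using assms by auto
  define w where "w = \<i> * of_real y"
  have w: "w \<notin> \<int>\<^sub>\<le>\<^sub>0" "w \<noteq> 0"
    using y0 by (auto simp: w_def complex_eq_iff elim!: nonpos_Ints_cases)
  have G1: "Gamma (Complex 1 y) = w * Gamma w"
    using Gamma_plus1[OF w(1)] by (simp add: w_def Complex_eq add.commute)
  have "Gamma (Complex 1 (-y)) = cnj (Gamma (Complex 1 y))"
    by (metis complex_cnj cnj_Gamma)
  then have "Gamma (Complex 1 y) * Gamma (Complex 1 (-y)) = of_real ((norm (Gamma (Complex 1 y)))\<^sup>2)"
    by (metis complex_norm_square of_real_power)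
  moreover have "Gamma (Complex 1 y) * Gamma (Complex 1 (-y)) = w * (Gamma w * Gamma (1 - w))"
    unfolding G1 by (simp add: w_def Complex_eq)
  moreover have "\<dots> = w * (of_real pi / sin (of_real pi * w))"
    unfolding Gamma_reflection_complex ..
  ultimately have "(norm (Gamma (Complex 1 y)))\<^sup>2 = norm (w * (of_real pi / sin (of_real pi * w)))"
    by (metis abs_of_nonneg norm_of_real zero_le_power2)
  also have "\<dots> = \<bar>y\<bar> * pi / norm (sin (of_real pi * w))"
    by (simp add: w_def norm_mult norm_divide)
  also have "sin (of_real pi * w) = \<i> * of_real (sinh (pi * y))"
    using sinh_real[of "pi * y"] by (simp add: w_def sinh_field_def exp_minus mult_ac)
  also have "norm \<dots> = sinh (pi * \<bar>y\<bar>)"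
    by (auto simp: norm_mult abs_if mult_less_0_iff)
  also have "\<bar>y\<bar> * pi / sinh (pi * \<bar>y\<bar>) \<le> \<bar>y\<bar> * pi / (exp (pi * \<bar>y\<bar>) / 4)"
  proof (intro divide_left_mono mult_pos_pos)
    have "1 * 1 \<le> pi * \<bar>y\<bar>" using assms pi_gt3 by (intro mult_mono) auto
    then have "1 + 1 \<le> exp (pi * \<bar>y\<bar>)" using exp_ge_add_one_self[of "pi * \<bar>y\<bar>"] by linarith
    moreover have "exp (- (pi * \<bar>y\<bar>)) \<le> 1" using \<open>1 * 1 \<le> pi * \<bar>y\<bar>\<close> by simp
    moreover have "E / 4 \<le> (E - e) / 2" if "1 + 1 \<le> E" "e \<le> 1" for E e :: real
      using that by simp
    ultimately show "exp (pi * \<bar>y\<bar>) / 4 \<le> sinh (pi * \<bar>y\<bar>)"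
      unfolding sinh_field_def by blast
    show "sinh (pi * \<bar>y\<bar>) > 0" using y0 by simp
  qed auto
  also have "\<dots> = 4 * pi * \<bar>y\<bar> * exp (- pi * \<bar>y\<bar>)"
    by (simp add: exp_minus field_simps)
  finally show ?thesis .
qed

text \<open>The rate \<open>e\<close> is shared out among the factors: each of them is at most
  \<open>2 * K0\<close> times exp (e y / (m + 1)). The denominator m + 1 keeps the share defined for
  m = 0.\<close>

lemma power_le_exp:
  fixes e :: real
  assumes "e > 0" "c \<ge> 0"
  obtains K where "K > 0" "\<And>y. y \<ge> 0 \<Longrightarrow> (c + y) ^ m \<le> K * exp (e * y)"
proof
  have "e / (real m + 1) > 0" using assms by simp
  define K0 where "K0 = max 1 (max c (1 / (e / (real m + 1))))"
  have K0: "K0 \<ge> 1" "K0 \<ge> c" "K0 * (e / (real m + 1)) \<ge> 1"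
  proof -
    show "K0 \<ge> 1" "K0 \<ge> c" by (auto simp: K0_def)
    have "1 / (e / (real m + 1)) * (e / (real m + 1)) \<le> K0 * (e / (real m + 1))"
      using assms by (intro mult_right_mono) (auto simp: K0_def)
    then show "K0 * (e / (real m + 1)) \<ge> 1" using assms by simp
  qed
  show "(2 * K0) ^ m > 0" using K0 by simp
  fix y :: real assume y: "y \<ge> 0"
  have "y \<le> K0 * (e / (real m + 1)) * y"
    using mult_right_mono[OF K0(3) y] by simp
  also have "\<dots> \<le> K0 * exp (e / (real m + 1) * y)"
    using exp_ge_add_one_self[of "e / (real m + 1) * y"] K0 by (subst mult.assoc, intro mult_left_mono) linarith+
  finally have 1: "y \<le> K0 * exp (e / (real m + 1) * y)" .
  have "c \<le> K0 * 1" using K0 by simp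
  also have "\<dots> \<le> K0 * exp (e / (real m + 1) * y)"
    using assms y K0 by (intro mult_left_mono) auto
  finally have "c + y \<le> 2 * K0 * exp (e / (real m + 1) * y)" using 1 by simp
  then have "(c + y) ^ m \<le> (2 * K0 * exp (e / (real m + 1) * y)) ^ m"
    using assms y by (intro power_mono) auto
  also have "\<dots> = (2 * K0) ^ m * exp (real m * (e / (real m + 1) * y))"
    unfolding power_mult_distrib exp_of_nat_mult ..
  also have "\<dots> \<le> (2 * K0) ^ m * exp (e * y)"
  proof -
    have "real m * e \<le> e * (real m + 1)" using assms by (simp add: algebra_simps)
    then have "real m * (e / (real m + 1)) \<le> e" by (simp add: field_simps)
    from mult_right_mono[OF this y] show ?thesis
      using K0 by (intro mult_left_mono) (auto simp: mult.assoc)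
  qed
  finally show "(c + y) ^ m \<le> (2 * K0) ^ m * exp (e * y)" .
qed

text \<open>The recurrence moves \<open>s\<close> into the region Re s >= 1, at no cost because |Im
  s| >= 1 makes every factor at least 1 in modulus. Monotonicity of the ratio then passes to the
  line Re = m + 1, and the recurrence leads back to Re = 1, where the rate pi/2 is known. The
  polynomial loss is absorbed by the gap between \<beta> and pi/2.\<close>

lemma Gamma_vertical_decay:
  fixes a b \<beta> :: real
  assumes \<beta>: "0 \<le> \<beta>" "\<beta> < pi / 2"
  obtains B where "B > 0"
    "\<And>s. a \<le> Re s \<Longrightarrow> Re s \<le> b \<Longrightarrow> \<bar>Im s\<bar> \<ge> 1 \<Longrightarrow> norm (Gamma s) \<le> B * exp (- \<beta> * \<bar>Im s\<bar>)"
proof -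
  define N where "N = nat \<lceil>\<bar>a\<bar> + 1\<rceil>"
  define m where "m = nat \<lceil>\<bar>b\<bar> + real N + 1\<rceil>"
  have N: "a + real N \<ge> 1" "real N \<ge> 1" unfolding N_def by linarith+
  have m: "b + real N \<le> real m + 1" unfolding m_def by linarith
  have "continuous_on {1..real m + 1} (Gamma :: real \<Rightarrow> real)"
    by (intro continuous_intros) (auto elim!: nonpos_Ints_cases)
  then have "compact ((Gamma :: real \<Rightarrow> real) ` {1..real m + 1})"
    by (intro compact_continuous_image) auto
  then obtain K where K: "\<And>x::real. x \<in> {1..real m + 1} \<Longrightarrow> norm (Gamma x) \<le> K"
    by (meson bounded_iff compact_imp_bounded imageI)
  have e: "pi / 2 - \<beta> > 0" using \<beta> by auto
  \<comment> \<open>The exponent m + 1 counts the m factors of the recurrence and one more for the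
    square root of |y| in the bound on the line Re = 1.\<close>
  obtain K2 where K2: "K2 > 0" "\<And>y. y \<ge> 0 \<Longrightarrow> (real m + 1 + y) ^ (m + 1) \<le> K2 * exp ((pi / 2 - \<beta>) * y)"
    using power_le_exp[OF e, of "real m + 1" "m + 1"] by auto
  define B where "B = 4 * (\<bar>K\<bar> + 1) * K2"
  show ?thesis
  proof (rule that[of B])
    show "B > 0" using K2 by (simp add: B_def)
    fix s :: complex assume s: "a \<le> Re s" "Re s \<le> b" "\<bar>Im s\<bar> \<ge> 1"
    define y where "y = Im s"
    have y1: "\<bar>y\<bar> \<ge> 1" using s by (simp add: y_def)
    define x where "x = Re s + real N"
    have x: "1 \<le> x" "x \<le> real m + 1" using s N m by (auto simp: x_def)
    have sN: "s + of_nat N = Complex x y" by (simp add: x_def y_def complex_eq_iff)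
    have s_ni: "s \<notin> \<int>\<^sub>\<le>\<^sub>0" using s by (auto elim!: nonpos_Ints_cases)
    have "norm (pochhammer s N) \<ge> 1"
      unfolding norm_pochhammer
    proof (rule prod_ge_1)
      fix i show "1 \<le> norm (s + of_nat i)"
        using s abs_Im_le_cmod[of "s + of_nat i"] by simp
    qed
    moreover have "pochhammer s N * Gamma s = Gamma (Complex x y)"
      using pochhammer_Gamma[OF s_ni, of N] s_ni by (simp add: sN Gamma_eq_zero_iff)
    ultimately have "norm (Gamma s) \<le> norm (Gamma (Complex x y))"
      by (metis mult_1 mult_right_mono norm_ge_zero norm_mult)
    also have "\<dots> \<le> Gamma x * (norm (Gamma (Complex (real m + 1) y)) / Gamma (real m + 1))"
      using norm_Gamma_ratio_mono[of x "real m + 1" y] x Gamma_real_pos[of x] by (simp add: field_simps)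
    also have "\<dots> \<le> \<bar>K\<bar> * (norm (Gamma (Complex (real m + 1) y)) / 1)"
    proof (intro mult_mono divide_left_mono)
      show "Gamma x \<le> \<bar>K\<bar>" using K[of x] x by auto
      show "1 \<le> Gamma (real m + 1)" using Gamma_fact[of m, where 'a = real] by (simp add: add.commute)
      show "0 \<le> norm (Gamma (Complex (real m + 1) y)) / Gamma (real m + 1)"
        using Gamma_real_pos[of "real m + 1"] by (intro divide_nonneg_pos) auto
    qed (auto intro!: Gamma_real_pos)
    also have "\<dots> \<le> (\<bar>K\<bar> + 1) * norm (Gamma (Complex (real m + 1) y))"
      by (simp add: mult_right_mono)
    also have "norm (Gamma (Complex (real m + 1) y)) \<le> (real m + 1 + \<bar>y\<bar>) ^ m * norm (Gamma (Complex 1 y))"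
    proof -
      have ni: "Complex 1 y \<notin> \<int>\<^sub>\<le>\<^sub>0" using y1 by (auto simp: complex_eq_iff elim!: nonpos_Ints_cases)
      have "Complex 1 y + of_nat m = Complex (real m + 1) y" by (simp add: complex_eq_iff)
      then have "Gamma (Complex (real m + 1) y) = pochhammer (Complex 1 y) m * Gamma (Complex 1 y)"
        using pochhammer_Gamma[OF ni, of m] ni by (simp add: Gamma_eq_zero_iff)
      moreover have "norm (pochhammer (Complex 1 y) m) \<le> (real m + 1 + \<bar>y\<bar>) ^ m"
      proof -
        have "norm (pochhammer (Complex 1 y) m) \<le> (\<Prod>i<m. real m + 1 + \<bar>y\<bar>)"
          unfolding norm_pochhammer
        proof (intro prod_mono conjI)
          fix i assume "i \<in> {..<m}"
          then show "norm (Complex 1 y + of_nat i) \<le> real m + 1 + \<bar>y\<bar>"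
            using cmod_le[of "Complex 1 y + of_nat i"] by auto
        qed auto
        then show ?thesis by simp
      qed
      ultimately show ?thesis by (simp add: norm_mult mult_right_mono)
    qed
    also have "norm (Gamma (Complex 1 y)) \<le> 4 * (real m + 1 + \<bar>y\<bar>) * exp (- (pi / 2) * \<bar>y\<bar>)"
    proof (rule power2_le_imp_le)
      have "(norm (Gamma (Complex 1 y)))\<^sup>2 \<le> 4 * pi * \<bar>y\<bar> * exp (- pi * \<bar>y\<bar>)"
        by (rule norm_Gamma_1_Im_le[OF y1])
      also have "\<dots> \<le> 16 * (real m + 1 + \<bar>y\<bar>)\<^sup>2 * exp (- pi * \<bar>y\<bar>)"
      proof (intro mult_right_mono)
        have "\<bar>y\<bar> * 1 \<le> (real m + 1 + \<bar>y\<bar>) * (real m + 1 + \<bar>y\<bar>)" using y1 by (intro mult_mono) auto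
        moreover have "4 * pi * \<bar>y\<bar> \<le> 16 * \<bar>y\<bar>" using pi_less_4 by (intro mult_right_mono) auto
        ultimately show "4 * pi * \<bar>y\<bar> \<le> 16 * (real m + 1 + \<bar>y\<bar>)\<^sup>2"
          unfolding power2_eq_square by linarith
      qed auto
      also have "\<dots> = (4 * (real m + 1 + \<bar>y\<bar>) * exp (- (pi / 2) * \<bar>y\<bar>))\<^sup>2"
        unfolding power_mult_distrib by (simp flip: exp_double)
      finally show "(norm (Gamma (Complex 1 y)))\<^sup>2 \<le> (4 * (real m + 1 + \<bar>y\<bar>) * exp (- (pi / 2) * \<bar>y\<bar>))\<^sup>2" .
    qed auto
    also have "(real m + 1 + \<bar>y\<bar>) ^ m * (4 * (real m + 1 + \<bar>y\<bar>) * exp (- (pi / 2) * \<bar>y\<bar>))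
        = 4 * ((real m + 1 + \<bar>y\<bar>) ^ (m + 1) * exp (- (pi / 2) * \<bar>y\<bar>))"
      by simp
    also have "\<dots> \<le> 4 * ((K2 * exp ((pi / 2 - \<beta>) * \<bar>y\<bar>)) * exp (- (pi / 2) * \<bar>y\<bar>))"
      by (intro mult_left_mono mult_right_mono K2) auto
    also have "\<dots> = 4 * K2 * exp (- \<beta> * \<bar>y\<bar>)"
      by (simp add: algebra_simps flip: exp_add)
    finally have "norm (Gamma s) \<le> (\<bar>K\<bar> + 1) * (4 * K2 * exp (- \<beta> * \<bar>y\<bar>))"
      by (simp add: mult_left_mono)
    then show "norm (Gamma s) \<le> B * exp (- \<beta> * \<bar>Im s\<bar>)"
      by (simp only: B_def y_def mult_ac)
  qed
qed

lemma residue_Gamma_mult: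
  assumes "open S" "- of_nat n \<in> S" "W holomorphic_on S"
  shows "residue (\<lambda>s. Gamma s * W s) (- of_nat n) = (-1) ^ n / fact n * W (- of_nat n)"
proof (rule residue_simple')
  \<comment> \<open>Every set of integers is closed, so removing the other poles of
    \<open>Gamma\<close> leaves an open set.\<close>
  let ?T = "S \<inter> - (\<int>\<^sub>\<le>\<^sub>0 - {- of_nat n :: complex})"
  show "open ?T"
    by (intro open_Int assms open_Compl closed_subset_Ints) auto
  show "- of_nat n \<in> ?T" using assms by auto
  show "(\<lambda>s. Gamma s * W s) holomorphic_on ?T - {- of_nat n}"
    using assms(3) by (intro holomorphic_intros) (auto intro: holomorphic_on_subset)
  have "isCont W (- of_nat n)"
    using assms holomorphic_on_imp_continuous_on continuous_on_eq_continuous_at by blast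
  then have "((\<lambda>s. (Gamma s * (s + of_nat n)) * W s) \<longlongrightarrow> ((-1) ^ n / fact n) * W (- of_nat n)) (at (- of_nat n))"
    unfolding isCont_def by (intro tendsto_mult Gamma_residues)
  then show "((\<lambda>s. Gamma s * W s * (s - - of_nat n)) \<longlongrightarrow> ((-1) ^ n / fact n) * W (- of_nat n)) (at (- of_nat n))"
    by (simp add: mult_ac)
qed

section \<open>Parametric integrals and Mellin transforms\<close>

text \<open>A majorant on a disc suffices: the Cauchy inequality on discs of half the radius bounds
  the derivative in \<open>z\<close>, hence also the difference quotients, by a multiple of
  \<open>b\<close>. Dominated convergence then differentiates under the integral.\<close>

lemma holomorphic_on_lborel_integral:
  fixes K :: "complex \<Rightarrow> real \<Rightarrow> complex"
  assumes "open S" and hol: "\<And>y. (\<lambda>z. K z y) holomorphic_on S"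
    and meas: "\<And>z. z \<in> S \<Longrightarrow> K z \<in> borel_measurable borel"
    and dom: "\<And>z. z \<in> S \<Longrightarrow> \<exists>r>0. \<exists>b. cball z r \<subseteq> S \<and> integrable lborel b \<and> (\<forall>w\<in>cball z r. \<forall>y. norm (K w y) \<le> b y)"
  shows "(\<lambda>z. LINT y|lborel. K z y) holomorphic_on S"
proof -
  have "(\<lambda>z. LINT y|lborel. K z y) field_differentiable at z" if z: "z \<in> S" for z
  proof -
    obtain r b where r: "r > 0" "cball z r \<subseteq> S" "integrable lborel b"
      and b: "\<And>w y. w \<in> cball z r \<Longrightarrow> norm (K w y) \<le> b y"
      using dom[OF z] by blast
    have int: "integrable lborel (K w)" if "w \<in> cball z r" for w
    proof (rule Bochner_Integration.integrable_bound[OF r(3)])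
      show "K w \<in> borel_measurable lborel" using meas r that by auto
    qed (use b[OF that] in \<open>auto intro: order_trans[OF _ abs_ge_self]\<close>)
    have sub: "cball w (r/2) \<subseteq> cball z r" if "w \<in> ball z (r/2)" for w
    proof
      fix x assume "x \<in> cball w (r/2)"
      then show "x \<in> cball z r" using that dist_triangle[of z x w] by auto
    qed
    have dbound: "norm (deriv (\<lambda>z. K z y) w) \<le> b y / (r/2)" if "w \<in> ball z (r/2)" for w y
    proof -
      have h: "(\<lambda>z. K z y) holomorphic_on cball w (r/2)"
        using hol r sub[OF that] by (blast intro: holomorphic_on_subset)
      have "norm ((deriv ^^ 1) (\<lambda>z. K z y) w) \<le> fact 1 * b y / (r/2) ^ 1"
      proof (rule Cauchy_inequality)
        show "(\<lambda>z. K z y) holomorphic_on ball w (r/2)"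
          using h ball_subset_cball by (rule holomorphic_on_subset)
        show "continuous_on (cball w (r/2)) (\<lambda>z. K z y)"
          using h by (rule holomorphic_on_imp_continuous_on)
        fix x assume "norm (w - x) = r/2"
        then have "x \<in> cball z r" using sub[OF that] by (auto simp: dist_norm)
        then show "norm (K x y) \<le> b y" by (rule b)
      qed (use \<open>r > 0\<close> in auto)
      then show ?thesis by simp
    qed
    have lip: "norm (K w y - K z y) \<le> b y / (r/2) * norm (w - z)" if "w \<in> ball z (r/2)" for w y
    proof (rule field_differentiable_bound[of "ball z (r/2)" "\<lambda>z. K z y" "deriv (\<lambda>z. K z y)"])
      fix x assume x: "x \<in> ball z (r/2)"
      then have "x \<in> S" using r by auto
      then show "((\<lambda>z. K z y) has_field_derivative deriv (\<lambda>z. K z y) x) (at x within ball z (r/2))"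
        by (intro has_field_derivative_at_within[OF holomorphic_derivI[OF hol \<open>open S\<close>]])
      show "norm (deriv (\<lambda>z. K z y) x) \<le> b y / (r/2)" by (rule dbound[OF x])
    qed (use that \<open>r > 0\<close> in auto)
    define D where "D y = deriv (\<lambda>z. K z y) z" for y
    have "((\<lambda>z. LINT y|lborel. K z y) has_field_derivative (LINT y|lborel. D y)) (at z within ball z (r/2))"
      unfolding has_field_derivative_iff tendsto_at_iff_sequentially
    proof (intro allI impI)
      fix X assume X: "\<forall>i. X i \<in> ball z (r/2) - {z}" "X \<longlonglongrightarrow> z"
      define Q where "Q i y = (K (X i) y - K z y) / (X i - z)" for i y
      have Xr: "X i \<in> cball z r" "X i \<in> ball z (r/2)" "X i \<noteq> z" for i
      proof -
        have "dist z (X i) < r / 2" "X i \<noteq> z" using spec[OF X(1), of i] by auto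
        then show "X i \<in> cball z r" "X i \<in> ball z (r/2)" "X i \<noteq> z" using \<open>r > 0\<close> by auto
      qed
      have Qm: "Q i \<in> borel_measurable lborel" for i
      proof -
        have [measurable]: "K (X i) \<in> borel_measurable borel" "K z \<in> borel_measurable borel"
          using meas r Xr(1)[of i] z by blast+
        show ?thesis unfolding Q_def by measurable
      qed
      have Qlim: "(\<lambda>i. Q i y) \<longlonglongrightarrow> D y" for y
      proof -
        have "((\<lambda>z. K z y) has_field_derivative D y) (at z)"
          unfolding D_def using hol[of y] \<open>open S\<close> z by (intro holomorphic_derivI) auto
        then have "((\<lambda>w. (K w y - K z y) / (w - z)) \<longlongrightarrow> D y) (at z)"
          by (simp add: has_field_derivative_iff)
        then show ?thesis
          using X unfolding tendsto_at_iff_sequentially by (auto simp: Q_def o_def)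
      qed
      have "(\<lambda>i. LINT y|lborel. Q i y) \<longlonglongrightarrow> (LINT y|lborel. D y)"
      proof (rule integral_dominated_convergence)
        show "D \<in> borel_measurable lborel"
          by (rule borel_measurable_LIMSEQ_metric[OF Qm]) (rule Qlim)
        show "integrable lborel (\<lambda>y. b y / (r/2))" using r by auto
        show "AE y in lborel. norm (Q i y) \<le> b y / (r/2)" for i
        proof (rule AE_I2)
          fix y
          have "norm (X i - z) > 0" using Xr by auto
          then show "norm (Q i y) \<le> b y / (r/2)"
            using lip[OF Xr(2)[of i], of y] unfolding Q_def norm_divide by (simp add: pos_divide_le_eq)
        qed
      qed (use Qm Qlim in auto)
      moreover have "(LINT y|lborel. Q i y) = ((LINT y|lborel. K (X i) y) - (LINT y|lborel. K z y)) / (X i - z)" for i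
        unfolding Q_def using int[OF Xr(1)[of i]] int[of z] r by simp
      ultimately show "((\<lambda>y. ((LINT ya|lborel. K y ya) - (LINT y|lborel. K z y)) / (y - z)) \<circ> X) \<longlonglongrightarrow> (LINT y|lborel. D y)"
        by (simp add: o_def)
    qed
    then show ?thesis
      using r by (metis at_within_open centre_in_ball field_differentiable_def half_gt_zero open_ball)
  qed
  then show ?thesis
    by (simp add: holomorphic_on_def field_differentiable_at_within)
qed

lemma integrable_pair_product_bound:
  fixes K :: "real \<Rightarrow> real \<Rightarrow> complex"
  assumes K[measurable]: "case_prod K \<in> borel_measurable (lborel \<Otimes>\<^sub>M lborel)"
    and p: "integrable lborel p" and q: "integrable lborel q"
    and bd: "\<And>x y. norm (K x y) \<le> p x * q y"
  shows "integrable (lborel \<Otimes>\<^sub>M lborel) (case_prod K)"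
proof (rule lborel_pair.Fubini_integrable)
  have [measurable]: "K x \<in> borel_measurable lborel" for x
  proof -
    have "(\<lambda>y. case_prod K (x, y)) \<in> borel_measurable lborel"
      by (rule measurable_compose[OF measurable_Pair1' K]) simp
    then show ?thesis by simp
  qed
  have int: "integrable lborel (K x)" for x
    by (rule Bochner_Integration.integrable_bound[OF integrable_mult_right[OF q, of "p x"]])
       (use bd in \<open>auto intro: order_trans[OF _ abs_ge_self]\<close>)
  then show "AE x in lborel. integrable lborel (\<lambda>y. case_prod K (x, y))" by simp
  show "integrable lborel (\<lambda>x. LINT y|lborel. norm (case_prod K (x, y)))"
  proof (rule Bochner_Integration.integrable_bound[OF integrable_mult_left[OF p, of "LINT y|lborel. q y"]])
    show "AE x in lborel. norm (LINT y|lborel. norm (case_prod K (x, y))) \<le> norm (p x * (LINT y|lborel. q y))"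
    proof (rule AE_I2)
      fix x
      have "norm (LINT y|lborel. norm (K x y)) = (LINT y|lborel. norm (K x y))" by simp
      also have "\<dots> \<le> (LINT y|lborel. p x * q y)"
        using int q bd by (intro integral_mono) auto
      also have "\<dots> = p x * (LINT y|lborel. q y)" by simp
      finally show "norm (LINT y|lborel. norm (case_prod K (x, y))) \<le> norm (p x * (LINT y|lborel. q y))"
        by simp
    qed
  qed measurable
qed fact

lemma of_real_powr_eq_exp:
  "t > 0 \<Longrightarrow> of_real t powr s = exp (s * of_real (ln t) :: complex)"
  by (simp add: powr_def Ln_of_real)

lemma norm_of_real_powr:
  "t > 0 \<Longrightarrow> norm (of_real t powr s :: complex) = t powr Re s"
  by (simp add: of_real_powr_eq_exp powr_def)

text \<open>If \<open>v\<close> is an inverse Mellin transform along Re s = c, Fubini leaves the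
  integral of t powr (z - s - 1) over \<open>T\<close> as the inner one. \<open>R\<close> is its
  sign: 1 on the unit interval with the line left of \<open>z\<close>, -1 on the half-line from 1
  with the line right of \<open>z\<close>.\<close>

lemma mellin_swap:
  fixes \<Phi> :: "real \<Rightarrow> complex" and T :: "real set"
  assumes T: "T \<subseteq> {0<..}" "T \<in> sets borel" and \<Phi>: "integrable lborel \<Phi>"
    and intT: "set_integrable lborel T (\<lambda>t. t powr (Re z - c - 1))"
    and val: "\<And>w::complex. Re w = Re z - c \<Longrightarrow> (LINT t:T|lborel. of_real t powr (w - 1)) = R / w"
    and v: "\<And>t. t \<in> T \<Longrightarrow> v t = (LINT y|lborel. \<Phi> y * of_real t powr (- Complex c y))"
  shows "set_integrable lborel T (\<lambda>t. of_real t powr (z - 1) * v t)"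
    "(LINT t:T|lborel. of_real t powr (z - 1) * v t) = (LINT y|lborel. \<Phi> y * (R / (z - Complex c y)))"
proof -
  \<comment> \<open>On \<open>T\<close> the logarithm is real, so this is the power in a form whose
    joint measurability in both variables is immediate; the indicator removes all other
    \<open>t\<close>.\<close>
  define K where "K t y = indicator T t *\<^sub>R (\<Phi> y * exp ((z - 1 - Complex c y) * of_real (ln t)))" for t y
  have [measurable]: "\<Phi> \<in> borel_measurable lborel" "T \<in> sets borel" using \<Phi> T by auto
  have int: "integrable (lborel \<Otimes>\<^sub>M lborel) (case_prod K)"
  proof (rule integrable_pair_product_bound)
    show "integrable lborel (\<lambda>t. indicator T t *\<^sub>R t powr (Re z - c - 1))"
      using intT by (simp add: set_integrable_def)
    show "integrable lborel (\<lambda>y. norm (\<Phi> y))" using \<Phi> by auto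
    show "case_prod K \<in> borel_measurable (lborel \<Otimes>\<^sub>M lborel)"
      unfolding K_def Complex_eq by measurable
    show "norm (K t y) \<le> (indicator T t *\<^sub>R t powr (Re z - c - 1)) * norm (\<Phi> y)" for t y
    proof (cases "t \<in> T")
      case True
      then have "t > 0" using T by auto
      then show ?thesis using True by (simp add: K_def norm_mult powr_def algebra_simps)
    qed (simp add: K_def)
  qed
  have 1: "(LINT y|lborel. K t y) = indicator T t *\<^sub>R (of_real t powr (z - 1) * v t)" for t
  proof (cases "t \<in> T")
    case True
    then have t: "t > 0" using T by auto
    have "K t y = of_real t powr (z - 1) * (\<Phi> y * of_real t powr (- Complex c y))" for y
      using True t by (simp add: K_def of_real_powr_eq_exp algebra_simps flip: exp_add)
    then show ?thesis using True by (simp add: v)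
  qed (simp add: K_def)
  show "set_integrable lborel T (\<lambda>t. of_real t powr (z - 1) * v t)"
    using lborel_pair.integrable_fst[OF int] by (simp add: set_integrable_def 1)
  have 2: "(LINT t|lborel. K t y) = \<Phi> y * (R / (z - Complex c y))" for y
  proof -
    have "K t y = \<Phi> y * (indicator T t *\<^sub>R of_real t powr (z - Complex c y - 1))" for t
      using T by (auto simp: K_def of_real_powr_eq_exp indicator_def algebra_simps subset_iff)
    then have "(LINT t|lborel. K t y) = \<Phi> y * (LINT t:T|lborel. of_real t powr (z - Complex c y - 1))"
      unfolding set_lebesgue_integral_def by (simp only: integral_mult_right_zero)
    then show ?thesis by (subst (asm) val) auto
  qed
  show "(LINT t:T|lborel. of_real t powr (z - 1) * v t) = (LINT y|lborel. \<Phi> y * (R / (z - Complex c y)))"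
    using lborel_pair.integral_fst[OF int] lborel_pair.integral_snd[OF int]
    by (simp add: set_lebesgue_integral_def 1 2)
qed

lemma has_vector_derivative_of_real_powr:
  assumes "t > 0"
  shows "((\<lambda>t. of_real t powr s) has_vector_derivative (s::complex) * of_real t powr (s - 1)) (at t)"
proof -
  have "((\<lambda>w. w powr s) has_field_derivative s * of_real t powr (s - 1)) (at (of_real t))"
    using assms by (intro has_field_derivative_powr) auto
  from has_vector_derivative_real_field[OF this] show ?thesis .
qed

lemma isCont_of_real_powr:
  assumes "t > 0"
  shows "isCont (\<lambda>t. of_real t powr s :: complex) t"
  using has_vector_derivative_continuous[OF has_vector_derivative_of_real_powr[OF assms]] .

lemma tendsto_of_real_powr_at_right_0:
  assumes "Re s > 0"
  shows "((\<lambda>t. of_real t powr s :: complex) \<longlongrightarrow> 0) (at_right 0)"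
proof (rule Lim_null_comparison)
  show "\<forall>\<^sub>F t in at_right 0. norm (of_real t powr s :: complex) \<le> t powr Re s"
    using eventually_at_right_less[of "0::real"] by eventually_elim (simp add: norm_of_real_powr)
  show "((\<lambda>t. t powr Re s) \<longlongrightarrow> 0) (at_right (0::real))"
    using assms by (intro tendsto_zero_powrI[where b = "Re s"] tendsto_intros) (auto simp: eventually_at_filter)
qed

lemma set_integrable_powr_at_0:
  assumes "p > -1" "c > 0"
  shows "set_integrable lborel {0<..<c} (\<lambda>t::real. t powr p)"
proof -
  have "set_integrable lborel {0..c} (\<lambda>t::real. t powr p)"
    using has_integral_powr_from_0[of p c] assms
    by (intro set_integrable_lborel_nonneg) (auto simp: integrable_on_def)
  then show ?thesis by (rule set_integrable_subset) auto
qed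

lemma set_integrable_powr_at_top:
  assumes "p < -1"
  shows "set_integrable lborel {1..} (\<lambda>t::real. t powr p)"
  using has_integral_powr_to_inf[of p 1] assms
  by (intro set_integrable_lborel_nonneg) (auto simp: integrable_on_def)

lemma set_integrable_of_real_powr:
  assumes "set_integrable lborel T (\<lambda>t. t powr Re s)" "T \<subseteq> {0<..}" "T \<in> sets borel"
  shows "set_integrable lborel T (\<lambda>t. of_real t powr s :: complex)"
proof (rule set_integrable_bound[OF assms(1)])
  have "(\<lambda>t. indicator T t *\<^sub>R exp (s * of_real (ln t))) \<in> borel_measurable lborel"
    using assms(3) by measurable
  also have "(\<lambda>t. indicator T t *\<^sub>R exp (s * of_real (ln t))) = (\<lambda>t. indicator T t *\<^sub>R (of_real t powr s))"
    using assms(2) by (auto simp: fun_eq_iff indicator_def of_real_powr_eq_exp subset_iff)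
  finally show "set_borel_measurable lborel T (\<lambda>t. of_real t powr s :: complex)"
    by (simp add: set_borel_measurable_def)
  show "AE t in lborel. t \<in> T \<longrightarrow> norm (of_real t powr s :: complex) \<le> norm (t powr Re s)"
    using assms(2) by (intro AE_I2) (auto simp: norm_of_real_powr)
qed

lemma integral_powr_0_1:
  assumes "Re w > 0"
  shows "(LINT t:{0<..<1}|lborel. of_real t powr (w - 1)) = 1 / w"
proof -
  have w: "w \<noteq> 0" using assms by auto
  have "(LBINT t=ereal 0..ereal 1. of_real t powr (w - 1)) = 1 / w - 0"
  proof (rule interval_integral_FTC_integrable[where F = "\<lambda>t. of_real t powr w / w"])
    show "((\<lambda>t. of_real t powr w / w) has_vector_derivative of_real t powr (w - 1)) (at t)" if "ereal 0 < ereal t" for t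
      using that w by (auto intro!: has_vector_derivative_eq_rhs[OF has_vector_derivative_divide[OF has_vector_derivative_of_real_powr]])
    show "isCont (\<lambda>t. of_real t powr (w - 1) :: complex) t" if "ereal 0 < ereal t" for t
      using that by (auto intro!: isCont_of_real_powr)
    show "set_integrable lborel (einterval (ereal 0) (ereal 1)) (\<lambda>t. of_real t powr (w - 1) :: complex)"
      using assms by (auto intro!: set_integrable_of_real_powr set_integrable_powr_at_0 simp: einterval_eq_Icc)
    show "(((\<lambda>t. of_real t powr w / w) \<circ> real_of_ereal) \<longlongrightarrow> 0) (at_right (ereal 0))"
      using tendsto_divide[OF tendsto_of_real_powr_at_right_0[OF assms] tendsto_const[of w]] w
      by (simp add: ereal_tendsto_simps)
    have "isCont (\<lambda>t. of_real t powr w / w) (1::real)"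
      using w isCont_of_real_powr[of 1 w] by (intro continuous_intros) auto
    then have "((\<lambda>t. of_real t powr w / w) \<longlongrightarrow> 1 / w) (at (1::real))"
      by (simp add: isCont_def)
    then show "(((\<lambda>t. of_real t powr w / w) \<circ> real_of_ereal) \<longlongrightarrow> 1 / w) (at_left (ereal 1))"
      by (simp add: ereal_tendsto_simps filterlim_at_split)
  qed auto
  then show ?thesis
    by (simp add: interval_lebesgue_integral_def einterval_eq)
qed

lemma integral_powr_1_top:
  assumes "Re w < 0"
  shows "(LINT t:{1..}|lborel. of_real t powr (w - 1)) = - 1 / w"
proof -
  have w: "w \<noteq> 0" using assms by auto
  have "(LBINT t=ereal 1..\<infinity>. of_real t powr (w - 1)) = 0 - 1 / w"
  proof (rule interval_integral_FTC_integrable[where F = "\<lambda>t. of_real t powr w / w"])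
    show "((\<lambda>t. of_real t powr w / w) has_vector_derivative of_real t powr (w - 1)) (at t)" if "ereal 1 < ereal t" for t
      using that w by (auto intro!: has_vector_derivative_eq_rhs[OF has_vector_derivative_divide[OF has_vector_derivative_of_real_powr]])
    show "isCont (\<lambda>t. of_real t powr (w - 1) :: complex) t" if "ereal 1 < ereal t" for t
      using that by (auto intro!: isCont_of_real_powr)
    have "set_integrable lborel {1..} (\<lambda>t. of_real t powr (w - 1) :: complex)"
      using assms by (auto intro!: set_integrable_of_real_powr set_integrable_powr_at_top)
    then show "set_integrable lborel (einterval (ereal 1) \<infinity>) (\<lambda>t. of_real t powr (w - 1) :: complex)"
      by (rule set_integrable_subset) (auto simp: einterval_def)
    have "((\<lambda>t. of_real t powr w :: complex) \<longlongrightarrow> 0) at_top"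
    proof (rule Lim_null_comparison)
      show "\<forall>\<^sub>F t in at_top. norm (of_real t powr w :: complex) \<le> t powr Re w"
        using eventually_gt_at_top[of "0::real"] by eventually_elim (simp add: norm_of_real_powr)
      show "((\<lambda>t. t powr Re w) \<longlongrightarrow> 0) at_top"
        using assms by (intro tendsto_neg_powr filterlim_ident)
    qed
    from tendsto_divide[OF this tendsto_const[of w]]
    show "(((\<lambda>t. of_real t powr w / w) \<circ> real_of_ereal) \<longlongrightarrow> 0) (at_left \<infinity>)"
      using w by (simp add: ereal_tendsto_simps)
    have "isCont (\<lambda>t. of_real t powr w / w) (1::real)"
      using w isCont_of_real_powr[of 1 w] by (intro continuous_intros) auto
    then have "((\<lambda>t. of_real t powr w / w) \<longlongrightarrow> 1 / w) (at (1::real))"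
      by (simp add: isCont_def)
    then show "(((\<lambda>t. of_real t powr w / w) \<circ> real_of_ereal) \<longlongrightarrow> 1 / w) (at_right (ereal 1))"
      by (simp add: ereal_tendsto_simps filterlim_at_split)
  qed auto
  then have "(LINT t:{1<..}|lborel. of_real t powr (w - 1)) = - 1 / w"
    by (simp add: interval_integral_to_infinity_eq)
  moreover have "(LINT t:{1..}|lborel. of_real t powr (w - 1)) = (LINT t:{1<..}|lborel. of_real t powr (w - 1))"
    unfolding set_lebesgue_integral_def
    by (rule integral_discrete_difference[of "{1}"]) (auto simp: indicator_def)
  ultimately show ?thesis by simp
qed

lemma mellin_swap_0_1:
  assumes "integrable lborel \<Phi>" "c < Re z"
    and "\<And>t. 0 < t \<Longrightarrow> t < 1 \<Longrightarrow> v t = (LINT y|lborel. \<Phi> y * of_real t powr (- Complex c y))"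
  shows "set_integrable lborel {0<..<1} (\<lambda>t. of_real t powr (z - 1) * v t)"
    "(LINT t:{0<..<1}|lborel. of_real t powr (z - 1) * v t) = (LINT y|lborel. \<Phi> y / (z - Complex c y))"
proof -
  have 1: "set_integrable lborel {0<..<1} (\<lambda>t. t powr (Re z - c - 1))"
    using assms by (intro set_integrable_powr_at_0) auto
  have 2: "(LINT t:{0<..<1}|lborel. of_real t powr (w - 1)) = 1 / w" if "Re w = Re z - c" for w
    using that assms by (intro integral_powr_0_1) auto
  have T: "{0<..<1} \<subseteq> {0::real<..}" "{0<..<1} \<in> sets (borel :: real measure)" by auto
  have v: "v t = (LINT y|lborel. \<Phi> y * of_real t powr (- Complex c y))" if "t \<in> {0<..<1}" for t
    using assms(3)[of t] that by simp
  show "set_integrable lborel {0<..<1} (\<lambda>t. of_real t powr (z - 1) * v t)"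
    by (rule mellin_swap(1)[OF T assms(1) 1 2 v])
  show "(LINT t:{0<..<1}|lborel. of_real t powr (z - 1) * v t) = (LINT y|lborel. \<Phi> y / (z - Complex c y))"
    using mellin_swap(2)[OF T assms(1) 1 2 v] by simp
qed

lemma mellin_swap_1_top:
  assumes "integrable lborel \<Phi>" "Re z < c"
    and "\<And>t. 1 \<le> t \<Longrightarrow> v t = (LINT y|lborel. \<Phi> y * of_real t powr (- Complex c y))"
  shows "set_integrable lborel {1..} (\<lambda>t. of_real t powr (z - 1) * v t)"
    "(LINT t:{1..}|lborel. of_real t powr (z - 1) * v t) = (LINT y|lborel. \<Phi> y / (Complex c y - z))"
proof -
  have *: "\<Phi> y * (- 1 / (z - Complex c y)) = \<Phi> y / (Complex c y - z)" for y
    using minus_divide_right[of "\<Phi> y" "z - Complex c y"] by simp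
  have 1: "set_integrable lborel {1..} (\<lambda>t. t powr (Re z - c - 1))"
    using assms by (intro set_integrable_powr_at_top) auto
  have 2: "(LINT t:{1..}|lborel. of_real t powr (w - 1)) = - 1 / w" if "Re w = Re z - c" for w
    using that assms by (intro integral_powr_1_top) auto
  have T: "{1..} \<subseteq> {0::real<..}" "{1..} \<in> sets (borel :: real measure)" by auto
  have v: "v t = (LINT y|lborel. \<Phi> y * of_real t powr (- Complex c y))" if "t \<in> {1..}" for t
    using assms(3)[of t] that by simp
  show "set_integrable lborel {1..} (\<lambda>t. of_real t powr (z - 1) * v t)"
    by (rule mellin_swap(1)[OF T assms(1) 1 2 v])
  show "(LINT t:{1..}|lborel. of_real t powr (z - 1) * v t) = (LINT y|lborel. \<Phi> y / (Complex c y - z))"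
    using mellin_swap(2)[OF T assms(1) 1 2 v] by (simp only: *)
qed

section \<open>Sums over the poles of the Gamma function\<close>

text \<open>Each factor with k >= 1 is at least k, and the factor for k = 0 is the lost 1/2.\<close>

lemma prod_half_ge_fact: "(\<Prod>k<Suc N. real k + 1/2) \<ge> fact N / 2"
proof (induction N)
  case (Suc N)
  have "fact (Suc N) / 2 = (fact N / 2) * (real N + 1)" by (simp add: field_simps)
  also have "\<dots> \<le> (\<Prod>k<Suc N. real k + 1/2) * (real (Suc N) + 1/2)"
    by (rule mult_mono[OF Suc]) (auto intro!: prod_nonneg simp del: prod.lessThan_Suc)
  finally show ?case by (simp add: mult.commute)
qed simp

text \<open>The line runs midway between two poles. N + 1 steps of the recurrence lead to Re = 1/2,
  and the real parts passed on the way have the absolute values k + 1/2 for k = 0, ..., N, whose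
  product is at least N!/2.\<close>

lemma norm_Gamma_left_line:
  "norm (Gamma (Complex (- real N - 1/2) y)) \<le> 2 / fact N * norm (Gamma (Complex (1/2) y))"
proof -
  define s where "s = Complex (- real N - 1/2) y"
  have s: "s \<notin> \<int>\<^sub>\<le>\<^sub>0"
  proof
    assume "s \<in> \<int>\<^sub>\<le>\<^sub>0"
    then obtain n where "s = of_int n" by (auto elim!: nonpos_Ints_cases)
    then have "- real N - 1/2 = of_int n" by (simp add: s_def complex_eq_iff)
    then have "real_of_int (2 * n + 2 * int N) = - 1" by simp
    then have "2 * n + 2 * int N = - 1" by linarith
    then show False by presburger
  qed
  have "fact N / 2 \<le> (\<Prod>k<Suc N. real k + 1/2)" by (rule prod_half_ge_fact)
  also have "\<dots> = (\<Prod>i<Suc N. real (Suc N - Suc i) + 1/2)"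
    by (rule prod.nat_diff_reindex[symmetric])
  also have "\<dots> \<le> (\<Prod>i<Suc N. norm (s + of_nat i))"
  proof (intro prod_mono conjI)
    fix i assume "i \<in> {..<Suc N}"
    then show "real (Suc N - Suc i) + 1/2 \<le> norm (s + of_nat i)"
      using abs_Re_le_cmod[of "s + of_nat i"] by (simp add: s_def of_nat_diff)
  qed auto
  also have "\<dots> = norm (pochhammer s (Suc N))" by (simp only: norm_pochhammer)
  finally have p: "fact N / 2 \<le> norm (pochhammer s (Suc N))" .
  have "s + of_nat (Suc N) = Complex (1/2) y" by (simp add: s_def complex_eq_iff)
  then have "pochhammer s (Suc N) * Gamma s = Gamma (Complex (1/2) y)"
    using pochhammer_Gamma[OF s, of "Suc N"] s by (simp add: Gamma_eq_zero_iff)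
  then have "norm (pochhammer s (Suc N)) * norm (Gamma s) = norm (Gamma (Complex (1/2) y))"
    by (metis norm_mult)
  then have "fact N / 2 * norm (Gamma s) \<le> norm (Gamma (Complex (1/2) y))"
    using mult_right_mono[OF p norm_ge_zero[of "Gamma s"]] by simp
  then show ?thesis unfolding s_def[symmetric] by (simp add: field_simps)
qed

text \<open>The line is moved from \<open>c\<close> to -N - 1/2 across the poles 0, ..., -N of
  \<open>Gamma\<close> and across \<open>P\<close>. The integral that remains is O(exp (\<kappa> N)
  / N!), so the partial sums of residues converge. The bound on \<open>W\<close> is required only
  high up, for the horizontal sides, and far to the left, for the final lines, which leaves room for
  poles of \<open>W\<close> in \<open>P\<close>.\<close>

lemma Gamma_residue_sums:
  fixes W :: "complex \<Rightarrow> complex"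
  assumes c: "0 < c" "c < 1" and \<alpha>: "0 \<le> \<alpha>" "\<alpha> < pi / 2"
    and P: "finite P" "\<And>p. p \<in> P \<Longrightarrow> Re p < c \<and> p \<notin> \<int>\<^sub>\<le>\<^sub>0"
    and W: "W holomorphic_on {s. Re s < 1} - P"
    and bd: "\<And>s. Re s \<le> c \<Longrightarrow> \<bar>Im s\<bar> \<ge> Y \<or> Re s \<le> - R \<Longrightarrow> norm (W s) \<le> B * exp (\<alpha> * \<bar>Im s\<bar> - \<kappa> * Re s)"
  shows "integrable lborel (\<lambda>y. Gamma (Complex c y) * W (Complex c y))"
    "(\<lambda>n. (-1) ^ n / fact n * W (- of_nat n)) sums
       (1 / (2 * pi) * (LINT y|lborel. Gamma (Complex c y) * W (Complex c y)) - (\<Sum>p\<in>P. residue (\<lambda>s. Gamma s * W s) p))"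
proof -
  define G where "G s = Gamma s * W s" for s
  \<comment> \<open>Midway between the growth rate of \<open>W\<close> and pi/2, so that a decay of
    rate \<beta> - \<alpha> > 0 survives in the product.\<close>
  define \<beta> where "\<beta> = (\<alpha> + pi / 2) / 2"
  have \<beta>: "\<alpha> < \<beta>" "\<beta> < pi / 2" "0 \<le> \<beta>" using \<alpha> by (auto simp: \<beta>_def)
  define B' where "B' = \<bar>B\<bar>"
  have bd': "norm (W s) \<le> B' * exp (\<alpha> * \<bar>Im s\<bar> - \<kappa> * Re s)" if "Re s \<le> c" "\<bar>Im s\<bar> \<ge> Y \<or> Re s \<le> - R" for s
    using bd[OF that] by (rule order_trans) (auto simp: B'_def intro: mult_right_mono)
  have B': "B' \<ge> 0" by (simp add: B'_def)
  define Q where "Q N = (\<lambda>n. - of_nat n :: complex) ` {..N}" for N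
  \<comment> \<open>From \<open>N0\<close> on, the line at -N - 1/2 lies to the left of
    \<open>P\<close> and inside the region where the bound on \<open>W\<close> holds at every
    height.\<close>
  define N0 where "N0 = nat \<lceil>Max (insert \<bar>R\<bar> ((\<lambda>p. \<bar>Re p\<bar>) ` P))\<rceil>"
  have N0: "real N0 \<ge> R" "\<And>p. p \<in> P \<Longrightarrow> Re p \<ge> - real N0"
  proof -
    have 1: "Max (insert \<bar>R\<bar> ((\<lambda>p. \<bar>Re p\<bar>) ` P)) \<le> real N0" unfolding N0_def by linarith
    then have 2: "\<And>x. x \<in> insert \<bar>R\<bar> ((\<lambda>p. \<bar>Re p\<bar>) ` P) \<Longrightarrow> x \<le> real N0"
      using P(1) by (subst (asm) Max_le_iff) auto
    show "real N0 \<ge> R" using 2[of "\<bar>R\<bar>"] by simp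
    show "Re p \<ge> - real N0" if "p \<in> P" for p using 2[of "\<bar>Re p\<bar>"] that by (simp add: abs_le_iff)
  qed
  \<comment> \<open>The constant may depend on \<open>N\<close>: it only justifies a single shift.
    Uniformity in \<open>N\<close> comes later from the majorant \<open>h\<close>.\<close>
  have hp: "\<exists>M. \<forall>s. - real N - 1/2 \<le> Re s \<and> Re s \<le> c \<and> \<bar>Im s\<bar> \<ge> max Y 1 \<longrightarrow> norm (G s) \<le> M * exp (- (\<beta> - \<alpha>) * \<bar>Im s\<bar>)" for N
  proof -
    obtain BG where BG: "BG > 0"
      "\<And>s. - real N - 1/2 \<le> Re s \<Longrightarrow> Re s \<le> c \<Longrightarrow> \<bar>Im s\<bar> \<ge> 1 \<Longrightarrow> norm (Gamma s) \<le> BG * exp (- \<beta> * \<bar>Im s\<bar>)"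
      using Gamma_vertical_decay[of \<beta> "- real N - 1/2" c] \<beta> by blast
    have "norm (G s) \<le> BG * B' * exp (\<bar>\<kappa>\<bar> * (real N + 2)) * exp (- (\<beta> - \<alpha>) * \<bar>Im s\<bar>)"
      if s: "- real N - 1/2 \<le> Re s" "Re s \<le> c" "\<bar>Im s\<bar> \<ge> max Y 1" for s
    proof -
      have "norm (G s) \<le> (BG * exp (- \<beta> * \<bar>Im s\<bar>)) * (B' * exp (\<alpha> * \<bar>Im s\<bar> - \<kappa> * Re s))"
        unfolding G_def norm_mult using s BG B' by (intro mult_mono BG(2) bd') auto
      also have "\<dots> \<le> (BG * exp (- \<beta> * \<bar>Im s\<bar>)) * (B' * exp (\<alpha> * \<bar>Im s\<bar> + \<bar>\<kappa>\<bar> * (real N + 2)))"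
      proof -
        have "- (\<kappa> * Re s) \<le> \<bar>\<kappa> * Re s\<bar>" by simp
        also have "\<dots> = \<bar>\<kappa>\<bar> * \<bar>Re s\<bar>" by (simp add: abs_mult)
        also have "\<dots> \<le> \<bar>\<kappa>\<bar> * (real N + 2)" using s c by (intro mult_left_mono) auto
        finally show ?thesis using BG B' by (intro mult_left_mono) auto
      qed
      also have "\<dots> = BG * B' * exp (\<bar>\<kappa>\<bar> * (real N + 2)) * exp (- (\<beta> - \<alpha>) * \<bar>Im s\<bar>)"
        by (simp add: algebra_simps flip: exp_add)
      finally show ?thesis .
    qed
    then show ?thesis by blast
  qed
  have shift: "integrable lborel (\<lambda>y. G (Complex c y))"
      "(LINT y|lborel. G (Complex c y)) - (LINT y|lborel. G (Complex (- real N - 1/2) y)) = 2 * pi * ((\<Sum>n\<le>N. (-1) ^ n / fact n * W (- of_nat n)) + (\<Sum>p\<in>P. residue G p))"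
    if N: "N \<ge> N0" for N
  proof -
    obtain M where M: "\<And>s. - real N - 1/2 \<le> Re s \<Longrightarrow> Re s \<le> c \<Longrightarrow> \<bar>Im s\<bar> \<ge> max Y 1 \<Longrightarrow> norm (G s) \<le> M * exp (- (\<beta> - \<alpha>) * \<bar>Im s\<bar>)"
      using hp[of N] by blast
    have hol: "G holomorphic_on {s. - real N - 1 < Re s \<and> Re s < 1} - (Q N \<union> P)"
    proof -
      have "Gamma holomorphic_on {s. - real N - 1 < Re s \<and> Re s < 1} - (Q N \<union> P)"
      proof (rule holomorphic_Gamma)
        show "({s. - real N - 1 < Re s \<and> Re s < 1} - (Q N \<union> P)) \<inter> \<int>\<^sub>\<le>\<^sub>0 = {}"
        proof (rule ccontr)
          assume "({s. - real N - 1 < Re s \<and> Re s < 1} - (Q N \<union> P)) \<inter> \<int>\<^sub>\<le>\<^sub>0 \<noteq> {}"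
          then obtain s where s: "- real N - 1 < Re s" "s \<notin> Q N" "s \<in> \<int>\<^sub>\<le>\<^sub>0" by auto
          then obtain n where n: "s = - of_nat n" by (auto elim!: nonpos_Ints_cases')
          then have "n \<le> N" using s by simp
          then show False using n s by (auto simp: Q_def)
        qed
      qed
      moreover have "W holomorphic_on {s. - real N - 1 < Re s \<and> Re s < 1} - (Q N \<union> P)"
        by (rule holomorphic_on_subset[OF W]) auto
      ultimately show ?thesis unfolding G_def by (intro holomorphic_on_mult)
    qed
    have poles: "- real N - 1/2 < Re p \<and> Re p < c" if "p \<in> Q N \<union> P" for p
      using that
    proof
      assume "p \<in> Q N"
      then show ?thesis using c by (auto simp: Q_def)
    next
      assume "p \<in> P"
      then show ?thesis using P(2)[of p] N0(2)[of p] N by auto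
    qed
    have lt: "- real N - 1 < - real N - 1/2" "- real N - 1/2 < c" "c < 1" using c by auto
    have fin: "finite (Q N \<union> P)" using P by (auto simp: Q_def)
    have d: "\<beta> - \<alpha> > 0" using \<beta> by simp
    note vs = vertical_shift[where Y = "max Y 1", OF lt fin hol poles d M]
    show "integrable lborel (\<lambda>y. G (Complex c y))" by (rule vs(2))
    have disj: "Q N \<inter> P = {}"
    proof (rule ccontr)
      assume "Q N \<inter> P \<noteq> {}"
      then obtain n where "- of_nat n \<in> P" by (auto simp: Q_def)
      from P(2)[OF this] show False by auto
    qed
    have "(\<Sum>p\<in>Q N. residue G p) = (\<Sum>n\<le>N. residue G (- of_nat n))"
      unfolding Q_def by (subst sum.reindex) (auto simp: inj_on_def)
    also have "\<dots> = (\<Sum>n\<le>N. (-1) ^ n / fact n * W (- of_nat n))"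
    proof (rule sum.cong)
      fix n :: nat
      have "- of_nat n \<notin> P" using P(2)[of "- of_nat n"] by auto
      then show "residue G (- of_nat n) = (-1) ^ n / fact n * W (- of_nat n)"
        unfolding G_def
        by (intro residue_Gamma_mult[OF _ _ W]) (auto intro!: open_Diff finite_imp_closed P open_halfspace_Re_lt)
    qed simp
    finally have "(\<Sum>p\<in>Q N \<union> P. residue G p) = (\<Sum>n\<le>N. (-1) ^ n / fact n * W (- of_nat n)) + (\<Sum>p\<in>P. residue G p)"
      using P(1) disj by (subst sum.union_disjoint) (auto simp: Q_def)
    then show "(LINT y|lborel. G (Complex c y)) - (LINT y|lborel. G (Complex (- real N - 1/2) y)) = 2 * pi * ((\<Sum>n\<le>N. (-1) ^ n / fact n * W (- of_nat n)) + (\<Sum>p\<in>P. residue G p))"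
      using vs(3) by simp
  qed
  show "integrable lborel (\<lambda>y. Gamma (Complex c y) * W (Complex c y))"
    using shift(1)[of N0] by (simp add: G_def)
  \<comment> \<open>An integrable majorant common to all the left lines; their dependence on
    \<open>N\<close> sits entirely in the factor exp (\<kappa> N) / N!.\<close>
  define h where "h y = norm (Gamma (Complex (1/2) y)) * exp (\<alpha> * \<bar>y\<bar>)" for y
  have h: "integrable lborel h"
  proof -
    obtain BG where BG: "BG > 0"
      "\<And>s. 1/2 \<le> Re s \<Longrightarrow> Re s \<le> 1/2 \<Longrightarrow> \<bar>Im s\<bar> \<ge> 1 \<Longrightarrow> norm (Gamma s) \<le> BG * exp (- \<beta> * \<bar>Im s\<bar>)"
      using Gamma_vertical_decay[of \<beta> "1/2" "1/2"] \<beta> by blast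
    have "continuous_on UNIV (\<lambda>y. Gamma (Complex (1/2) y))"
      by (rule continuous_on_vertical[OF holomorphic_Gamma[of "{s. Re s > 0}"]]) (auto elim!: nonpos_Ints_cases)
    then have "integrable lborel (\<lambda>y. Gamma (Complex (1/2) y) * of_real (exp (\<alpha> * \<bar>y\<bar>)))"
    proof (intro integrable_exp_decay[where d = "\<beta> - \<alpha>" and Y = 1 and M = BG])
      fix y :: real assume "1 \<le> \<bar>y\<bar>"
      then have "norm (Gamma (Complex (1/2) y) * of_real (exp (\<alpha> * \<bar>y\<bar>))) \<le> BG * exp (- \<beta> * \<bar>y\<bar>) * exp (\<alpha> * \<bar>y\<bar>)"
        unfolding norm_mult using BG(1) BG(2)[of "Complex (1/2) y"] by (intro mult_mono) auto
      also have "\<dots> = BG * exp (- (\<beta> - \<alpha>) * \<bar>y\<bar>)" by (simp add: algebra_simps flip: exp_add)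
      finally show "norm (Gamma (Complex (1/2) y) * of_real (exp (\<alpha> * \<bar>y\<bar>))) \<le> BG * exp (- (\<beta> - \<alpha>) * \<bar>y\<bar>)" .
    qed (use \<beta> in \<open>auto intro!: continuous_intros\<close>)
    from integrable_norm[OF this] show ?thesis by (simp add: h_def[abs_def] norm_mult)
  qed
  have left: "norm (LINT y|lborel. G (Complex (- real N - 1/2) y)) \<le> (2 * B' * exp (\<kappa> / 2) * (LINT y|lborel. h y)) * (inverse (fact N) * exp \<kappa> ^ N)"
    if N: "N \<ge> N0" for N
  proof -
    have "norm (G (Complex (- real N - 1/2) y)) \<le> 2 * B' * exp (\<kappa> / 2) * (inverse (fact N) * exp \<kappa> ^ N) * h y" for y
    proof -
      have "norm (G (Complex (- real N - 1/2) y)) \<le> (2 / fact N * norm (Gamma (Complex (1/2) y))) * (B' * exp (\<alpha> * \<bar>Im (Complex (- real N - 1/2) y)\<bar> - \<kappa> * Re (Complex (- real N - 1/2) y)))"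
        unfolding G_def norm_mult using N N0(1) c B' by (intro mult_mono norm_Gamma_left_line bd') auto
      also have "\<alpha> * \<bar>Im (Complex (- real N - 1/2) y)\<bar> - \<kappa> * Re (Complex (- real N - 1/2) y) = \<alpha> * \<bar>y\<bar> + (\<kappa> / 2 + real N * \<kappa>)"
        by (simp add: algebra_simps)
      also have "exp \<dots> = exp (\<alpha> * \<bar>y\<bar>) * (exp (\<kappa> / 2) * exp \<kappa> ^ N)" by (simp only: exp_add exp_of_nat_mult)
      finally show ?thesis by (simp add: h_def field_simps)
    qed
    then have "norm (LINT y|lborel. G (Complex (- real N - 1/2) y)) \<le> (LINT y|lborel. 2 * B' * exp (\<kappa> / 2) * (inverse (fact N) * exp \<kappa> ^ N) * h y)"
      using h by (intro norm_integral_le_of_bound integrable_mult_right)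
    then show ?thesis by (simp add: mult_ac)
  qed
  show "(\<lambda>n. (-1) ^ n / fact n * W (- of_nat n)) sums
       (1 / (2 * pi) * (LINT y|lborel. Gamma (Complex c y) * W (Complex c y)) - (\<Sum>p\<in>P. residue (\<lambda>s. Gamma s * W s) p))"
    unfolding sums_def_le
  proof -
    define I where "I = (LINT y|lborel. G (Complex c y))"
    define E where "E N = (LINT y|lborel. G (Complex (- real N - 1/2) y))" for N
    have "E \<longlonglongrightarrow> 0"
    proof (rule Lim_null_comparison)
      show "\<forall>\<^sub>F N in sequentially. norm (E N) \<le> (2 * B' * exp (\<kappa> / 2) * (LINT y|lborel. h y)) * (inverse (fact N) * exp \<kappa> ^ N)"
        using eventually_ge_at_top[of N0] by eventually_elim (unfold E_def, rule left)
      have "(\<lambda>N. inverse (fact N) * exp \<kappa> ^ N) \<longlonglongrightarrow> 0"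
        by (rule summable_LIMSEQ_zero[OF summable_exp])
      from tendsto_mult_left[OF this]
      show "(\<lambda>N. (2 * B' * exp (\<kappa> / 2) * (LINT y|lborel. h y)) * (inverse (fact N) * exp \<kappa> ^ N)) \<longlonglongrightarrow> 0" by simp
    qed
    then have "(\<lambda>N. 1 / (2 * pi) * (I - E N) - (\<Sum>p\<in>P. residue G p)) \<longlonglongrightarrow> 1 / (2 * pi) * (I - 0) - (\<Sum>p\<in>P. residue G p)"
      by (intro tendsto_intros)
    moreover have "\<forall>\<^sub>F N in sequentially. 1 / (2 * pi) * (I - E N) - (\<Sum>p\<in>P. residue G p) = (\<Sum>n\<le>N. (-1) ^ n / fact n * W (- of_nat n))"
      using eventually_ge_at_top[of N0]
    proof eventually_elim
      case (elim N)
      have "I - E N = 2 * pi * ((\<Sum>n\<le>N. (-1) ^ n / fact n * W (- of_nat n)) + (\<Sum>p\<in>P. residue G p))"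
        using shift(2)[OF elim] by (simp add: I_def E_def)
      then show ?case by (simp add: field_simps)
    qed
    ultimately have "(\<lambda>N. \<Sum>n\<le>N. (-1) ^ n / fact n * W (- of_nat n)) \<longlonglongrightarrow> 1 / (2 * pi) * (I - 0) - (\<Sum>p\<in>P. residue G p)"
      by (rule Lim_transform_eventually)
    then show "(\<lambda>N. \<Sum>n\<le>N. (-1) ^ n / fact n * W (- of_nat n)) \<longlonglongrightarrow> 1 / (2 * pi) * (LINT y|lborel. Gamma (Complex c y) * W (Complex c y)) - (\<Sum>p\<in>P. residue (\<lambda>s. Gamma s * W s) p)"
      by (simp add: I_def G_def[abs_def])
  qed
qed

section \<open>Moving Mellin-Barnes integrals between parallel lines\<close>

lemma of_real_powr_bound:
  assumes "x > 0" "a \<le> Re s" "Re s \<le> b"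
  shows "norm (of_real x powr (- s) :: complex) \<le> exp (\<bar>ln x\<bar> * (\<bar>a\<bar> + \<bar>b\<bar>))"
proof -
  have "norm (of_real x powr (- s) :: complex) = exp (- Re s * ln x)"
    using assms(1) by (simp add: norm_of_real_powr powr_def)
  also have "- Re s * ln x \<le> \<bar>Re s\<bar> * \<bar>ln x\<bar>"
    by (metis abs_ge_self abs_minus_cancel abs_mult)
  also have "\<dots> \<le> (\<bar>a\<bar> + \<bar>b\<bar>) * \<bar>ln x\<bar>"
    using assms by (intro mult_right_mono) auto
  finally show ?thesis by (simp add: mult.commute)
qed

text \<open>On a strip of bounded width the power of \<open>x\<close> costs only a constant. The
  rate (pi/2 - \<alpha>)/2 is what remains of the decay of \<open>Gamma\<close>, taken midway
  between \<alpha> and pi/2, after subtracting the growth \<alpha>.\<close>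

lemma Gamma_powr_decay:
  assumes \<alpha>: "0 \<le> \<alpha>" "\<alpha> < pi / 2" and x: "x > 0" and Y: "Y \<ge> 1"
    and W: "\<And>s. a \<le> Re s \<Longrightarrow> Re s \<le> b \<Longrightarrow> \<bar>Im s\<bar> \<ge> Y \<Longrightarrow> norm (W s) \<le> B * exp (\<alpha> * \<bar>Im s\<bar>)"
  obtains M where "\<And>s. a \<le> Re s \<Longrightarrow> Re s \<le> b \<Longrightarrow> \<bar>Im s\<bar> \<ge> Y \<Longrightarrow>
      norm (Gamma s * W s * of_real x powr (- s)) \<le> M * exp (- ((pi / 2 - \<alpha>) / 2) * \<bar>Im s\<bar>)"
proof -
  define \<beta> where "\<beta> = (\<alpha> + pi / 2) / 2"
  have \<beta>: "0 \<le> \<beta>" "\<beta> < pi / 2" using \<alpha> by (auto simp: \<beta>_def)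
  obtain BG where BG: "BG > 0"
    "\<And>s. a \<le> Re s \<Longrightarrow> Re s \<le> b \<Longrightarrow> \<bar>Im s\<bar> \<ge> 1 \<Longrightarrow> norm (Gamma s) \<le> BG * exp (- \<beta> * \<bar>Im s\<bar>)"
    using Gamma_vertical_decay[OF \<beta>] by blast
  show ?thesis
  proof (rule that[of "BG * \<bar>B\<bar> * exp (\<bar>ln x\<bar> * (\<bar>a\<bar> + \<bar>b\<bar>))"])
    fix s assume s: "a \<le> Re s" "Re s \<le> b" "\<bar>Im s\<bar> \<ge> Y"
    have "norm (W s) \<le> \<bar>B\<bar> * exp (\<alpha> * \<bar>Im s\<bar>)"
      using W[OF s] by (rule order_trans) (auto intro: mult_right_mono)
    then have "norm (Gamma s * W s * of_real x powr (- s)) \<le> (BG * exp (- \<beta> * \<bar>Im s\<bar>)) * (\<bar>B\<bar> * exp (\<alpha> * \<bar>Im s\<bar>)) * exp (\<bar>ln x\<bar> * (\<bar>a\<bar> + \<bar>b\<bar>))"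
      unfolding norm_mult using s Y BG x by (intro mult_mono BG(2) of_real_powr_bound) auto
    also have "\<dots> = BG * \<bar>B\<bar> * exp (\<bar>ln x\<bar> * (\<bar>a\<bar> + \<bar>b\<bar>)) * (exp (- \<beta> * \<bar>Im s\<bar>) * exp (\<alpha> * \<bar>Im s\<bar>))"
      by (simp add: mult_ac)
    also have "exp (- \<beta> * \<bar>Im s\<bar>) * exp (\<alpha> * \<bar>Im s\<bar>) = exp (- ((pi / 2 - \<alpha>) / 2) * \<bar>Im s\<bar>)"
      unfolding exp_add[symmetric] \<beta>_def by (simp add: field_simps)
    finally show "norm (Gamma s * W s * of_real x powr (- s)) \<le> BG * \<bar>B\<bar> * exp (\<bar>ln x\<bar> * (\<bar>a\<bar> + \<bar>b\<bar>)) * exp (- ((pi / 2 - \<alpha>) / 2) * \<bar>Im s\<bar>)" .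
  qed
qed

lemma holomorphic_of_real_powr: "x > 0 \<Longrightarrow> (\<lambda>s. of_real x powr (- s) :: complex) holomorphic_on A"
  by (subst of_real_powr_eq_exp) (auto intro!: holomorphic_intros)

text \<open>The poles of \<open>Gamma\<close> may only meet the strip in \<open>0\<close>, and \<open>W 0 = 0\<close> makes that one removable.\<close>

lemma Gamma_powr_shift:
  fixes W :: "complex \<Rightarrow> complex"
  assumes \<alpha>: "0 \<le> \<alpha>" "\<alpha> < pi / 2" and x: "x > 0" and ab: "-1 < a" "a < b" "a \<noteq> 0" "b \<noteq> 0"
    and W: "W holomorphic_on {s. l < Re s}" "l < a" "a < 0 \<Longrightarrow> W 0 = 0"
    and bd: "\<And>s. a \<le> Re s \<Longrightarrow> Re s \<le> b \<Longrightarrow> norm (W s) \<le> B * exp (\<alpha> * \<bar>Im s\<bar>)"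
  shows "integrable lborel (\<lambda>y. Gamma (Complex a y) * W (Complex a y) * of_real x powr (- Complex a y))"
    "integrable lborel (\<lambda>y. Gamma (Complex b y) * W (Complex b y) * of_real x powr (- Complex b y))"
    "(LINT y|lborel. Gamma (Complex a y) * W (Complex a y) * of_real x powr (- Complex a y)) =
     (LINT y|lborel. Gamma (Complex b y) * W (Complex b y) * of_real x powr (- Complex b y))"
proof -
  define G where "G s = Gamma s * W s * of_real x powr (- s)" for s
  define P where "P = (if a < 0 \<and> 0 < b then {0} else {} :: complex set)"
  \<comment> \<open>The open strip must contain no pole of \<open>Gamma\<close> except those in
    \<open>P\<close>: it never reaches -1, and it stops at 0 whenever both lines lie on the same
    side of 0.\<close>
  define a' where "a' = (if a > 0 then max l 0 else max l (-1))"
  define b' where "b' = (if b < 0 then 0 else b + 1)"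
  obtain M where M: "\<And>s. a \<le> Re s \<Longrightarrow> Re s \<le> b \<Longrightarrow> \<bar>Im s\<bar> \<ge> 1 \<Longrightarrow> norm (G s) \<le> M * exp (- ((pi / 2 - \<alpha>) / 2) * \<bar>Im s\<bar>)"
    using Gamma_powr_decay[OF \<alpha> x order_refl bd] unfolding G_def by blast
  have lt: "a' < a" "b < b'" using ab W by (auto simp: a'_def b'_def)
  have "Gamma holomorphic_on {s. a' < Re s \<and> Re s < b'} - P"
  proof (rule holomorphic_Gamma, rule ccontr)
    assume "({s. a' < Re s \<and> Re s < b'} - P) \<inter> \<int>\<^sub>\<le>\<^sub>0 \<noteq> {}"
    then obtain s where s: "a' < Re s" "Re s < b'" "s \<notin> P" "s \<in> \<int>\<^sub>\<le>\<^sub>0" by auto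
    then obtain n where n: "s = - of_nat n" by (auto elim!: nonpos_Ints_cases')
    have "a' \<ge> -1" by (auto simp: a'_def)
    then have "n = 0" using s n by simp
    then show False using n s ab by (auto simp: P_def a'_def b'_def split: if_splits)
  qed
  moreover have "W holomorphic_on {s. a' < Re s \<and> Re s < b'} - P"
    by (rule holomorphic_on_subset[OF W(1)]) (auto simp: a'_def split: if_splits)
  ultimately have hol: "G holomorphic_on {s. a' < Re s \<and> Re s < b'} - P"
    unfolding G_def by (intro holomorphic_on_mult holomorphic_of_real_powr x)
  have fin: "finite P" by (simp add: P_def)
  have P: "a < Re p \<and> Re p < b" if "p \<in> P" for p using that by (auto simp: P_def split: if_splits)
  have d: "(pi / 2 - \<alpha>) / 2 > 0" using \<alpha> by simp
  note vs = vertical_shift[where Y = 1, OF lt(1) ab(2) lt(2) fin hol P d M]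
  show "integrable lborel (\<lambda>y. Gamma (Complex a y) * W (Complex a y) * of_real x powr (- Complex a y))"
    "integrable lborel (\<lambda>y. Gamma (Complex b y) * W (Complex b y) * of_real x powr (- Complex b y))"
    using vs(1,2) by (simp_all add: G_def)
  have "residue G p = 0" if "p \<in> P" for p
  proof -
    have p: "p = 0" "a < 0" using that by (auto simp: P_def split: if_splits)
    have "residue (\<lambda>s. Gamma s * (W s * of_real x powr (- s))) (- of_nat 0) = (-1) ^ 0 / fact 0 * (W (- of_nat 0) * of_real x powr (- (- of_nat 0)))"
      using p W(2) by (intro residue_Gamma_mult[of "{s. l < Re s}"] holomorphic_on_mult W(1) holomorphic_of_real_powr x open_halfspace_Re_gt) auto
    then show ?thesis using p W(3) by (simp add: G_def[abs_def] mult.assoc)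
  qed
  then have "(LINT y|lborel. G (Complex a y)) = (LINT y|lborel. G (Complex b y))"
    using vs(3) by simp
  then show "(LINT y|lborel. Gamma (Complex a y) * W (Complex a y) * of_real x powr (- Complex a y)) =
     (LINT y|lborel. Gamma (Complex b y) * W (Complex b y) * of_real x powr (- Complex b y))"
    by (simp add: G_def)
qed

text \<open>The integrand is the derivative of exp x * x powr -w. Since Re w < 0, this primitive
  tends to 0 at the origin and the singularity x powr (-w - 1) is integrable there.\<close>

lemma integral_exp_powr_derivative:
  fixes w :: complex and t :: real
  assumes w: "Re w < 0" "Re w > -1" and t: "t > 0"
  shows "(LINT x:{0<..<t}|lborel. of_real (exp x) * (of_real x powr (- w) - w * of_real x powr (- w - 1))) = of_real (exp t) * of_real t powr (- w)"
proof -
  let ?F = "\<lambda>x::real. of_real (exp x) * of_real x powr (- w) :: complex"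
  let ?f = "\<lambda>x::real. of_real (exp x) * (of_real x powr (- w) - w * of_real x powr (- w - 1)) :: complex"
  have "(LBINT x=ereal 0..ereal t. ?f x) = ?F t - 0"
  proof (rule interval_integral_FTC_integrable[where F = ?F])
    show "ereal 0 < ereal t" using t by simp
    have e: "((\<lambda>x. of_real (exp x) :: complex) has_vector_derivative of_real (exp x)) (at x)" for x
      using has_vector_derivative_real_field[OF DERIV_exp] by (simp add: exp_of_real)
    show "(?F has_vector_derivative ?f x) (at x)" if "ereal 0 < ereal x" for x
      using that has_vector_derivative_mult[OF e has_vector_derivative_of_real_powr[of x "- w"]]
      by (simp add: algebra_simps)
    show "isCont ?f x" if "ereal 0 < ereal x" for x
      using that isCont_of_real_powr[of x "- w"] isCont_of_real_powr[of x "- w - 1"]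
      by (intro continuous_intros) auto
    have "set_integrable lborel {0<..<t} (\<lambda>x. exp t * (x powr Re (- w) + norm w * x powr Re (- w - 1)))"
      using w t by (intro set_integrable_mult_right set_integral_add set_integrable_powr_at_0) auto
    then have "set_integrable lborel {0<..<t} ?f"
    proof (rule set_integrable_bound)
      have "(\<lambda>x. indicator {0<..<t} x *\<^sub>R (of_real (exp x) * (exp (- w * of_real (ln x)) - w * exp ((- w - 1) * of_real (ln x))))) \<in> borel_measurable lborel"
        by measurable
      also have "(\<lambda>x. indicator {0<..<t} x *\<^sub>R (of_real (exp x) * (exp (- w * of_real (ln x)) - w * exp ((- w - 1) * of_real (ln x))))) = (\<lambda>x. indicator {0<..<t} x *\<^sub>R ?f x)"
        by (auto simp: fun_eq_iff indicator_def of_real_powr_eq_exp)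
      finally show "set_borel_measurable lborel {0<..<t} ?f" by (simp add: set_borel_measurable_def)
      show "AE x in lborel. x \<in> {0<..<t} \<longrightarrow> norm (?f x) \<le> norm (exp t * (x powr Re (- w) + norm w * x powr Re (- w - 1)))"
      proof (intro AE_I2 impI)
        fix x assume x: "x \<in> {0<..<t}"
        have "norm (?f x) = exp x * norm (of_real x powr (- w) - w * of_real x powr (- w - 1))"
          by (simp add: norm_mult)
        also have "\<dots> \<le> exp t * (x powr Re (- w) + norm w * x powr Re (- w - 1))"
          using x norm_triangle_ineq4[of "of_real x powr (- w)" "w * of_real x powr (- w - 1)"]
          by (intro mult_mono) (auto simp: norm_mult norm_of_real_powr)
        finally show "norm (?f x) \<le> norm (exp t * (x powr Re (- w) + norm w * x powr Re (- w - 1)))"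
          by (rule order_trans) simp
      qed
    qed
    then show "set_integrable lborel (einterval (ereal 0) (ereal t)) ?f" by (simp add: einterval_eq)
    have "((\<lambda>x. of_real x powr (- w) :: complex) \<longlongrightarrow> 0) (at_right 0)"
      using w by (intro tendsto_of_real_powr_at_right_0) auto
    moreover have "((\<lambda>x. of_real (exp x) :: complex) \<longlongrightarrow> of_real (exp 0)) (at_right 0)"
      by (intro tendsto_intros)
    ultimately have "(?F \<longlongrightarrow> of_real (exp 0) * 0) (at_right 0)" by (rule tendsto_mult[rotated])
    then show "((?F \<circ> real_of_ereal) \<longlongrightarrow> 0) (at_right (ereal 0))"
      by (simp add: ereal_tendsto_simps)
    have "isCont ?F t" using isCont_of_real_powr[OF t, of "- w"] t w by (intro continuous_intros) auto
    then show "((?F \<circ> real_of_ereal) \<longlongrightarrow> ?F t) (at_left (ereal t))"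
      by (simp add: ereal_tendsto_simps isCont_def filterlim_at_split)
  qed
  then show ?thesis using t by (simp add: interval_lebesgue_integral_def einterval_eq)
qed

section \<open>The interpolated partial sums\<close>

lemma norm_sin_pi_le: "norm (sin (of_real pi * w :: complex)) \<le> exp (pi * \<bar>Im w\<bar>)"
proof -
  have "sin (of_real pi * w) = (exp (\<i> * (of_real pi * w)) - exp (- (\<i> * (of_real pi * w)))) / (2 * \<i>)"
    by (simp add: sin_exp_eq)
  also have "norm \<dots> \<le> (norm (exp (\<i> * (of_real pi * w))) + norm (exp (- (\<i> * (of_real pi * w))))) / 2"
    unfolding norm_divide norm_mult norm_ii norm_numeral mult_1_right
    by (intro divide_right_mono norm_triangle_ineq4) auto
  also have "\<dots> = (exp (- (pi * Im w)) + exp (pi * Im w)) / 2"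
    by simp
  also have "\<dots> \<le> (exp (pi * \<bar>Im w\<bar>) + exp (pi * \<bar>Im w\<bar>)) / 2"
    using abs_ge_self[of "pi * Im w"] abs_ge_minus_self[of "pi * Im w"] unfolding abs_mult
    by (intro divide_right_mono add_mono) auto
  finally show ?thesis by simp
qed

lemma norm_sin_eq:
  "(norm (sin (w::complex)))\<^sup>2 = (sin (Re w))\<^sup>2 + (sinh (Im w))\<^sup>2"
proof -
  have "(norm (sin w))\<^sup>2 = (Re (sin w))\<^sup>2 + (Im (sin w))\<^sup>2"
    by (simp add: cmod_power2)
  also have "\<dots> = (sin (Re w))\<^sup>2 * (cosh (Im w))\<^sup>2 + (cos (Re w))\<^sup>2 * (sinh (Im w))\<^sup>2"
    by (simp add: Re_sin Im_sin cosh_field_def sinh_field_def power_mult_distrib power_divide)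
  also have "\<dots> = (sin (Re w))\<^sup>2 * (1 + (sinh (Im w))\<^sup>2) + (1 - (sin (Re w))\<^sup>2) * (sinh (Im w))\<^sup>2"
    by (simp add: cosh_square_eq cos_squared_eq)
  finally show ?thesis by (simp add: algebra_simps)
qed

lemma exp_abs_le_2_cosh: "exp \<bar>x\<bar> \<le> 2 * cosh (x::real)"
  by (cases "x \<ge> 0") (auto simp: cosh_field_def)

text \<open>Because sin^2 <= 1, the sum sin^2 a + sinh^2 b is at least sin^2 a cosh^2 b. The
  estimate is uniform in height on a vertical line that avoids the integers.\<close>

lemma norm_sin_pi_ge:
  "norm (sin (of_real pi * w :: complex)) \<ge> \<bar>sin (pi * Re w)\<bar> / 2 * exp (pi * \<bar>Im w\<bar>)"
proof -
  have "\<bar>sin (pi * Re w)\<bar> / 2 * exp (pi * \<bar>Im w\<bar>) = \<bar>sin (pi * Re w)\<bar> * (exp \<bar>pi * Im w\<bar> / 2)"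
    by (simp add: abs_mult)
  also have "\<dots> \<le> \<bar>sin (pi * Re w)\<bar> * cosh (pi * Im w)"
    using exp_abs_le_2_cosh[of "pi * Im w"] by (intro mult_left_mono) auto
  also have "\<dots> \<le> norm (sin (of_real pi * w))"
  proof (rule power2_le_imp_le)
    have "(\<bar>sin (pi * Re w)\<bar> * cosh (pi * Im w))\<^sup>2 = (sin (pi * Re w))\<^sup>2 + (sin (pi * Re w))\<^sup>2 * (sinh (pi * Im w))\<^sup>2"
      by (simp add: power_mult_distrib cosh_square_eq algebra_simps)
    also have "\<dots> \<le> (sin (pi * Re w))\<^sup>2 + 1 * (sinh (pi * Im w))\<^sup>2"
      by (intro add_left_mono mult_right_mono) (auto simp: abs_square_le_1)
    also have "\<dots> = (norm (sin (of_real pi * w)))\<^sup>2"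
      by (simp add: norm_sin_eq)
    finally show "(\<bar>sin (pi * Re w)\<bar> * cosh (pi * Im w))\<^sup>2 \<le> (norm (sin (of_real pi * w)))\<^sup>2" .
  qed auto
  finally show ?thesis .
qed

text \<open>Here the sinh part alone suffices, so the estimate is uniform in the real part; it
  serves the horizontal sides of rectangles, which may pass above zeros of the sine.\<close>

lemma norm_sin_pi_ge_far:
  assumes "\<bar>Im w\<bar> \<ge> 1"
  shows "norm (sin (of_real pi * w :: complex)) \<ge> 1 / 4 * exp (pi * \<bar>Im w\<bar>)"
proof -
  have p: "1 * 1 \<le> pi * \<bar>Im w\<bar>" using assms pi_gt3 by (intro mult_mono) auto
  then have "1 + 1 \<le> exp (pi * \<bar>Im w\<bar>)" using exp_ge_add_one_self[of "pi * \<bar>Im w\<bar>"] by linarith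
  moreover have "exp (- (pi * \<bar>Im w\<bar>)) \<le> 1" using p by simp
  moreover have "1 / 4 * E \<le> (E - e) / 2" if "1 + 1 \<le> E" "e \<le> 1" for E e :: real
    using that by simp
  ultimately have "1 / 4 * exp (pi * \<bar>Im w\<bar>) \<le> sinh (pi * \<bar>Im w\<bar>)"
    unfolding sinh_field_def by blast
  also have "\<dots> \<le> norm (sin (of_real pi * w))"
  proof (rule power2_le_imp_le)
    have "(sinh (pi * \<bar>Im w\<bar>))\<^sup>2 = (sinh (pi * Im w))\<^sup>2" by (cases "Im w \<ge> 0") auto
    also have "\<dots> \<le> (norm (sin (of_real pi * w)))\<^sup>2" by (simp add: norm_sin_eq)
    finally show "(sinh (pi * \<bar>Im w\<bar>))\<^sup>2 \<le> (norm (sin (of_real pi * w)))\<^sup>2" .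
  qed auto
  finally show ?thesis .
qed

lemma sin_pi_ge:
  fixes x r :: real
  assumes "0 \<le> r" "r \<le> x" "x \<le> 1 - r"
  shows "sin (pi * r) \<le> sin (pi * x)"
proof (cases "x \<le> 1/2")
  case True
  have *: "0 \<le> pi * r" "pi * r \<le> pi * x" "pi * x \<le> pi * (1/2)"
    using assms True by (auto intro!: mult_left_mono simp del: mult_cancel_left2)
  show ?thesis using * pi_gt_zero by (intro sin_monotone_2pi_le) linarith+
next
  case False
  have *: "0 \<le> pi * r" "pi * r \<le> pi * (1 - x)" "pi * (1 - x) \<le> pi * (1/2)"
    using assms False by (auto intro!: mult_left_mono simp del: mult_cancel_left2)
  have "sin (pi * r) \<le> sin (pi * (1 - x))"
    using * pi_gt_zero by (intro sin_monotone_2pi_le) linarith+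
  also have "\<dots> = sin (pi * x)" by (simp add: right_diff_distrib)
  finally show ?thesis .
qed

lemma sin_of_real_pi_mult_eq_0_iff: "sin (of_real pi * w :: complex) = 0 \<longleftrightarrow> w \<in> \<int>"
proof -
  have "sin (of_real pi * w) = 0 \<longleftrightarrow> (\<exists>n::int. of_real pi * w = of_real (real_of_int n * pi))"
    by (simp add: sin_eq_0)
  also have "\<dots> \<longleftrightarrow> (\<exists>n::int. w = of_int n)" by (auto simp: mult.commute)
  finally show ?thesis by (auto elim!: Ints_cases)
qed

lemma Re_unit_not_Ints: "0 < Re w \<Longrightarrow> Re w < 1 \<Longrightarrow> w \<notin> \<int>"
  by (auto elim!: Ints_cases)

lemma Complex_not_Ints:
  assumes "c \<notin> \<int>"
  shows "Complex c y \<notin> \<int>"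
proof
  assume "Complex c y \<in> \<int>"
  then obtain n where "Complex c y = of_int n" by (rule Ints_cases)
  then have "c = of_int n" by (simp add: complex_eq_iff)
  then show False using assms by simp
qed

lemma ex_non_int_between:
  fixes l u :: real
  assumes "l < u"
  shows "\<exists>c. c \<notin> \<int> \<and> l < c \<and> c < u"
proof (rule ccontr)
  assume *: "\<not> ?thesis"
  define d where "d = min (u - l) 1"
  have d: "0 < d" "d \<le> 1" "d \<le> u - l" using assms by (auto simp: d_def)
  \<comment> \<open>Two distinct points less than 1 apart cannot both be integers.\<close>
  have "l + d/3 \<in> \<int>" "l + 2*d/3 \<in> \<int>" 
    using *[simplified, rule_format, of "l + d/3"] *[simplified, rule_format, of "l + 2*d/3"] d by linarith+
  then have "(l + 2*d/3) - (l + d/3) \<in> \<int>" by (rule Ints_diff[rotated])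
  then have "d / 3 \<in> \<int>" by (simp add: field_simps)
  then obtain n :: int where "d / 3 = of_int n" by (auto elim: Ints_cases)
  then have "0 < real_of_int n" "real_of_int n < 1" using d by auto
  then show False by simp
qed

lemma residue_simple_quotient:
  assumes "open S" "p \<in> S" "u holomorphic_on S" "g holomorphic_on S"
    and "\<And>w. w \<in> S - {p} \<Longrightarrow> g w \<noteq> 0" "g p = 0" "(g has_field_derivative g') (at p)" "g' \<noteq> 0"
  shows "residue (\<lambda>w. u w / g w) p = u p / g'"
proof (rule residue_simple')
  show "(\<lambda>w. u w / g w) holomorphic_on S - {p}"
    using assms(5) by (intro holomorphic_on_divide holomorphic_on_subset[OF assms(3)] holomorphic_on_subset[OF assms(4)]) auto
  have "((\<lambda>w. (g w - g p) / (w - p)) \<longlongrightarrow> g') (at p)"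
    using assms(7) by (simp add: has_field_derivative_iff)
  moreover have "(u \<longlongrightarrow> u p) (at p)"
    using holomorphic_on_imp_continuous_on[OF assms(3)] assms(1,2)
    by (simp add: continuous_on_eq_continuous_at isCont_def)
  ultimately have "((\<lambda>w. u w / ((g w - g p) / (w - p))) \<longlongrightarrow> u p / g') (at p)"
    using assms(8) by (intro tendsto_divide)
  then show "((\<lambda>w. u w / g w * (w - p)) \<longlongrightarrow> u p / g') (at p)"
    using assms(6) by simp
qed (use assms(1,2) in auto)

text \<open>\<alpha> is strictly positive because exp (-\<alpha> |y - Im z|) has to be an integrable
  majorant on the lines; a bound with a smaller rate implies one with a larger rate.\<close>

locale exp_type =
  fixes f :: "complex \<Rightarrow> complex" and \<alpha> \<rho> C :: real
  assumes hol: "f holomorphic_on {z. Re z > 0}"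
    and \<alpha>: "0 < \<alpha>" "\<alpha> < pi / 2" and \<rho>: "0 \<le> \<rho>" and C: "0 < C"
    and bound: "\<And>z. Re z > 0 \<Longrightarrow> norm (f z) \<le> C * exp (\<alpha> * \<bar>Im z\<bar> + \<rho> * Re z)"
begin

text \<open>\<open>kern \<xi> z = cot (\<pi> (\<xi> - z)) - cot (\<pi> \<xi>)\<close>, in a form that shows the decay in \<open>\<xi>\<close>.\<close>

definition kern :: "complex \<Rightarrow> complex \<Rightarrow> complex" where
  "kern \<xi> z = sin (of_real pi * z) / (sin (of_real pi * \<xi>) * sin (of_real pi * (\<xi> - z)))"

text \<open>The factor 1/2 is 1/(2i) times the i of d\<xi> = i dy. The finite sum runs over the
  positive integers to the left of the line.\<close>

definition line_sum :: "real \<Rightarrow> complex \<Rightarrow> complex" where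
  "line_sum c z = (\<Sum>j=1..nat \<lfloor>c\<rfloor>. f (of_nat j)) +
     1 / 2 * (LINT y|lborel. f (Complex c y) * kern (Complex c y) z)"

text \<open>The condition places Re (\<xi> - z) strictly between 0 and 1 on the line, so that
  neither sine in the denominator of the kernel vanishes there.\<close>

definition admissible :: "real \<Rightarrow> complex \<Rightarrow> bool" where
  "admissible c z \<longleftrightarrow> c > 0 \<and> c \<notin> \<int> \<and> c - 1 < Re z \<and> Re z < c"

text \<open>Let a = |Im z|, b = |Im \<xi>|, d = |Im \<xi> - Im z|. The sines contribute exp (pi (a -
  b - d)), and a - b - d <= 0 by the triangle inequality, so pi may be lowered to \<alpha> there;
  the growth exp (\<alpha> b) of \<open>f\<close> then cancels. In this way the rate in Im z stays
  \<alpha>, below what \<open>Gamma\<close> can absorb.\<close>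

lemma f_kern_bound:
  assumes \<xi>: "Re \<xi> > 0" and \<mu>: "\<mu> > 0" "norm (sin (of_real pi * \<xi>)) \<ge> \<mu> * exp (pi * \<bar>Im \<xi>\<bar>)"
    and \<nu>: "\<nu> > 0" "norm (sin (of_real pi * (\<xi> - z))) \<ge> \<nu> * exp (pi * \<bar>Im \<xi> - Im z\<bar>)"
  shows "norm (f \<xi> * kern \<xi> z) \<le> C * exp (\<rho> * Re \<xi>) / (\<mu> * \<nu>) * exp (\<alpha> * \<bar>Im z\<bar>) * exp (- \<alpha> * \<bar>Im \<xi> - Im z\<bar>)"
proof -
  let ?a = "\<bar>Im z\<bar>" and ?b = "\<bar>Im \<xi>\<bar>" and ?d = "\<bar>Im \<xi> - Im z\<bar>"
  have "norm (kern \<xi> z) = norm (sin (of_real pi * z)) / (norm (sin (of_real pi * \<xi>)) * norm (sin (of_real pi * (\<xi> - z))))"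
    by (simp add: kern_def norm_divide norm_mult)
  also have "\<dots> \<le> exp (pi * ?a) / ((\<mu> * exp (pi * ?b)) * (\<nu> * exp (pi * ?d)))"
  proof (rule frac_le)
    show "(\<mu> * exp (pi * ?b)) * (\<nu> * exp (pi * ?d)) \<le> norm (sin (of_real pi * \<xi>)) * norm (sin (of_real pi * (\<xi> - z)))"
      by (rule mult_mono[OF \<mu>(2) \<nu>(2)]) (use \<nu>(1) in auto)
  qed (use \<mu>(1) \<nu>(1) norm_sin_pi_le in auto)
  also have "\<dots> = 1 / (\<mu> * \<nu>) * exp (pi * (?a - ?b - ?d))"
    by (simp add: exp_diff right_diff_distrib)
  finally have k: "norm (kern \<xi> z) \<le> 1 / (\<mu> * \<nu>) * exp (pi * (?a - ?b - ?d))" .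
  have "norm (f \<xi> * kern \<xi> z) \<le> (C * exp (\<alpha> * ?b + \<rho> * Re \<xi>)) * (1 / (\<mu> * \<nu>) * exp (pi * (?a - ?b - ?d)))"
    unfolding norm_mult using C by (intro mult_mono[OF bound[OF \<xi>] k]) auto
  also have "\<dots> = C * exp (\<rho> * Re \<xi>) / (\<mu> * \<nu>) * exp (\<alpha> * ?b + pi * (?a - ?b - ?d))"
    by (simp add: exp_add)
  also have "\<dots> \<le> C * exp (\<rho> * Re \<xi>) / (\<mu> * \<nu>) * exp (\<alpha> * ?a + - \<alpha> * ?d)"
  proof (intro mult_left_mono)
    have "(pi - \<alpha>) * (?a - ?b - ?d) \<le> 0"
      using \<alpha> by (intro mult_nonneg_nonpos) auto
    then show "exp (\<alpha> * ?b + pi * (?a - ?b - ?d)) \<le> exp (\<alpha> * ?a + - \<alpha> * ?d)"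
      by (simp add: algebra_simps)
  qed (use C \<mu>(1) \<nu>(1) in auto)
  finally show ?thesis unfolding exp_add by (simp only: mult.assoc)
qed

text \<open>Recentres the decay at 0 at the price of doubling the rate in \<open>b\<close>, which is
  harmless while z is fixed or stays in a small disc.\<close>

lemma exp_shift_le: "exp (\<alpha> * \<bar>b\<bar>) * exp (- \<alpha> * \<bar>a - b\<bar>) \<le> exp (2 * \<alpha> * \<bar>b\<bar>) * exp (- \<alpha> * \<bar>a::real\<bar>)"
proof -
  have "\<alpha> * \<bar>a\<bar> \<le> \<alpha> * (\<bar>a - b\<bar> + \<bar>b\<bar>)" using \<alpha> by (intro mult_left_mono) auto
  then show ?thesis unfolding exp_add[symmetric] by (simp add: algebra_simps)
qed

lemma sin_pi_nonint: "c \<notin> \<int> \<Longrightarrow> sin (pi * c) \<noteq> 0"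
  using sin_of_real_pi_mult_eq_0_iff[of "of_real c"] Complex_not_Ints[of c 0]
  by (simp add: complex_of_real_def[of c, symmetric] sin_of_real flip: of_real_mult)

lemma line_bound:
  assumes "c > 0" "c \<notin> \<int>" "0 < r" "r \<le> 1/2" "r \<le> c - Re z" "c - Re z \<le> 1 - r"
  shows "norm (f (Complex c y) * kern (Complex c y) z)
    \<le> 4 * C * exp (\<rho> * c) / (\<bar>sin (pi * c)\<bar> * sin (pi * r)) * exp (\<alpha> * \<bar>Im z\<bar>) * exp (- \<alpha> * \<bar>y - Im z\<bar>)"
proof -
  have s: "sin (pi * r) > 0" using assms by (intro sin_gt_zero) auto
  have s2: "sin (pi * r) \<le> \<bar>sin (pi * (c - Re z))\<bar>"
    using sin_pi_ge[of r "c - Re z"] assms by auto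
  have "norm (f (Complex c y) * kern (Complex c y) z)
    \<le> C * exp (\<rho> * Re (Complex c y)) / ((\<bar>sin (pi * c)\<bar> / 2) * (sin (pi * r) / 2)) * exp (\<alpha> * \<bar>Im z\<bar>) * exp (- \<alpha> * \<bar>Im (Complex c y) - Im z\<bar>)"
  proof (rule f_kern_bound)
    show "\<bar>sin (pi * c)\<bar> / 2 * exp (pi * \<bar>Im (Complex c y)\<bar>) \<le> norm (sin (of_real pi * Complex c y))"
      using norm_sin_pi_ge[of "Complex c y"] by simp
    have "sin (pi * r) / 2 * exp (pi * \<bar>y - Im z\<bar>) \<le> \<bar>sin (pi * (c - Re z))\<bar> / 2 * exp (pi * \<bar>y - Im z\<bar>)"
      using s2 by (intro mult_right_mono) auto
    also have "\<dots> \<le> norm (sin (of_real pi * (Complex c y - z)))"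
      using norm_sin_pi_ge[of "Complex c y - z"] by simp
    finally show "sin (pi * r) / 2 * exp (pi * \<bar>Im (Complex c y) - Im z\<bar>) \<le> norm (sin (of_real pi * (Complex c y - z)))"
      by simp
  qed (use assms s sin_pi_nonint in auto)
  then show ?thesis by (simp add: field_simps)
qed

lemma line_continuous:
  assumes "admissible c z"
  shows "continuous_on UNIV (\<lambda>y. f (Complex c y) * kern (Complex c y) z)"
proof -
  have 1: "continuous_on UNIV (\<lambda>y. f (Complex c y))"
    using assms by (intro continuous_on_vertical[OF hol]) (auto simp: admissible_def)
  have "sin (of_real pi * Complex c y) \<noteq> 0" for y
    using assms Complex_not_Ints by (auto simp: sin_of_real_pi_mult_eq_0_iff admissible_def)
  moreover have "sin (of_real pi * (Complex c y - z)) \<noteq> 0" for y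
    using assms Re_unit_not_Ints[of "Complex c y - z"] by (auto simp: sin_of_real_pi_mult_eq_0_iff admissible_def)
  ultimately show ?thesis
    unfolding kern_def Complex_eq by (intro continuous_intros 1[unfolded Complex_eq]) auto
qed

lemma line_measurable:
  assumes "admissible c z"
  shows "(\<lambda>y. f (Complex c y) * kern (Complex c y) z) \<in> borel_measurable borel"
  by (intro borel_measurable_continuous_onI line_continuous assms)

lemma line_sum_holomorphic:
  assumes c: "c > 0" "c \<notin> \<int>"
  shows "line_sum c holomorphic_on {z. c - 1 < Re z \<and> Re z < c}"
proof -
  let ?S = "{z. c - 1 < Re z \<and> Re z < c}"
  have op: "open ?S"
    by (intro open_Collect_conj open_Collect_less continuous_intros)
  have "(\<lambda>z. LINT y|lborel. f (Complex c y) * kern (Complex c y) z) holomorphic_on ?S"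
  proof (rule holomorphic_on_lborel_integral[OF op])
    fix y
    have "sin (of_real pi * (Complex c y - z)) \<noteq> 0" if "z \<in> ?S" for z
      using that Re_unit_not_Ints[of "Complex c y - z"] by (auto simp: sin_of_real_pi_mult_eq_0_iff)
    moreover have "sin (of_real pi * Complex c y) \<noteq> 0"
      using c Complex_not_Ints by (auto simp: sin_of_real_pi_mult_eq_0_iff)
    ultimately show "(\<lambda>z. f (Complex c y) * kern (Complex c y) z) holomorphic_on ?S"
      unfolding kern_def by (intro holomorphic_intros) auto
  next
    fix z assume "z \<in> ?S"
    then show "(\<lambda>y. f (Complex c y) * kern (Complex c y) z) \<in> borel_measurable borel"
      using c by (intro line_measurable) (auto simp: admissible_def)
  next
    fix z assume z: "z \<in> ?S"
    \<comment> \<open>Half the distance to the nearer edge of the strip, so that every point of the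
      disc stays at least \<open>r\<close> away from both edges.\<close>
    define r where "r = min (c - Re z) (Re z - (c - 1)) / 2"
    have r: "r > 0" "r \<le> 1/2" "2 * r \<le> c - Re z" "2 * r \<le> Re z - (c - 1)" using z by (auto simp: r_def min_def)
    define A where "A = 4 * C * exp (\<rho> * c) / (\<bar>sin (pi * c)\<bar> * sin (pi * r)) * exp (2 * \<alpha> * (\<bar>Im z\<bar> + r))"
    have near: "\<bar>Re w - Re z\<bar> \<le> r" "\<bar>Im w\<bar> \<le> \<bar>Im z\<bar> + r" if "w \<in> cball z r" for w
      using abs_Re_le_cmod[of "w - z"] abs_Im_le_cmod[of "w - z"] that by (auto simp: dist_norm norm_minus_commute)
    have "cball z r \<subseteq> ?S"
    proof
      fix w assume "w \<in> cball z r"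
      from near(1)[OF this] show "w \<in> ?S" using r by auto
    qed
    moreover have "integrable lborel (\<lambda>y. A * exp (- \<alpha> * \<bar>y\<bar>))"
      using integrable_exp_minus_abs[OF \<alpha>(1)] by simp
    moreover have "norm (f (Complex c y) * kern (Complex c y) w) \<le> A * exp (- \<alpha> * \<bar>y\<bar>)" if w: "w \<in> cball z r" for w y
    proof -
      have s: "sin (pi * r) > 0" using r by (intro sin_gt_zero) auto
      have "norm (f (Complex c y) * kern (Complex c y) w)
        \<le> 4 * C * exp (\<rho> * c) / (\<bar>sin (pi * c)\<bar> * sin (pi * r)) * exp (\<alpha> * \<bar>Im w\<bar>) * exp (- \<alpha> * \<bar>y - Im w\<bar>)"
        using near(1)[OF w] r c by (intro line_bound) auto
      also have "\<dots> \<le> 4 * C * exp (\<rho> * c) / (\<bar>sin (pi * c)\<bar> * sin (pi * r)) * (exp (2 * \<alpha> * \<bar>Im w\<bar>) * exp (- \<alpha> * \<bar>y\<bar>))"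
        unfolding mult.assoc[of _ "exp _" "exp _"] using C s exp_shift_le[of "Im w" y] by (intro mult_left_mono) auto
      also have "\<dots> \<le> 4 * C * exp (\<rho> * c) / (\<bar>sin (pi * c)\<bar> * sin (pi * r)) * (exp (2 * \<alpha> * (\<bar>Im z\<bar> + r)) * exp (- \<alpha> * \<bar>y\<bar>))"
        using near(2)[OF w] C s \<alpha> by (intro mult_left_mono mult_right_mono) auto
      finally show ?thesis by (simp add: A_def mult.assoc)
    qed
    ultimately show "\<exists>r>0. \<exists>b. cball z r \<subseteq> ?S \<and> integrable lborel b \<and> (\<forall>w\<in>cball z r. \<forall>y. norm (f (Complex c y) * kern (Complex c y) w) \<le> b y)"
      using r(1) by blast
  qed
  then show ?thesis
    unfolding line_sum_def by (intro holomorphic_intros)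
qed

text \<open>Between the lines f * kern has simple poles at the integers, with residue -f/pi, and at
  the points of z + Z, with residue f/pi; as \<open>z\<close> is not an integer the two families are
  disjoint. The integer residues cancel against the terms that the finite sum gains, and only the
  sum over \<open>P2\<close> is left. \<open>a'\<close> and \<open>b'\<close> are confined so that
  the wider strip contains no further integers.\<close>

lemma line_sum_shift:
  assumes z: "z \<notin> \<int>" and c: "0 < c" "c < c'" "c \<notin> \<int>" "c' \<notin> \<int>"
    and ab: "a' < c" "c' < b'" "real_of_int \<lfloor>c\<rfloor> \<le> a'" "b' \<le> real_of_int \<lfloor>c'\<rfloor> + 1"
    and P2: "finite P2" "\<And>p. p \<in> P2 \<Longrightarrow> c < Re p \<and> Re p < c' \<and> p - z \<in> \<int>"
    and P2': "\<And>\<xi>. a' < Re \<xi> \<Longrightarrow> Re \<xi> < b' \<Longrightarrow> \<xi> - z \<in> \<int> \<Longrightarrow> \<xi> \<in> P2"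
  shows "line_sum c' z - line_sum c z = (\<Sum>p\<in>P2. f p)"
proof -
  define P1 where "P1 = (of_nat :: nat \<Rightarrow> complex) ` {nat \<lfloor>c\<rfloor> + 1..nat \<lfloor>c'\<rfloor>}"
  define G where "G \<xi> = f \<xi> * kern \<xi> z" for \<xi>
  define g where "g \<xi> = sin (of_real pi * \<xi>) * sin (of_real pi * (\<xi> - z))" for \<xi>
  have G_eq: "G = (\<lambda>\<xi>. (f \<xi> * sin (of_real pi * z)) / g \<xi>)"
    by (auto simp: G_def kern_def g_def)
  define S where "S = {s. a' < Re s \<and> Re s < b'}"
  have opS: "open S" unfolding S_def
    by (intro open_Collect_conj open_Collect_less continuous_intros)
  have a0: "a' \<ge> 0"
  proof -
    have "0 \<le> real_of_int \<lfloor>c\<rfloor>" using c(1) by simp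
    then show ?thesis using ab(3) by linarith
  qed
  have fl: "real_of_int \<lfloor>c\<rfloor> < c" "real_of_int \<lfloor>c'\<rfloor> < c'"
    using c of_int_floor_le[of c] of_int_floor_le[of c'] Ints_of_int[of "\<lfloor>c\<rfloor>"] Ints_of_int[of "\<lfloor>c'\<rfloor>"]
    by (auto simp: order_le_less simp del: Ints_of_int)
  have nfl: "real (nat \<lfloor>c\<rfloor>) = real_of_int \<lfloor>c\<rfloor>" "real (nat \<lfloor>c'\<rfloor>) = real_of_int \<lfloor>c'\<rfloor>" using c by auto
  have fin: "finite (P1 \<union> P2)" using P2 by (auto simp: P1_def)
  have P1: "c < Re p \<and> Re p < c'" "p \<in> \<int>" if pP: "p \<in> P1" for p
  proof -
    obtain j where j: "p = of_nat j" "nat \<lfloor>c\<rfloor> + 1 \<le> j" "j \<le> nat \<lfloor>c'\<rfloor>" using pP unfolding P1_def by auto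
    have "real (nat \<lfloor>c\<rfloor>) + 1 \<le> real j" "real j \<le> real (nat \<lfloor>c'\<rfloor>)" using j by linarith+
    then show "c < Re p \<and> Re p < c'" "p \<in> \<int>" using nfl fl j by (auto intro: less_le_trans[OF floor_correct[THEN conjunct2]])
  qed
  have disj: "P1 \<inter> P2 = {}"
  proof (rule ccontr)
    assume "P1 \<inter> P2 \<noteq> {}"
    then obtain p where p: "p \<in> P1" "p \<in> P2" by auto
    then have "p - (p - z) \<in> \<int>" using P1(2)[of p] P2(2)[of p] by (intro Ints_diff) auto
    then show False using z by simp
  qed
  have zero: "g \<xi> = 0 \<longleftrightarrow> \<xi> \<in> P1 \<union> P2" if "\<xi> \<in> S" for \<xi>
  proof
    assume "g \<xi> = 0"
    then consider "\<xi> \<in> \<int>" | "\<xi> - z \<in> \<int>" by (auto simp: g_def sin_of_real_pi_mult_eq_0_iff)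
    then show "\<xi> \<in> P1 \<union> P2"
    proof cases
      case 1
      then obtain n where n: "\<xi> = of_int n" by (auto elim: Ints_cases)
      have "real_of_int \<lfloor>c\<rfloor> < real_of_int n" "real_of_int n < real_of_int \<lfloor>c'\<rfloor> + 1"
        using that ab n by (auto simp: S_def)
      then have "\<lfloor>c\<rfloor> < n" "n \<le> \<lfloor>c'\<rfloor>" "0 \<le> \<lfloor>c\<rfloor>" using c by linarith+
      then have "0 \<le> n" "nat \<lfloor>c\<rfloor> < nat n" "nat n \<le> nat \<lfloor>c'\<rfloor>"
        by linarith+
      then have "\<xi> = of_nat (nat n)" "nat n \<in> {nat \<lfloor>c\<rfloor> + 1..nat \<lfloor>c'\<rfloor>}" using n by auto
      then show ?thesis by (auto simp: P1_def)
    next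
      case 2
      then show ?thesis using P2'[of \<xi>] that by (auto simp: S_def)
    qed
  next
    assume "\<xi> \<in> P1 \<union> P2"
    then show "g \<xi> = 0" using P1(2)[of \<xi>] P2(2)[of \<xi>] by (auto simp: g_def sin_of_real_pi_mult_eq_0_iff)
  qed
  have PS: "P1 \<union> P2 \<subseteq> S" using P1 P2(2) ab by (fastforce simp: S_def)
  have holu: "(\<lambda>\<xi>. f \<xi> * sin (of_real pi * z)) holomorphic_on S"
    using hol a0 by (intro holomorphic_intros) (auto intro: holomorphic_on_subset simp: S_def)
  have holg: "g holomorphic_on S" unfolding g_def by (intro holomorphic_intros)
  have holG: "G holomorphic_on S - (P1 \<union> P2)"
    unfolding G_eq using holu holg zero
    by (intro holomorphic_on_divide) (auto intro: holomorphic_on_subset)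
  have sz: "sin (of_real pi * z) \<noteq> 0" using z by (simp add: sin_of_real_pi_mult_eq_0_iff)
  have res: "residue G p = f p * sin (of_real pi * z) / g'" 
    if p: "p \<in> P1 \<union> P2" and g': "(g has_field_derivative g') (at p)" "g' \<noteq> 0" for p g'
    unfolding G_eq
  proof (rule residue_simple_quotient)
    let ?S = "S - (P1 \<union> P2 - {p})"
    show "open ?S" using opS fin by (intro open_Diff finite_imp_closed) auto
    show "p \<in> ?S" using p PS by auto
    show "(\<lambda>\<xi>. f \<xi> * sin (of_real pi * z)) holomorphic_on ?S" "g holomorphic_on ?S"
      using holu holg by (auto intro: holomorphic_on_subset)
    show "g w \<noteq> 0" if "w \<in> ?S - {p}" for w using zero[of w] that by auto
    show "g p = 0" using p PS zero by auto
  qed (use g' in auto)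
  have dg: "(g has_field_derivative of_real pi * (cos (of_real pi * p) * sin (of_real pi * (p - z)) + sin (of_real pi * p) * cos (of_real pi * (p - z)))) (at p)" for p
    unfolding g_def by (auto intro!: derivative_eq_intros simp: algebra_simps)
  \<comment> \<open>In this form periodicity evaluates the derivative at every pole: it is pi times
    -sin (pi z) at integers and sin (pi z) at points of z + Z, so the numerator of the kernel
    cancels.\<close>
  have dg': "of_real pi * (cos (of_real pi * p) * sin (of_real pi * (p - z)) + sin (of_real pi * p) * cos (of_real pi * (p - z)))
      = of_real pi * sin (of_real pi * (2 * p - z))" for p
  proof -
    have "of_real pi * (2 * p - z) = of_real pi * p + of_real pi * (p - z)" by (simp add: algebra_simps)
    then show ?thesis by (simp only: sin_add) simp
  qed
  have per: "sin (of_real pi * (w + 2 * of_int n)) = sin (of_real pi * w)" for w :: complex and n :: int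
  proof -
    have "sin (of_real pi * w + of_real (2 * pi * of_int n)) = sin (of_real pi * w)"
      by (simp add: sin_add sin_of_real cos_of_real del: of_real_mult)
    then show ?thesis by (simp add: algebra_simps)
  qed
  have res1: "residue G p = - f p / pi" if pP: "p \<in> P1" for p
  proof -
    obtain n where n: "p = of_int n" using P1(2)[OF pP] by (auto elim: Ints_cases)
    have "sin (of_real pi * (2 * p - z)) = - sin (of_real pi * z)"
      using per[of "-z" n] by (simp add: n algebra_simps)
    then show ?thesis using res[of p, OF _ dg] pP sz by (simp add: dg')
  qed
  have res2: "residue G p = f p / pi" if pP: "p \<in> P2" for p
  proof -
    obtain n where "p - z = of_int n" using P2(2)[OF pP] by (auto elim: Ints_cases)
    then have n: "p = z + of_int n" by (simp add: algebra_simps)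
    have "sin (of_real pi * (2 * p - z)) = sin (of_real pi * z)"
      using per[of z n] by (simp add: n algebra_simps)
    then show ?thesis using res[of p, OF _ dg] pP sz by (simp add: dg')
  qed
  define M where "M = C * exp (\<rho> * c') / (1/4 * (1/4)) * exp (2 * \<alpha> * \<bar>Im z\<bar>)"
  have "(LINT y|lborel. G (Complex c' y)) - (LINT y|lborel. G (Complex c y)) = 2 * pi * (\<Sum>p\<in>P1 \<union> P2. residue G p)"
  proof (rule vertical_shift(3)[where a' = a' and b' = b' and d = \<alpha> and Y = "\<bar>Im z\<bar> + 1" and M = M])
    show "G holomorphic_on {s. a' < Re s \<and> Re s < b'} - (P1 \<union> P2)" using holG by (simp add: S_def)
    show "c < Re p \<and> Re p < c'" if "p \<in> P1 \<union> P2" for p using that P1 P2(2) by auto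
    fix s assume s: "c \<le> Re s" "Re s \<le> c'" "\<bar>Im s\<bar> \<ge> \<bar>Im z\<bar> + 1"
    have "norm (G s) \<le> C * exp (\<rho> * Re s) / (1/4 * (1/4)) * exp (\<alpha> * \<bar>Im z\<bar>) * exp (- \<alpha> * \<bar>Im s - Im z\<bar>)"
      unfolding G_def
    proof (rule f_kern_bound)
      show "1/4 * exp (pi * \<bar>Im s\<bar>) \<le> norm (sin (of_real pi * s))"
        using s by (intro norm_sin_pi_ge_far) auto
      show "1/4 * exp (pi * \<bar>Im s - Im z\<bar>) \<le> norm (sin (of_real pi * (s - z)))"
        using norm_sin_pi_ge_far[of "s - z"] s by simp
    qed (use s c in auto)
    also have "\<dots> \<le> C * exp (\<rho> * Re s) / (1/4 * (1/4)) * (exp (2 * \<alpha> * \<bar>Im z\<bar>) * exp (- \<alpha> * \<bar>Im s\<bar>))"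
      unfolding mult.assoc[of _ "exp _" "exp _"] using C exp_shift_le[of "Im z" "Im s"] by (intro mult_left_mono) auto
    also have "\<dots> \<le> C * exp (\<rho> * c') / (1/4 * (1/4)) * (exp (2 * \<alpha> * \<bar>Im z\<bar>) * exp (- \<alpha> * \<bar>Im s\<bar>))"
      using s C \<rho> by (intro mult_right_mono divide_right_mono mult_left_mono) (auto intro: mult_left_mono)
    finally show "norm (G s) \<le> M * exp (- \<alpha> * \<bar>Im s\<bar>)" by (simp add: M_def mult.assoc)
  qed (use ab c fin \<alpha> in auto)
  also have "(\<Sum>p\<in>P1 \<union> P2. residue G p) = (\<Sum>p\<in>P1. - f p / pi) + (\<Sum>p\<in>P2. f p / pi)"
    using fin disj res1 res2 by (subst sum.union_disjoint) auto
  also have "(\<Sum>p\<in>P1. - f p / pi) = - (\<Sum>p\<in>P1. f p) / pi"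
    by (simp add: sum_divide_distrib sum_negf)
  also have "(\<Sum>p\<in>P2. f p / pi) = (\<Sum>p\<in>P2. f p) / pi" by (simp add: sum_divide_distrib)
  also have "2 * pi * (- (\<Sum>p\<in>P1. f p) / pi + (\<Sum>p\<in>P2. f p) / pi) = 2 * ((\<Sum>p\<in>P2. f p) - (\<Sum>p\<in>P1. f p))"
    by (simp add: field_simps)
  finally have I: "(LINT y|lborel. G (Complex c' y)) - (LINT y|lborel. G (Complex c y)) = 2 * ((\<Sum>p\<in>P2. f p) - (\<Sum>p\<in>P1. f p))" .
  have "(\<Sum>p\<in>P1. f p) = (\<Sum>j=nat \<lfloor>c\<rfloor> + 1..nat \<lfloor>c'\<rfloor>. f (of_nat j))"
    unfolding P1_def by (subst sum.reindex) (auto simp: inj_on_def)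
  moreover have "(\<Sum>j=1..nat \<lfloor>c'\<rfloor>. f (of_nat j)) = (\<Sum>j=1..nat \<lfloor>c\<rfloor>. f (of_nat j)) + (\<Sum>j=nat \<lfloor>c\<rfloor> + 1..nat \<lfloor>c'\<rfloor>. f (of_nat j))"
  proof -
    have "nat \<lfloor>c\<rfloor> \<le> nat \<lfloor>c'\<rfloor>" using c by (intro nat_mono floor_mono) auto
    then have "{1..nat \<lfloor>c'\<rfloor>} = {1..nat \<lfloor>c\<rfloor>} \<union> {nat \<lfloor>c\<rfloor> + 1..nat \<lfloor>c'\<rfloor>}" by auto
    then show ?thesis by (simp only:) (subst sum.union_disjoint, auto)
  qed
  moreover have "(LINT y|lborel. G (Complex c' y)) = (LINT y|lborel. G (Complex c y)) + 2 * ((\<Sum>p\<in>P2. f p) - (\<Sum>p\<in>P1. f p))"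
    using I by (simp add: diff_eq_eq add.commute)
  ultimately show ?thesis
    unfolding line_sum_def G_def by (simp add: field_simps)
qed

text \<open>Lines through integers are excluded, so no uniform formula for the line offers itself;
  any admissible choice gives the same value.\<close>

definition psum :: "complex \<Rightarrow> complex" where
  "psum z = line_sum (SOME c. admissible c z) z"

lemma kern_Ints: "z \<in> \<int> \<Longrightarrow> kern \<xi> z = 0"
  using sin_of_real_pi_mult_eq_0_iff[of z] by (simp add: kern_def)

lemma line_sum_Ints: "z \<in> \<int> \<Longrightarrow> line_sum c z = (\<Sum>j=1..nat \<lfloor>c\<rfloor>. f (of_nat j))"
  by (simp add: line_sum_def kern_Ints)

text \<open>Both lines lie strictly between Re z and Re z + 1, where z + Z has no point, so the
  shift picks up nothing. For integer \<open>z\<close> the kernel vanishes and both lines have floor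
  \<open>z\<close>.\<close>

lemma line_sum_unique_less:
  assumes c: "admissible c z" "admissible c' z" "c < c'"
  shows "line_sum c z = line_sum c' z"
proof (cases "z \<in> \<int>")
  case True
  then obtain n where n: "z = of_int n" by (rule Ints_cases)
  have "\<lfloor>c\<rfloor> = n" "\<lfloor>c'\<rfloor> = n"
    using c n by (auto simp: admissible_def floor_eq_iff)
  then show ?thesis using line_sum_Ints[OF True] by simp
next
  case False
  note c' = c[unfolded admissible_def]
  have fl: "real_of_int \<lfloor>c\<rfloor> < c"
    using c' Ints_of_int[of "\<lfloor>c\<rfloor>"] of_int_floor_le[of c] by (metis order_le_less)
  have "line_sum c' z - line_sum c z = (\<Sum>p\<in>{}. f p)"
  proof (rule line_sum_shift[where a' = "max (real_of_int \<lfloor>c\<rfloor>) (Re z)" and b' = "min (real_of_int \<lfloor>c'\<rfloor> + 1) (Re z + 1)"])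
    show "c' < min (real_of_int \<lfloor>c'\<rfloor> + 1) (Re z + 1)" using c' floor_correct[of c'] by auto
    show "\<xi> \<in> {}" if "max (real_of_int \<lfloor>c\<rfloor>) (Re z) < Re \<xi>" "Re \<xi> < min (real_of_int \<lfloor>c'\<rfloor> + 1) (Re z + 1)" "\<xi> - z \<in> \<int>" for \<xi>
      using Re_unit_not_Ints[of "\<xi> - z"] that by auto
  qed (use c' fl False c(3) in auto)
  then show ?thesis by simp
qed

lemma ex_admissible: "Re z > -1 \<Longrightarrow> \<exists>c. admissible c z"
  using ex_non_int_between[of "max 0 (Re z)" "Re z + 1"] by (auto simp: admissible_def)

lemma psum_eq_line_sum:
  assumes "admissible c z"
  shows "psum z = line_sum c z"
proof -
  have *: "admissible (SOME c. admissible c z) z" using assms by (rule someI)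
  show ?thesis
    unfolding psum_def
    using line_sum_unique_less[OF * assms] line_sum_unique_less[OF assms *] by (metis less_linear)
qed

lemma psum_holomorphic: "psum holomorphic_on {z. Re z > -1}"
proof -
  have "psum field_differentiable at z" if z: "Re z > -1" for z
  proof -
    obtain c where c: "admissible c z" using ex_admissible[OF z] by blast
    let ?S = "{z. c - 1 < Re z \<and> Re z < c}"
    have op: "open ?S"
      by (intro open_Collect_conj open_Collect_less continuous_intros)
    have "psum holomorphic_on ?S"
      using line_sum_holomorphic[of c]
    proof (rule holomorphic_transform)
      show "line_sum c w = psum w" if "w \<in> ?S" for w
        using that c by (intro psum_eq_line_sum[symmetric]) (auto simp: admissible_def)
    qed (use c in \<open>auto simp: admissible_def\<close>)
    then show ?thesis
      using op c by (intro holomorphic_on_imp_differentiable_at[of _ ?S]) (auto simp: admissible_def)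
  qed
  then show ?thesis
    by (simp add: holomorphic_on_def field_differentiable_at_within)
qed

lemma psum_of_nat: "psum (of_nat n) = (\<Sum>j=1..n. f (of_nat j))"
proof -
  obtain c where c: "admissible c (of_nat n)" using ex_admissible[of "of_nat n"] by auto
  have "\<lfloor>c\<rfloor> = int n" using c by (auto simp: admissible_def floor_eq_iff)
  then show ?thesis
    using psum_eq_line_sum[OF c] line_sum_Ints[of "of_nat n" c] by simp
qed

lemma psum_0: "psum 0 = 0"
  using psum_of_nat[of 0] by simp

lemma kern_minus_1: "kern \<xi> (z - 1) = kern \<xi> z"
proof -
  have "sin (of_real pi * (z - 1)) = - sin (of_real pi * z)"
    by (simp add: right_diff_distrib sin_diff)
  moreover have "sin (of_real pi * (\<xi> - (z - 1))) = - sin (of_real pi * (\<xi> - z))"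
  proof -
    have "of_real pi * (\<xi> - (z - 1)) = of_real pi * (\<xi> - z) + of_real pi" by (simp add: algebra_simps)
    then show ?thesis by (simp only: sin_add) simp
  qed
  ultimately show ?thesis by (simp add: kern_def)
qed

text \<open>The kernel has period 1 in \<open>z\<close>, so \<open>psum (z - 1)\<close> is also
  \<open>line_sum c z\<close> for a line just left of \<open>z\<close>, which is not admissible for
  \<open>z\<close>. Moving it to c + 1, which is admissible, crosses exactly one point of z + Z,
  namely \<open>z\<close> itself. At integer \<open>z\<close> the two families of poles collide, so
  the sums are compared directly.\<close>

lemma psum_step:
  assumes z: "Re z > 0"
  shows "psum z = psum (z - 1) + f z"
proof -
  obtain c where c: "c \<notin> \<int>" "max 0 (Re z - 1) < c" "c < Re z"
    using ex_non_int_between[of "max 0 (Re z - 1)" "Re z"] z by auto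
  have c1: "c + 1 \<notin> \<int>"
  proof
    assume "c + 1 \<in> \<int>"
    then have "c + 1 - 1 \<in> \<int>" by (rule Ints_diff) simp
    then show False using c by simp
  qed
  have ad: "admissible c (z - 1)" "admissible (c + 1) z" using c c1 by (auto simp: admissible_def)
  have fl: "real_of_int \<lfloor>c\<rfloor> < c"
    using c Ints_of_int[of "\<lfloor>c\<rfloor>"] of_int_floor_le[of c] by (metis order_le_less)
  have "line_sum (c + 1) z - line_sum c (z - 1) = f z"
  proof (cases "z \<in> \<int>")
    case True
    then obtain n where n: "z = of_int n" by (rule Ints_cases)
    have n0: "n > 0" using z n by simp
    have "\<lfloor>c\<rfloor> = n - 1" using c n by (auto simp: floor_eq_iff)
    moreover from this have "\<lfloor>c + 1\<rfloor> = n" by simp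
    moreover have "nat n = Suc (nat (n - 1))" using n0 by simp
    moreover have "z - 1 \<in> \<int>" using True by simp
    ultimately show ?thesis
      using line_sum_Ints[OF True, of "c + 1"] line_sum_Ints[of "z - 1" c] n n0 by simp
  next
    case False
    have "line_sum (c + 1) z - line_sum c z = (\<Sum>p\<in>{z}. f p)"
    proof (rule line_sum_shift[where a' = "max (real_of_int \<lfloor>c\<rfloor>) (Re z - 1)" and b' = "min (real_of_int \<lfloor>c + 1\<rfloor> + 1) (Re z + 1)"])
      show "c + 1 < min (real_of_int \<lfloor>c + 1\<rfloor> + 1) (Re z + 1)" using c floor_correct[of "c + 1"] by auto
      show "\<xi> \<in> {z}" if "max (real_of_int \<lfloor>c\<rfloor>) (Re z - 1) < Re \<xi>" "Re \<xi> < min (real_of_int \<lfloor>c + 1\<rfloor> + 1) (Re z + 1)" "\<xi> - z \<in> \<int>" for \<xi>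
      proof -
        from that(3) obtain n where n: "\<xi> - z = of_int n" by (rule Ints_cases)
        then have "Re \<xi> - Re z = of_int n" by (simp add: complex_eq_iff)
        then have "- 1 < real_of_int n" "real_of_int n < 1" using that by auto
        then have "n = 0" by simp
        then show ?thesis using n by simp
      qed
    qed (use c c1 fl False in auto)
    moreover have "line_sum c (z - 1) = line_sum c z" by (simp add: line_sum_def kern_minus_1)
    ultimately show ?thesis by simp
  qed
  then show ?thesis
    using psum_eq_line_sum[OF ad(1)] psum_eq_line_sum[OF ad(2)] by (simp add: diff_eq_eq add.commute)
qed

section \<open>Growth of the interpolant\<close>

lemma sin_pi_quarter_ge: "sin (pi * (1/4)) \<ge> 1/2" "sin (pi * (3/4)) \<ge> 1/2"
proof -
  have "sqrt 2 \<ge> 1" by simp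
  then show 1: "sin (pi * (1/4)) \<ge> 1/2" using sin_45 by simp
  show "sin (pi * (3/4)) \<ge> 1/2" using sin_pi_ge[of "1/4" "3/4"] 1 by linarith
qed

lemma psum_bound_strip:
  obtains B where "B > 0" "\<And>z. - 1/2 \<le> Re z \<Longrightarrow> Re z \<le> 1/2 \<Longrightarrow> norm (psum z) \<le> B * exp (\<alpha> * \<bar>Im z\<bar>)"
proof -
  define I where "I = (LINT y|lborel. exp (- \<alpha> * \<bar>y\<bar>))"
  have int: "integrable lborel (\<lambda>y. exp (- \<alpha> * \<bar>y\<bar>))" by (rule integrable_exp_minus_abs[OF \<alpha>(1)])
  define A where "A = 16 * C * exp \<rho>"
  have A: "A > 0" using C by (simp add: A_def)
  have I0: "I \<ge> 0" unfolding I_def by (intro integral_nonneg_AE) auto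
  show ?thesis
  proof (rule that[of "A * I + 1"])
    \<comment> \<open>Adding 1 secures strict positivity, as \<open>I\<close> is only known to be
      nonnegative.\<close>
    show "A * I + 1 > 0" using A I0 by (simp add: add_nonneg_pos)
    fix z assume z: "- 1/2 \<le> Re z" "Re z \<le> 1/2"
    \<comment> \<open>For either sign of Re z this keeps the line at a distance of at least 1/4 from
      the integers and from z + Z.\<close>
    define c :: real where "c = (if Re z \<le> 0 then 1/4 else 3/4)"
    have c: "c \<in> {1/4, 3/4}" "1/4 \<le> c - Re z" "c - Re z \<le> 3/4" using z by (auto simp: c_def)
    have cf: "\<lfloor>c\<rfloor> = 0" using c by (auto simp: floor_eq_iff)
    have "c \<notin> \<int>"
    proof
      assume "c \<in> \<int>"
      then obtain n where "c = of_int n" by (rule Ints_cases)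
      then show False using c(1) cf by auto
    qed
    then have ad: "admissible c z" using c by (auto simp: admissible_def)
    have "norm (f (Complex c y) * kern (Complex c y) z) \<le> A * exp (\<alpha> * \<bar>Im z\<bar>) * exp (- \<alpha> * \<bar>y - Im z\<bar>)" for y
    proof -
      have "norm (f (Complex c y) * kern (Complex c y) z)
        \<le> 4 * C * exp (\<rho> * c) / (\<bar>sin (pi * c)\<bar> * sin (pi * (1/4))) * exp (\<alpha> * \<bar>Im z\<bar>) * exp (- \<alpha> * \<bar>y - Im z\<bar>)"
        using ad c by (intro line_bound) (auto simp: admissible_def)
      also have "\<dots> \<le> 4 * C * exp (\<rho> * 1) / (1/2 * (1/2)) * exp (\<alpha> * \<bar>Im z\<bar>) * exp (- \<alpha> * \<bar>y - Im z\<bar>)"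
      proof -
        have "1/2 \<le> \<bar>sin (pi * c)\<bar>" using sin_pi_quarter_ge by (auto simp: c_def)
        then have "1/2 * (1/2) \<le> \<bar>sin (pi * c)\<bar> * sin (pi * (1/4))"
          using sin_pi_quarter_ge by (intro mult_mono) auto
        moreover have "4 * C * exp (\<rho> * c) \<le> 4 * C * exp (\<rho> * 1)"
          using C \<rho> c by (intro mult_left_mono) (auto intro: mult_left_mono simp del: mult_1_right)
        ultimately have "4 * C * exp (\<rho> * c) / (\<bar>sin (pi * c)\<bar> * sin (pi * (1/4))) \<le> 4 * C * exp (\<rho> * 1) / (1/2 * (1/2))"
          using C by (intro frac_le) auto
        then show ?thesis by (intro mult_right_mono) auto
      qed
      finally show ?thesis by (simp add: A_def)
    qed
    note bd = this
    have int2: "integrable lborel (\<lambda>y. exp (- \<alpha> * \<bar>- Im z + 1 * y\<bar>))"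
      by (rule lborel_integrable_real_affine[OF int]) auto
    have I2: "I = (LINT y|lborel. exp (- \<alpha> * \<bar>- Im z + 1 * y\<bar>))"
      unfolding I_def using lborel_integral_real_affine[of 1 "\<lambda>y. exp (- \<alpha> * \<bar>y\<bar>)" "- Im z"] by simp
    have "norm (LINT y|lborel. f (Complex c y) * kern (Complex c y) z) \<le> (LINT y|lborel. A * exp (\<alpha> * \<bar>Im z\<bar>) * exp (- \<alpha> * \<bar>- Im z + 1 * y\<bar>))"
      using int2 bd by (intro norm_integral_le_of_bound integrable_mult_right) simp_all
    also have "\<dots> = A * I * exp (\<alpha> * \<bar>Im z\<bar>)"
      unfolding I2 by simp
    finally have "norm (LINT y|lborel. f (Complex c y) * kern (Complex c y) z) \<le> A * I * exp (\<alpha> * \<bar>Im z\<bar>)" .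
    moreover have "norm (psum z) = 1/2 * norm (LINT y|lborel. f (Complex c y) * kern (Complex c y) z)"
      unfolding psum_eq_line_sum[OF ad] line_sum_def cf by (simp add: norm_mult)
    moreover have "A * I * exp (\<alpha> * \<bar>Im z\<bar>) \<le> (A * I + 1) * exp (\<alpha> * \<bar>Im z\<bar>)"
      by (intro mult_right_mono) auto
    ultimately show "norm (psum z) \<le> (A * I + 1) * exp (\<alpha> * \<bar>Im z\<bar>)"
      using norm_ge_zero[of "LINT y|lborel. f (Complex c y) * kern (Complex c y) z"] by linarith
  qed
qed

text \<open>Induction over unit strips by the difference equation: the bound at z - 1 and the bound
  on f z each use up at most half of the bound at \<open>z\<close>.\<close>

lemma psum_bound:
  obtains B \<kappa> where "B > 0" "\<kappa> > 0"
    "\<And>z. - 1/2 \<le> Re z \<Longrightarrow> norm (psum z) \<le> B * exp (\<alpha> * \<bar>Im z\<bar> + \<kappa> * Re z)"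
proof -
  obtain B0 where B0: "B0 > 0" "\<And>z. - 1/2 \<le> Re z \<Longrightarrow> Re z \<le> 1/2 \<Longrightarrow> norm (psum z) \<le> B0 * exp (\<alpha> * \<bar>Im z\<bar>)"
    using psum_bound_strip by blast
  \<comment> \<open>\<kappa> >= 1 gives exp (-\<kappa>) <= 1/2, which halves the contribution of z -
    1; \<kappa> >= \<rho> lets the bound dominate that of \<open>f\<close>.\<close>
  define \<kappa> where "\<kappa> = \<rho> + 1"
  have \<kappa>: "\<kappa> \<ge> 1" "\<kappa> \<ge> \<rho>" using \<rho> by (auto simp: \<kappa>_def)
  \<comment> \<open>The factor exp \<kappa> pays for negative real parts in the base strip, where Re
    z >= -1; the term 2 C makes \<open>f\<close> at most half of the bound.\<close>
  define B where "B = B0 * exp \<kappa> + 2 * C"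
  have B: "B > 0" "B \<ge> B0 * exp \<kappa>" "B \<ge> 2 * C" using B0 C by (auto simp: B_def intro: add_pos_pos)
  have "norm (psum z) \<le> B * exp (\<alpha> * \<bar>Im z\<bar> + \<kappa> * Re z)" if "- 1/2 \<le> Re z" "Re z \<le> 1/2 + real n" for n z
    using that
  proof (induction n arbitrary: z)
    case 0
    have "norm (psum z) \<le> B0 * exp (\<alpha> * \<bar>Im z\<bar>)" using 0 B0(2)[of z] by simp
    also have "\<dots> = B0 * exp \<kappa> * exp (\<alpha> * \<bar>Im z\<bar> + \<kappa> * (-1))" by (simp flip: exp_add)
    also have "\<dots> \<le> B0 * exp \<kappa> * exp (\<alpha> * \<bar>Im z\<bar> + \<kappa> * Re z)"
    proof -
      have "\<kappa> * (-1) \<le> \<kappa> * Re z" using \<kappa> 0 by (intro mult_left_mono) auto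
      then show ?thesis using B0 by (intro mult_left_mono) auto
    qed
    also have "\<dots> \<le> B * exp (\<alpha> * \<bar>Im z\<bar> + \<kappa> * Re z)" using B by (intro mult_right_mono) auto
    finally show ?case .
  next
    case (Suc n)
    show ?case
    proof (cases "Re z \<le> 1/2 + real n")
      case True
      then show ?thesis using Suc by simp
    next
      case False
      then have z: "Re z > 1/2" by simp
      have "norm (psum z) \<le> norm (psum (z - 1)) + norm (f z)"
        using psum_step[of z] z norm_triangle_ineq by simp
      also have "norm (psum (z - 1)) \<le> B * exp (\<alpha> * \<bar>Im (z - 1)\<bar> + \<kappa> * Re (z - 1))"
        by (rule Suc.IH) (use z Suc.prems in auto)
      also have "\<dots> = exp (- \<kappa>) * B * exp (\<alpha> * \<bar>Im z\<bar> + \<kappa> * Re z)"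
        by (simp add: right_diff_distrib exp_diff exp_add exp_minus field_simps)
      also have "\<dots> \<le> 1/2 * B * exp (\<alpha> * \<bar>Im z\<bar> + \<kappa> * Re z)"
      proof -
        have "2 \<le> exp \<kappa>" using exp_ge_add_one_self[of \<kappa>] \<kappa> by linarith
        then have "exp (- \<kappa>) \<le> 1/2" by (simp add: exp_minus field_simps)
        then show ?thesis using B by (intro mult_right_mono) auto
      qed
      also have "norm (f z) \<le> C * exp (\<alpha> * \<bar>Im z\<bar> + \<rho> * Re z)" using z by (intro bound) auto
      also have "\<dots> \<le> 1/2 * B * exp (\<alpha> * \<bar>Im z\<bar> + \<kappa> * Re z)"
        using B C \<kappa> z by (intro mult_mono) (auto intro: mult_right_mono)
      finally show ?thesis by simp
    qed
  qed
  note * = this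
  have "norm (psum z) \<le> B * exp (\<alpha> * \<bar>Im z\<bar> + \<kappa> * Re z)" if "- 1/2 \<le> Re z" for z
    by (rule *[OF that, of "nat \<lceil>Re z\<rceil>"]) linarith
  then show ?thesis using that[of B \<kappa>] B \<kappa> by auto
qed

section \<open>The indefinite sum\<close>

lemma f_strip_bound:
  assumes "0 < a"
  shows "\<And>s. a \<le> Re s \<Longrightarrow> Re s \<le> b \<Longrightarrow> norm (f s) \<le> C * exp (\<rho> * b) * exp (\<alpha> * \<bar>Im s\<bar>)"
proof -
  fix s assume s: "a \<le> Re s" "Re s \<le> b"
  have "norm (f s) \<le> C * exp (\<alpha> * \<bar>Im s\<bar> + \<rho> * Re s)" using assms s by (intro bound) auto
  also have "\<dots> \<le> C * exp (\<alpha> * \<bar>Im s\<bar> + \<rho> * b)"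
    using C \<rho> s by (intro mult_left_mono) (auto intro: mult_left_mono)
  finally show "norm (f s) \<le> C * exp (\<rho> * b) * exp (\<alpha> * \<bar>Im s\<bar>)" by (simp add: exp_add mult_ac)
qed

lemma psum_strip_bound:
  obtains B where "\<And>s. - 1/2 \<le> Re s \<Longrightarrow> Re s \<le> b \<Longrightarrow> norm (psum s) \<le> B * exp (\<alpha> * \<bar>Im s\<bar>)"
proof -
  obtain B \<kappa> where B: "B > 0" "\<kappa> > 0" "\<And>z. - 1/2 \<le> Re z \<Longrightarrow> norm (psum z) \<le> B * exp (\<alpha> * \<bar>Im z\<bar> + \<kappa> * Re z)"
    using psum_bound by blast
  show ?thesis
  proof (rule that[of "B * exp (\<kappa> * b)"])
    fix s assume s: "- 1/2 \<le> Re s" "Re s \<le> b"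
    have "norm (psum s) \<le> B * exp (\<alpha> * \<bar>Im s\<bar> + \<kappa> * Re s)" using s B by auto
    also have "\<dots> \<le> B * exp (\<alpha> * \<bar>Im s\<bar> + \<kappa> * b)"
      using B s by (intro mult_left_mono) (auto intro: mult_left_mono)
    finally show "norm (psum s) \<le> B * exp (\<kappa> * b) * exp (\<alpha> * \<bar>Im s\<bar>)" by (simp add: exp_add mult_ac)
  qed
qed

lemma \<alpha>_nonneg: "0 \<le> \<alpha>" using \<alpha> by simp

lemma f_line_integral:
  assumes "\<sigma> > 0" "x > 0"
  shows "integrable lborel (\<lambda>y. Gamma (Complex \<sigma> y) * f (Complex \<sigma> y) * of_real x powr (- Complex \<sigma> y))"
    and "(LINT y|lborel. Gamma (Complex \<sigma> y) * f (Complex \<sigma> y) * of_real x powr (- Complex \<sigma> y)) =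
         (LINT y|lborel. Gamma (Complex (3/4) y) * f (Complex (3/4) y) * of_real x powr (- Complex (3/4) y))"
proof -
  have sh: "integrable lborel (\<lambda>y. Gamma (Complex a y) * f (Complex a y) * of_real x powr (- Complex a y))"
    "(LINT y|lborel. Gamma (Complex a y) * f (Complex a y) * of_real x powr (- Complex a y)) =
     (LINT y|lborel. Gamma (Complex b y) * f (Complex b y) * of_real x powr (- Complex b y))"
    if ab: "0 < a" "a < b" for a b
  proof -
    have ab': "-1 < a" "a < b" "a \<noteq> 0" "b \<noteq> 0" "0 < a" using ab by auto
    note sh = Gamma_powr_shift[OF \<alpha>_nonneg \<alpha>(2) assms(2) ab'(1-4) hol ab'(5) _ f_strip_bound[OF ab'(5)]]
    show "integrable lborel (\<lambda>y. Gamma (Complex a y) * f (Complex a y) * of_real x powr (- Complex a y))"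
      by (rule sh(1)) (use ab in auto)
    show "(LINT y|lborel. Gamma (Complex a y) * f (Complex a y) * of_real x powr (- Complex a y)) =
     (LINT y|lborel. Gamma (Complex b y) * f (Complex b y) * of_real x powr (- Complex b y))"
      by (rule sh(3)) (use ab in auto)
  qed
  show "integrable lborel (\<lambda>y. Gamma (Complex \<sigma> y) * f (Complex \<sigma> y) * of_real x powr (- Complex \<sigma> y))"
    using sh(1)[of \<sigma> "\<sigma> + 1"] assms by auto
  consider "\<sigma> < 3/4" | "\<sigma> = 3/4" | "\<sigma> > 3/4" by linarith
  then show "(LINT y|lborel. Gamma (Complex \<sigma> y) * f (Complex \<sigma> y) * of_real x powr (- Complex \<sigma> y)) =
         (LINT y|lborel. Gamma (Complex (3/4) y) * f (Complex (3/4) y) * of_real x powr (- Complex (3/4) y))"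
  proof cases
    case 1
    then show ?thesis by (rule sh(2)[OF assms(1)])
  next
    case 2
    then show ?thesis by (simp only:)
  next
    case 3
    then show ?thesis by (intro sh(2)[symmetric]) auto
  qed
qed

text \<open>On Re s = -1/4 the power x powr -s vanishes at 0 like x^(1/4), its derivative is still
  integrable there, and the growth bound for \<open>psum\<close> is available.\<close>

definition psi :: "real \<Rightarrow> complex" where
  "psi y = Gamma (Complex (- 1/4) y) * psum (Complex (- 1/4) y)"

lemma psum_line_integral:
  assumes "x > 0" "c > 0"
  shows "integrable lborel (\<lambda>y. psi y * of_real x powr (- Complex (- 1/4) y))"
    "integrable lborel (\<lambda>y. Gamma (Complex c y) * psum (Complex c y) * of_real x powr (- Complex c y))"
    "(LINT y|lborel. psi y * of_real x powr (- Complex (- 1/4) y)) =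
     (LINT y|lborel. Gamma (Complex c y) * psum (Complex c y) * of_real x powr (- Complex c y))"
proof -
  obtain B where B: "\<And>s. - 1/2 \<le> Re s \<Longrightarrow> Re s \<le> c \<Longrightarrow> norm (psum s) \<le> B * exp (\<alpha> * \<bar>Im s\<bar>)"
    using psum_strip_bound by blast
  have ab: "-1 < (- 1/4 :: real)" "- 1/4 < c" "- 1/4 \<noteq> (0::real)" "c \<noteq> 0" "-1 < (- 1/4 :: real)" using assms by auto
  note sh = Gamma_powr_shift[OF \<alpha>_nonneg \<alpha>(2) assms(1) ab(1-4) psum_holomorphic ab(5) psum_0, where B = B]
  show "integrable lborel (\<lambda>y. psi y * of_real x powr (- Complex (- 1/4) y))"
    unfolding psi_def by (rule sh(1)) (auto intro: B)
  show "integrable lborel (\<lambda>y. Gamma (Complex c y) * psum (Complex c y) * of_real x powr (- Complex c y))"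
    by (rule sh(2)) (auto intro: B)
  show "(LINT y|lborel. psi y * of_real x powr (- Complex (- 1/4) y)) =
     (LINT y|lborel. Gamma (Complex c y) * psum (Complex c y) * of_real x powr (- Complex c y))"
    unfolding psi_def by (rule sh(3)) (auto intro: B)
qed

lemma psi_integrable: "integrable lborel psi"
  using psum_line_integral(1)[of 1 1] by simp

lemma psi_shifted:
  assumes "x > 0"
  shows "psi y * Complex (- 1/4) y * of_real x powr (- Complex (- 1/4) y - 1) =
    Gamma (Complex (3/4) y) * psum (Complex (3/4) y - 1) * of_real x powr (- Complex (3/4) y)"
proof -
  have w: "Complex (- 1/4) y \<notin> \<int>\<^sub>\<le>\<^sub>0"
  proof
    assume "Complex (- 1/4) y \<in> \<int>\<^sub>\<le>\<^sub>0"
    then obtain n where "Complex (- 1/4) y = of_int n" by (auto elim!: nonpos_Ints_cases)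
    then have "- 1/4 = real_of_int n" by (simp add: complex_eq_iff)
    then have "real_of_int (4 * n) = -1" by simp
    then have "4 * n = -1" by linarith
    then show False by presburger
  qed
  have eq: "Complex (- 1/4) y + 1 = Complex (3/4) y" by (simp add: complex_eq_iff)
  have "Gamma (Complex (3/4) y) = Complex (- 1/4) y * Gamma (Complex (- 1/4) y)"
    using Gamma_plus1[OF w] unfolding eq .
  moreover have "Complex (3/4) y - 1 = Complex (- 1/4) y" by (simp add: complex_eq_iff)
  moreover have "- Complex (- 1/4) y - 1 = - Complex (3/4) y" by (simp add: complex_eq_iff)
  ultimately show ?thesis by (simp add: psi_def mult_ac)
qed

lemma psi_mult_integrable:
  assumes "x > 0"
  shows "integrable lborel (\<lambda>y. psi y * Complex (- 1/4) y * of_real x powr (- Complex (- 1/4) y - 1))"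
proof -
  obtain B where B: "\<And>s. - 1/2 \<le> Re s \<Longrightarrow> Re s \<le> 1 \<Longrightarrow> norm (psum s) \<le> B * exp (\<alpha> * \<bar>Im s\<bar>)"
    using psum_strip_bound by blast
  have h: "(\<lambda>s. psum (s - 1)) holomorphic_on {s. 0 < Re s}"
  proof -
    have "(psum \<circ> (\<lambda>s. s - 1)) holomorphic_on {s. 0 < Re s}"
      by (intro holomorphic_on_compose_gen[OF _ psum_holomorphic] holomorphic_intros) auto
    then show ?thesis by (simp add: o_def)
  qed
  have bd: "norm (psum (s - 1)) \<le> B * exp (\<alpha> * \<bar>Im s\<bar>)" if "3/4 \<le> Re s" "Re s \<le> 1" for s
    using B[of "s - 1"] that by simp
  have ab: "-1 < (3/4 :: real)" "3/4 < (1::real)" "3/4 \<noteq> (0::real)" "1 \<noteq> (0::real)" "0 < (3/4::real)" by auto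
  show ?thesis
    unfolding psi_shifted[OF assms]
    by (rule Gamma_powr_shift(1)[OF \<alpha>_nonneg \<alpha>(2) assms ab(1-4) h ab(5) _ bd]) auto
qed

text \<open>\<open>f\<close> is split by the difference equation. The term with
  \<open>psum s\<close> is moved from 3/4 to -1/4 without a residue, and the term with
  \<open>psum (s - 1)\<close> is rewritten on that line. The bracket is exp (-x) times the
  derivative of exp x * x powr -s.\<close>

lemma f_line_integral_psi:
  assumes "\<sigma> > 0" "x > 0"
  shows "(LINT y|lborel. Gamma (Complex \<sigma> y) * f (Complex \<sigma> y) * of_real x powr (- Complex \<sigma> y)) =
    (LINT y|lborel. psi y * (of_real x powr (- Complex (- 1/4) y) - Complex (- 1/4) y * of_real x powr (- Complex (- 1/4) y - 1)))"
proof -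
  have fs: "f (Complex (3/4) y) = psum (Complex (3/4) y) - psum (Complex (3/4) y - 1)" for y
    using psum_step[of "Complex (3/4) y"] by simp
  have c: "(3/4 :: real) > 0" by simp
  have "(LINT y|lborel. Gamma (Complex \<sigma> y) * f (Complex \<sigma> y) * of_real x powr (- Complex \<sigma> y)) =
    (LINT y|lborel. Gamma (Complex (3/4) y) * psum (Complex (3/4) y) * of_real x powr (- Complex (3/4) y)
       - psi y * Complex (- 1/4) y * of_real x powr (- Complex (- 1/4) y - 1))"
    unfolding f_line_integral(2)[OF assms] psi_shifted[OF assms(2)] fs
    by (rule Bochner_Integration.integral_cong) (auto simp: algebra_simps)
  also have "\<dots> = (LINT y|lborel. psi y * of_real x powr (- Complex (- 1/4) y))
     - (LINT y|lborel. psi y * Complex (- 1/4) y * of_real x powr (- Complex (- 1/4) y - 1))"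
    using psum_line_integral[OF assms(2) c] psi_mult_integrable[OF assms(2)] by simp
  also have "\<dots> = (LINT y|lborel. psi y * of_real x powr (- Complex (- 1/4) y) - psi y * Complex (- 1/4) y * of_real x powr (- Complex (- 1/4) y - 1))"
    using psum_line_integral[OF assms(2) c] psi_mult_integrable[OF assms(2)] by simp
  finally show ?thesis by (simp add: right_diff_distrib mult.assoc)
qed

lemma indef_sum_inner_eq:
  assumes "\<sigma> > 0" "x > 0"
  shows "indef_sum_inner \<sigma> f x = of_real (exp x) / (2 * pi) *
    (LINT y|lborel. psi y * (of_real x powr (- Complex (- 1/4) y) - Complex (- 1/4) y * of_real x powr (- Complex (- 1/4) y - 1)))"
  unfolding indef_sum_inner_def vertical_integral_def indef_sum_kernel_def f_line_integral_psi[OF assms]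
  by (simp add: field_simps)

text \<open>After the exchange of integrals the x-integrand is an exact derivative for each s. The
  factor exp t produced here cancels the exp (-t) of the outer integral, which is thereby reduced to
  a Mellin transform.\<close>

lemma indef_sum_inner_integral:
  assumes \<sigma>: "\<sigma> > 0" and t: "t > 0"
  shows "set_integrable lborel {0<..<t} (indef_sum_inner \<sigma> f)"
    "(LINT x:{0<..<t}|lborel. indef_sum_inner \<sigma> f x) =
       of_real (exp t) / (2 * pi) * (LINT y|lborel. psi y * of_real t powr (- Complex (- 1/4) y))"
proof -
  define w where "w y = Complex (- 1/4) y" for y
  define K where "K x y = indicator {0<..<t} x *\<^sub>R (of_real (exp x) / (2 * pi) *
     (psi y * exp (- w y * of_real (ln x)) - psi y * w y * exp ((- w y - 1) * of_real (ln x))))" for x y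
  have [measurable]: "psi \<in> borel_measurable lborel" using psi_integrable by auto
  have [measurable]: "w \<in> borel_measurable borel" unfolding w_def Complex_eq by measurable
  \<comment> \<open>The exponents 1/4 and -3/4 are the real parts of -s and -s - 1 on the line -1/4;
    both exceed -1.\<close>
  define p where "p x = indicator {0<..<t} x *\<^sub>R (exp t * (x powr (1/4) + x powr (- 3/4)))" for x :: real
  define q where "q y = norm (psi y) + norm (psi y * w y)" for y
  have pint: "integrable lborel p"
  proof -
    have "set_integrable lborel {0<..<t} (\<lambda>x. exp t * (x powr (1/4) + x powr (- 3/4)))"
      using t by (intro set_integrable_mult_right set_integral_add set_integrable_powr_at_0) auto
    then show ?thesis by (simp add: set_integrable_def p_def[abs_def])
  qed
  have qint: "integrable lborel q"
    unfolding q_def[abs_def] w_def using psi_integrable psi_mult_integrable[of 1] by auto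
  have int: "integrable (lborel \<Otimes>\<^sub>M lborel) (case_prod K)"
  proof (rule integrable_pair_product_bound[OF _ pint qint])
    show "case_prod K \<in> borel_measurable (lborel \<Otimes>\<^sub>M lborel)"
      unfolding K_def by measurable
    show "norm (K x y) \<le> p x * q y" for x y
    proof (cases "x \<in> {0<..<t}")
      case True
      then have x: "0 < x" "x < t" by auto
      have e1: "norm (exp (- w y * of_real (ln x))) = x powr (1/4)"
        using x by (simp add: w_def powr_def)
      have e2: "norm (exp ((- w y - 1) * of_real (ln x))) = x powr (- 3/4)"
        using x by (simp add: w_def powr_def)
      have "norm (K x y) = exp x / (2 * pi) * norm (psi y * exp (- w y * of_real (ln x)) - psi y * w y * exp ((- w y - 1) * of_real (ln x)))"
        using True by (simp add: K_def norm_mult norm_divide)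
      also have "\<dots> \<le> exp t * (norm (psi y) * x powr (1/4) + norm (psi y * w y) * x powr (- 3/4))"
      proof (intro mult_mono)
        have "exp x / (2 * pi) \<le> exp x / 1" using pi_gt3 by (intro divide_left_mono) auto
        also have "\<dots> \<le> exp t" using x by simp
        finally show "exp x / (2 * pi) \<le> exp t" .
        show "norm (psi y * exp (- w y * of_real (ln x)) - psi y * w y * exp ((- w y - 1) * of_real (ln x))) \<le> norm (psi y) * x powr (1/4) + norm (psi y * w y) * x powr (- 3/4)"
          using norm_triangle_ineq4[of "psi y * exp (- w y * of_real (ln x))" "psi y * w y * exp ((- w y - 1) * of_real (ln x))"]
          unfolding norm_mult[of "psi y" "exp _"] norm_mult[of "psi y * w y" "exp _"] e1 e2 .
      qed auto
      also have "\<dots> \<le> exp t * ((x powr (1/4) + x powr (- 3/4)) * (norm (psi y) + norm (psi y * w y)))"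
        by (intro mult_left_mono) (auto simp: algebra_simps)
      finally show ?thesis using True by (simp add: p_def q_def mult.assoc)
    qed (simp add: K_def p_def)
  qed
  have 1: "(LINT y|lborel. K x y) = indicator {0<..<t} x *\<^sub>R indef_sum_inner \<sigma> f x" for x
  proof (cases "x \<in> {0<..<t}")
    case True
    then have x: "x > 0" by simp
    have "K x y = of_real (exp x) / (2 * pi) * (psi y * (of_real x powr (- Complex (- 1/4) y) - Complex (- 1/4) y * of_real x powr (- Complex (- 1/4) y - 1)))" for y
      unfolding K_def of_real_powr_eq_exp[OF x] w_def[symmetric] using True by (simp add: algebra_simps)
    then show ?thesis using True indef_sum_inner_eq[OF \<sigma> x] by (simp del: of_real_mult)
  qed (simp add: K_def)
  show "set_integrable lborel {0<..<t} (indef_sum_inner \<sigma> f)"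
    using lborel_pair.integrable_fst[OF int] by (simp add: set_integrable_def 1)
  have 2: "(LINT x|lborel. K x y) = of_real (exp t) / (2 * pi) * (psi y * of_real t powr (- Complex (- 1/4) y))" for y
  proof -
    have "K x y = (psi y / (2 * pi)) * (indicator {0<..<t} x *\<^sub>R (of_real (exp x) * (of_real x powr (- w y) - w y * of_real x powr (- w y - 1))))" for x
      by (cases "x \<in> {0<..<t}") (auto simp: K_def of_real_powr_eq_exp algebra_simps)
    then have "(LINT x|lborel. K x y) = (psi y / (2 * pi)) * (LINT x:{0<..<t}|lborel. of_real (exp x) * (of_real x powr (- w y) - w y * of_real x powr (- w y - 1)))"
      unfolding set_lebesgue_integral_def by (simp only: integral_mult_right_zero)
    also have "\<dots> = (psi y / (2 * pi)) * (of_real (exp t) * of_real t powr (- w y))"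
      by (subst integral_exp_powr_derivative[OF _ _ t]) (auto simp: w_def)
    finally show ?thesis by (simp add: w_def)
  qed
  show "(LINT x:{0<..<t}|lborel. indef_sum_inner \<sigma> f x) =
       of_real (exp t) / (2 * pi) * (LINT y|lborel. psi y * of_real t powr (- Complex (- 1/4) y))"
    using lborel_pair.integral_fst[OF int] lborel_pair.integral_snd[OF int]
    unfolding set_lebesgue_integral_def 1 2 by (simp only: integral_mult_right_zero)
qed

text \<open>Between the lines only 0 and \<open>z\<close> are singular, and \<open>psum_0\<close>
  annihilates the residue at 0. The second denominator is z - s instead of s - z, which turns the
  difference of the two line integrals into a sum.\<close>

lemma psum_pole_integral:
  assumes z: "Re z > 0"
  shows "(LINT y|lborel. Gamma (Complex (Re z + 1) y) * psum (Complex (Re z + 1) y) / (Complex (Re z + 1) y - z))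
    + (LINT y|lborel. psi y / (z - Complex (- 1/4) y)) = 2 * pi * (Gamma z * psum z)"
proof -
  define G where "G s = Gamma s * (psum s / (s - z))" for s
  let ?S = "{s. - 1/2 < Re s \<and> Re s < Re z + 2}"
  obtain B where B: "\<And>s. - 1/2 \<le> Re s \<Longrightarrow> Re s \<le> Re z + 1 \<Longrightarrow> norm (psum s) \<le> B * exp (\<alpha> * \<bar>Im s\<bar>)"
    using psum_strip_bound by blast
  have bd: "norm (psum s / (s - z)) \<le> B * exp (\<alpha> * \<bar>Im s\<bar>)"
    if s: "- 1/4 \<le> Re s" "Re s \<le> Re z + 1" "\<bar>Im s\<bar> \<ge> \<bar>Im z\<bar> + 1" for s
  proof -
    have "1 \<le> norm (s - z)" using abs_Im_le_cmod[of "s - z"] s by simp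
    then have "norm (psum s / (s - z)) \<le> norm (psum s) / 1"
      unfolding norm_divide by (intro divide_left_mono) auto
    also have "\<dots> \<le> B * exp (\<alpha> * \<bar>Im s\<bar>)" using B[of s] s by simp
    finally show ?thesis .
  qed
  have Y1: "\<bar>Im z\<bar> + 1 \<ge> 1" by simp
  obtain M where M: "\<And>s. - 1/4 \<le> Re s \<Longrightarrow> Re s \<le> Re z + 1 \<Longrightarrow> \<bar>Im s\<bar> \<ge> \<bar>Im z\<bar> + 1 \<Longrightarrow> norm (G s) \<le> M * exp (- ((pi / 2 - \<alpha>) / 2) * \<bar>Im s\<bar>)"
    using Gamma_powr_decay[OF \<alpha>_nonneg \<alpha>(2) zero_less_one Y1 bd] unfolding G_def by auto
  have "Gamma holomorphic_on ?S - {0, z}"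
  proof (rule holomorphic_Gamma, rule ccontr)
    assume "(?S - {0, z}) \<inter> \<int>\<^sub>\<le>\<^sub>0 \<noteq> {}"
    then obtain s where s: "- 1/2 < Re s" "s \<noteq> 0" "s \<in> \<int>\<^sub>\<le>\<^sub>0" by auto
    then obtain n where n: "s = - of_nat n" by (auto elim!: nonpos_Ints_cases')
    then have "n = 0" using s by simp
    then show False using n s by simp
  qed
  moreover have "(\<lambda>s. psum s / (s - z)) holomorphic_on ?S - {0, z}"
    by (intro holomorphic_intros holomorphic_on_subset[OF psum_holomorphic]) auto
  ultimately have hol: "G holomorphic_on ?S - {0, z}"
    unfolding G_def by (intro holomorphic_on_mult)
  have lt: "- 1/2 < (- 1/4 :: real)" "- 1/4 < Re z + 1" "Re z + 1 < Re z + 2" using z by auto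
  have P: "- 1/4 < Re p \<and> Re p < Re z + 1" if "p \<in> {0, z}" for p using that z by auto
  have d: "(pi / 2 - \<alpha>) / 2 > 0" using \<alpha> by simp
  have fin: "finite {0, z}" by simp
  note vs = vertical_shift[where Y = "\<bar>Im z\<bar> + 1", OF lt fin hol P d M]
  have z0: "z \<noteq> 0" using z by auto
  have "residue G (- of_nat 0) = (-1) ^ 0 / fact 0 * (psum (- of_nat 0) / (- of_nat 0 - z))"
    unfolding G_def
  proof (rule residue_Gamma_mult)
    show "open ({s. Re s > -1} - {z})" by (intro open_Diff open_halfspace_Re_gt) auto
    show "(\<lambda>s. psum s / (s - z)) holomorphic_on {s. Re s > -1} - {z}"
      by (intro holomorphic_intros holomorphic_on_subset[OF psum_holomorphic]) auto
  qed (use z0 in auto)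
  then have r0: "residue G 0 = 0" by (simp add: psum_0)
  have "residue (\<lambda>s. (Gamma s * psum s) / (s - z)) z = Gamma z * psum z"
  proof (rule residue_simple)
    show "open {s. Re s > 0}" by (rule open_halfspace_Re_gt)
    show "(\<lambda>s. Gamma s * psum s) holomorphic_on {s. Re s > 0}"
      by (intro holomorphic_intros holomorphic_on_subset[OF psum_holomorphic]) (auto elim!: nonpos_Ints_cases)
  qed (use z in auto)
  then have rz: "residue G z = Gamma z * psum z" by (simp add: G_def[abs_def])
  have "(LINT y|lborel. G (Complex (Re z + 1) y)) - (LINT y|lborel. G (Complex (- 1/4) y)) = 2 * pi * (Gamma z * psum z)"
    using vs(3) z0 r0 rz by simp
  moreover have "(LINT y|lborel. G (Complex (- 1/4) y)) = - (LINT y|lborel. psi y / (z - Complex (- 1/4) y))"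
  proof -
    have "G (Complex (- 1/4) y) = - (psi y / (z - Complex (- 1/4) y))" for y
      using minus_divide_right[of "psi y" "z - Complex (- 1/4) y"] by (simp add: G_def psi_def)
    then show ?thesis by simp
  qed
  ultimately show ?thesis by (simp add: G_def)
qed

lemma indef_sum_converges_and_eq:
  assumes \<sigma>: "\<sigma> > 0" and z: "Re z > 0"
  shows "indef_sum_converges \<sigma> f z" "indef_sum \<sigma> f z = psum z"
proof -
  define c where "c = Re z + 1"
  have c: "c > 0" "Re z < c" using z by (auto simp: c_def)
  define v where "v t = of_real (exp (- t)) * (LINT x:{0<..<t}|lborel. indef_sum_inner \<sigma> f x)" for t
  have v: "v t = 1 / (2 * pi) * (LINT y|lborel. psi y * of_real t powr (- Complex (- 1/4) y))" if "t > 0" for t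
    unfolding v_def indef_sum_inner_integral(2)[OF \<sigma> that] by (simp add: exp_minus field_simps)
  have v1: "v t = (LINT y|lborel. psi y / (2 * pi) * of_real t powr (- Complex (- 1/4) y))" if "t > 0" for t
    using v[OF that] by simp
  define \<Phi> where "\<Phi> y = Gamma (Complex c y) * psum (Complex c y) / (2 * pi)" for y
  \<comment> \<open>The same \<open>v\<close> is written on a second line because t powr (z - 1 - s)
    is integrable near 0 only for Re s < Re z and near infinity only for Re s > Re z.\<close>
  have v2: "v t = (LINT y|lborel. \<Phi> y * of_real t powr (- Complex c y))" if "t > 0" for t
    using v[OF that] psum_line_integral(3)[OF that c(1)] by (simp add: \<Phi>_def)
  have \<Phi>: "integrable lborel \<Phi>"
    using psum_line_integral(2)[OF zero_less_one c(1)] by (simp add: \<Phi>_def[abs_def])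
  have psi: "integrable lborel (\<lambda>y. psi y / (2 * pi))" using psi_integrable by simp
  have z14: "- 1/4 < Re z" using z by simp
  note A = mellin_swap_0_1[OF psi z14 v1]
  note A' = mellin_swap_1_top[OF \<Phi> c(2) v2]
  have int1: "set_integrable lborel {0<..<1} (\<lambda>t. of_real t powr (z - 1) * v t)" by (rule A(1)) auto
  have int2: "set_integrable lborel {1..} (\<lambda>t. of_real t powr (z - 1) * v t)" by (rule A'(1)) auto
  have U: "{0<..} = {0<..<1} \<union> {1::real..}" by auto
  have outer: "indef_sum_outer \<sigma> f z = (\<lambda>t. of_real t powr (z - 1) * v t)"
    by (auto simp: indef_sum_outer_def v_def mult.assoc)
  have "set_integrable lborel {0<..} (indef_sum_outer \<sigma> f z)"
    unfolding outer U by (rule set_integrable_Un[OF int1 int2]) auto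
  then show "indef_sum_converges \<sigma> f z"
    unfolding indef_sum_converges_def vertical_integrable_def indef_sum_kernel_def
    using f_line_integral(1)[OF \<sigma>] indef_sum_inner_integral(1)[OF \<sigma>] by auto
  have "(LINT t:{0<..}|lborel. indef_sum_outer \<sigma> f z t) = (LINT t:{0<..<1}|lborel. of_real t powr (z - 1) * v t) + (LINT t:{1..}|lborel. of_real t powr (z - 1) * v t)"
    unfolding outer U by (rule set_integral_Un[OF _ int1 int2]) auto
  also have "(LINT t:{0<..<1}|lborel. of_real t powr (z - 1) * v t) = (LINT y|lborel. psi y / (2 * pi) / (z - Complex (- 1/4) y))"
    by (rule A(2)) auto
  also have "(LINT t:{1..}|lborel. of_real t powr (z - 1) * v t) = (LINT y|lborel. \<Phi> y / (Complex c y - z))"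
    by (rule A'(2)) auto
  also have "(LINT y|lborel. psi y / (2 * pi) / (z - Complex (- 1/4) y)) = 1 / (2 * pi) * (LINT y|lborel. psi y / (z - Complex (- 1/4) y))"
    by (simp add: mult.commute flip: integral_mult_right_zero)
  also have "(LINT y|lborel. \<Phi> y / (Complex c y - z)) = 1 / (2 * pi) * (LINT y|lborel. Gamma (Complex c y) * psum (Complex c y) / (Complex c y - z))"
    by (simp add: \<Phi>_def mult.commute flip: integral_mult_right_zero)
  also have "1 / (2 * pi) * (LINT y|lborel. psi y / (z - Complex (- 1/4) y)) + 1 / (2 * pi) * (LINT y|lborel. Gamma (Complex c y) * psum (Complex c y) / (Complex c y - z))
      = 1 / (2 * pi) * (2 * pi * (Gamma z * psum z))"
    unfolding psum_pole_integral[OF z, symmetric] c_def by (simp only: distrib_left add.commute)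
  also have "\<dots> = Gamma z * psum z" by simp
  finally show "indef_sum \<sigma> f z = psum z"
    using z unfolding indef_sum_def by (auto simp: Gamma_eq_zero_iff elim!: nonpos_Ints_cases)
qed

section \<open>The series and the exponential generating function\<close>

lemma sum_f_eq_psum: "(\<Sum>j=1..n+1. f (of_nat j)) = psum (of_nat n + 1)"
  using psum_of_nat[of "n + 1"] by (simp add: add.commute)

lemma vartheta_summable: "summable (vartheta_term f x)"
proof -
  obtain B \<kappa> where B: "B > 0" "\<kappa> > 0" "\<And>z. - 1/2 \<le> Re z \<Longrightarrow> norm (psum z) \<le> B * exp (\<alpha> * \<bar>Im z\<bar> + \<kappa> * Re z)"
    using psum_bound by blast
  show ?thesis
  proof (rule summable_comparison_test)
    show "summable (\<lambda>n. B * exp \<kappa> * (inverse (fact n) * (exp \<kappa> * norm x) ^ n))"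
      by (intro summable_mult summable_exp)
    have "norm (vartheta_term f x n) \<le> B * exp \<kappa> * (inverse (fact n) * (exp \<kappa> * norm x) ^ n)" for n
    proof -
      have "norm (vartheta_term f x n) = norm (psum (of_nat n + 1)) * (norm x ^ n / fact n)"
        unfolding vartheta_term_def sum_f_eq_psum by (simp add: norm_mult norm_divide norm_power)
      also have "\<dots> \<le> (B * exp (real n * \<kappa> + \<kappa>)) * (norm x ^ n / fact n)"
        using B(3)[of "of_nat n + 1"] by (intro mult_right_mono) (auto simp: algebra_simps)
      also have "\<dots> = B * exp \<kappa> * (inverse (fact n) * (exp \<kappa> * norm x) ^ n)"
        unfolding exp_add exp_of_nat_mult power_mult_distrib by (simp add: field_simps)
      finally show ?thesis .
    qed
    then show "\<exists>N. \<forall>n\<ge>N. norm (vartheta_term f x n) \<le> B * exp \<kappa> * (inverse (fact n) * (exp \<kappa> * norm x) ^ n)" by blast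
  qed
qed

lemma vartheta_holomorphic: "vartheta f holomorphic_on UNIV"
proof -
  have "vartheta f holomorphic_on ball 0 r" for r
  proof (rule power_series_holomorphic[where a = "\<lambda>n. (\<Sum>j=1..n+1. f (of_nat j)) / fact n"])
    fix w
    have "vartheta_term f w sums vartheta f w"
      unfolding vartheta_def using vartheta_summable by (rule summable_sums)
    then show "(\<lambda>n. (\<Sum>j=1..n+1. f (of_nat j)) / fact n * (w - 0) ^ n) sums vartheta f w"
      by (simp add: vartheta_term_def[abs_def])
  qed
  then have "vartheta f field_differentiable at z" for z
    by (intro holomorphic_on_imp_differentiable_at[of _ "ball 0 (norm z + 1)"]) auto
  then show ?thesis by (simp add: holomorphic_on_def)
qed

lemma psum_reflect_bound:
  obtains B \<kappa> where "B > 0" "\<And>s. Re s \<le> 1 \<Longrightarrow> norm (psum (1 - s)) \<le> B * exp (\<alpha> * \<bar>Im s\<bar> - \<kappa> * Re s)"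
proof -
  obtain B \<kappa> where B: "B > 0" "\<kappa> > 0" "\<And>z. - 1/2 \<le> Re z \<Longrightarrow> norm (psum z) \<le> B * exp (\<alpha> * \<bar>Im z\<bar> + \<kappa> * Re z)"
    using psum_bound by blast
  show ?thesis
  proof (rule that[of "B * exp \<kappa>" \<kappa>])
    fix s assume "Re s \<le> 1"
    then have "norm (psum (1 - s)) \<le> B * exp (\<alpha> * \<bar>Im s\<bar> + \<kappa> * (1 - Re s))" using B(3)[of "1 - s"] by simp
    also have "\<dots> = B * exp \<kappa> * exp (\<alpha> * \<bar>Im s\<bar> - \<kappa> * Re s)"
      by (simp add: algebra_simps flip: exp_add)
    finally show "norm (psum (1 - s)) \<le> B * exp \<kappa> * exp (\<alpha> * \<bar>Im s\<bar> - \<kappa> * Re s)" .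
  qed (use B in auto)
qed

lemma psum_reflect_holomorphic: "(\<lambda>s. psum (1 - s)) holomorphic_on {s. Re s < 1}"
proof -
  have "(psum \<circ> (\<lambda>s. 1 - s)) holomorphic_on {s. Re s < 1}"
    by (intro holomorphic_on_compose_gen[OF _ psum_holomorphic] holomorphic_intros) auto
  then show ?thesis by (simp add: o_def)
qed

text \<open>At s = -n the function psum (1 - s) * x powr -s takes the value psum (n + 1) * x^n, so
  the residues of \<open>Gamma\<close> produce the series of \<open>vartheta\<close> at -x. The
  power of \<open>x\<close> merely adds ln x to the rate \<kappa>.\<close>

lemma vartheta_mellin:
  assumes x: "x > 0" and c: "0 < c" "c < 1"
  shows "integrable lborel (\<lambda>y. Gamma (Complex c y) * (psum (1 - Complex c y) * of_real x powr (- Complex c y)))"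
    "vartheta f (- of_real x) = 1 / (2 * pi) * (LINT y|lborel. Gamma (Complex c y) * (psum (1 - Complex c y) * of_real x powr (- Complex c y)))"
proof -
  obtain B \<kappa> where B: "B > 0" "\<And>s. Re s \<le> 1 \<Longrightarrow> norm (psum (1 - s)) \<le> B * exp (\<alpha> * \<bar>Im s\<bar> - \<kappa> * Re s)"
    using psum_reflect_bound by blast
  have hol: "(\<lambda>s. psum (1 - s) * of_real x powr (- s)) holomorphic_on {s. Re s < 1} - {}"
    using psum_reflect_holomorphic holomorphic_of_real_powr[OF x] by (auto intro: holomorphic_on_mult)
  have bd: "norm (psum (1 - s) * of_real x powr (- s)) \<le> B * exp (\<alpha> * \<bar>Im s\<bar> - (\<kappa> + ln x) * Re s)" if "Re s \<le> c" for s
  proof -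
    have "norm (psum (1 - s) * of_real x powr (- s)) \<le> B * exp (\<alpha> * \<bar>Im s\<bar> - \<kappa> * Re s) * exp (- Re s * ln x)"
      unfolding norm_mult using B(2)[of s] that c x
      by (intro mult_mono) (auto simp: norm_of_real_powr powr_def intro: order_trans[OF norm_ge_zero])
    also have "\<dots> = B * exp (\<alpha> * \<bar>Im s\<bar> - (\<kappa> + ln x) * Re s)"
      by (simp add: algebra_simps flip: exp_add)
    finally show ?thesis .
  qed
  have em: "finite {}" "\<And>p::complex. p \<in> {} \<Longrightarrow> Re p < c \<and> p \<notin> \<int>\<^sub>\<le>\<^sub>0" by auto
  note S = Gamma_residue_sums[OF c \<alpha>_nonneg \<alpha>(2) em hol bd]
  show "integrable lborel (\<lambda>y. Gamma (Complex c y) * (psum (1 - Complex c y) * of_real x powr (- Complex c y)))"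
    by (rule S(1))
  have "(-1) ^ n / fact n * (psum (1 - - of_nat n) * of_real x powr (- (- of_nat n))) = vartheta_term f (- of_real x) n" for n
  proof -
    have "(of_real x :: complex) powr of_nat n = of_real x ^ n" 
      using x by (simp add: of_real_powr_eq_exp exp_of_nat_mult flip: exp_of_real)
    moreover have "(- of_real x :: complex) ^ n = (-1) ^ n * of_real x ^ n" by (rule power_minus)
    ultimately show ?thesis unfolding vartheta_term_def sum_f_eq_psum by (simp add: add.commute)
  qed
  then have "vartheta_term f (- of_real x) sums (1 / (2 * pi) * (LINT y|lborel. Gamma (Complex c y) * (psum (1 - Complex c y) * of_real x powr (- Complex c y))))"
    using S(2) by simp
  then show "vartheta f (- of_real x) = 1 / (2 * pi) * (LINT y|lborel. Gamma (Complex c y) * (psum (1 - Complex c y) * of_real x powr (- Complex c y)))"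
    unfolding vartheta_def by (rule sums_unique[symmetric])
qed

text \<open>The Mellin integral has denominator s - p with p = 1 - z, whereas the series needs p -
  s. The two line integrals are therefore opposite and cancel, and only the residue at
  \<open>p\<close> remains. It is a simple pole apart from those of \<open>Gamma\<close> precisely
  because \<open>z\<close> is not a positive integer.\<close>

lemma rhs_converges_and_eq:
  assumes z: "Re z > 0" "z \<notin> \<nat>"
  shows "summable (rhs_term f z)" "set_integrable lborel {1..} (rhs_integrand f z)" "rhs f z = psum z"
proof -
  \<comment> \<open>The line must lie in the open unit strip and strictly to the right of the pole 1
    - z.\<close>
  define c where "c = 1 - min 1 (Re z) / 2"
  have c: "0 < c" "c < 1" "Re (1 - z) < c" using z by (auto simp: c_def min_def)
  define p where "p = 1 - z"
  have p: "p \<notin> \<int>\<^sub>\<le>\<^sub>0"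
  proof
    assume "p \<in> \<int>\<^sub>\<le>\<^sub>0"
    then obtain n where "p = - of_nat n" by (auto elim!: nonpos_Ints_cases')
    then have "z = of_nat (n + 1)" by (simp add: p_def algebra_simps)
    then show False using z by (metis of_nat_in_Nats)
  qed
  obtain B \<kappa> where B: "B > 0" "\<And>s. Re s \<le> 1 \<Longrightarrow> norm (psum (1 - s)) \<le> B * exp (\<alpha> * \<bar>Im s\<bar> - \<kappa> * Re s)"
    using psum_reflect_bound by blast
  define \<Phi> where "\<Phi> y = Gamma (Complex c y) * psum (1 - Complex c y) / (2 * pi)" for y
  have \<Phi>: "integrable lborel \<Phi>"
    using vartheta_mellin(1)[OF zero_less_one c(1,2)] by (simp add: \<Phi>_def[abs_def])
  have v: "vartheta f (- of_real t) = (LINT y|lborel. \<Phi> y * of_real t powr (- Complex c y))" if "1 \<le> t" for t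
    using vartheta_mellin(2)[of t, OF _ c(1,2)] that by (simp add: \<Phi>_def mult.assoc)
  note Mel = mellin_swap_1_top[OF \<Phi> c(3) v]
  have integrand: "rhs_integrand f z = (\<lambda>t. of_real t powr (1 - z - 1) * vartheta f (- of_real t))"
    by (auto simp: rhs_integrand_def mult.commute)
  show "set_integrable lborel {1..} (rhs_integrand f z)" unfolding integrand by (rule Mel(1))
  have I: "(LINT x:{1..}|lborel. rhs_integrand f z x) = (LINT y|lborel. \<Phi> y / (Complex c y - p))"
    unfolding integrand p_def by (rule Mel(2))
  \<comment> \<open>With this sign \<open>W (- of_nat n)\<close> carries the denominator n + 1 - z
    of \<open>rhs_term\<close>.\<close>
  define W where "W s = psum (1 - s) / (p - s)" for s
  have W_minus: "W s = - (psum (1 - s) / (s - p))" for s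
    using minus_divide_right[of "psum (1 - s)" "s - p"] by (simp add: W_def)
  have hol: "W holomorphic_on {s. Re s < 1} - {p}"
    unfolding W_def by (intro holomorphic_on_divide holomorphic_on_subset[OF psum_reflect_holomorphic] holomorphic_intros) auto
  have bd: "norm (W s) \<le> B * exp (\<alpha> * \<bar>Im s\<bar> - \<kappa> * Re s)" if s: "Re s \<le> c" "\<bar>Im s\<bar> \<ge> \<bar>Im z\<bar> + 1 \<or> Re s \<le> - Re z" for s
  proof -
    \<comment> \<open>As Re p = 1 - Re z, either alternative of the hypothesis puts \<open>s\<close>
      at distance at least 1 from \<open>p\<close>.\<close>
    have "1 \<le> norm (p - s)"
      using s abs_Im_le_cmod[of "p - s"] abs_Re_le_cmod[of "p - s"] by (auto simp: p_def)
    then have "norm (W s) \<le> norm (psum (1 - s)) / 1"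
      unfolding W_def norm_divide by (intro divide_left_mono) auto
    also have "\<dots> \<le> B * exp (\<alpha> * \<bar>Im s\<bar> - \<kappa> * Re s)" using B(2)[of s] s c by simp
    finally show ?thesis .
  qed
  have P: "finite {p}" "\<And>q. q \<in> {p} \<Longrightarrow> Re q < c \<and> q \<notin> \<int>\<^sub>\<le>\<^sub>0" using p c by (auto simp: p_def)
  note S = Gamma_residue_sums[where Y = "\<bar>Im z\<bar> + 1" and R = "Re z", OF c(1,2) \<alpha>_nonneg \<alpha>(2) P hol bd]
  have term_eq: "(-1) ^ n / fact n * W (- of_nat n) = rhs_term f z n" for n
  proof -
    have e: "p - - of_nat n = of_nat n + 1 - z" "1 - - of_nat n = of_nat n + (1 :: complex)"
      by (simp_all add: p_def)
    show ?thesis unfolding rhs_term_def sum_f_eq_psum W_def e by simp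
  qed
  have "residue (\<lambda>s. - (Gamma s * psum (1 - s)) / (s - p)) p = - (Gamma p * psum (1 - p))"
  proof (rule residue_simple)
    show "open ({s. Re s < 1} - \<int>\<^sub>\<le>\<^sub>0)" by (intro open_Diff open_halfspace_Re_lt closed_nonpos_Ints)
    show "p \<in> {s. Re s < 1} - \<int>\<^sub>\<le>\<^sub>0" using p z by (auto simp: p_def)
    show "(\<lambda>s. - (Gamma s * psum (1 - s))) holomorphic_on {s. Re s < 1} - \<int>\<^sub>\<le>\<^sub>0"
      by (intro holomorphic_intros holomorphic_on_subset[OF psum_reflect_holomorphic]) auto
  qed
  moreover have "(\<lambda>s. - (Gamma s * psum (1 - s)) / (s - p)) = (\<lambda>s. Gamma s * W s)"
    by (simp add: W_minus)
  ultimately have res: "residue (\<lambda>s. Gamma s * W s) p = - (Gamma p * psum z)" by (simp add: p_def)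
  have "(LINT y|lborel. \<Phi> y / (Complex c y - p)) = (LINT y|lborel. - (1 / (2 * pi)) * (Gamma (Complex c y) * W (Complex c y)))"
  proof (rule Bochner_Integration.integral_cong)
    fix y
    show "\<Phi> y / (Complex c y - p) = - (1 / (2 * pi)) * (Gamma (Complex c y) * W (Complex c y))"
      by (simp add: \<Phi>_def W_minus)
  qed simp
  also have "\<dots> = - (1 / (2 * pi)) * (LINT y|lborel. Gamma (Complex c y) * W (Complex c y))"
    by (rule integral_mult_right_zero)
  finally have I2: "(LINT x:{1..}|lborel. rhs_integrand f z x) = - (1 / (2 * pi)) * (LINT y|lborel. Gamma (Complex c y) * W (Complex c y))"
    using I by simp
  have sums: "rhs_term f z sums (1 / (2 * pi) * (LINT y|lborel. Gamma (Complex c y) * W (Complex c y)) + Gamma p * psum z)"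
    using S(2) unfolding term_eq by (simp add: res)
  then show "summable (rhs_term f z)" by (rule sums_summable)
  have "(\<Sum>n. rhs_term f z n) + (LINT x:{1..}|lborel. rhs_integrand f z x) = Gamma p * psum z"
    unfolding sums_unique[OF sums, symmetric] I2 by simp
  then show "rhs f z = psum z"
    unfolding rhs_def p_def[symmetric] using p by (simp add: Gamma_eq_zero_iff)
qed

end

section \<open>Equality of both sides, with the limit at positive integers\<close>

theorem corollary3p1:
  fixes f :: "complex \<Rightarrow> complex" and \<sigma> :: real and z :: complex
  assumes "f \<in> space_E" and "\<sigma> > 0" and "Re z > 0"
  shows "(\<forall>x. summable (vartheta_term f x)) \<and> vartheta f holomorphic_on UNIV \<and>
         indef_sum_converges \<sigma> f z \<and>
         (z \<notin> \<nat> \<longrightarrow>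
            summable (rhs_term f z) \<and> set_integrable lborel {1..} (rhs_integrand f z) \<and>
            indef_sum \<sigma> f z = rhs f z) \<and>
         (z \<in> \<nat> \<longrightarrow> (rhs f \<longlongrightarrow> indef_sum \<sigma> f z) (at z))"
proof -
  obtain \<alpha> \<rho> C where E: "f holomorphic_on {z. Re z > 0}" "0 \<le> \<alpha>" "\<alpha> < pi / 2" "0 \<le> \<rho>" "0 < C"
    and bd: "\<And>z. Re z > 0 \<Longrightarrow> norm (f z) < C * exp (\<alpha> * \<bar>Im z\<bar> + \<rho> * \<bar>Re z\<bar>)"
    using assms(1) unfolding space_E_def by blast
  \<comment> \<open>Raising the rate to at least pi/4 makes it strictly positive and keeps it below
    pi/2.\<close>
  define \<alpha>' where "\<alpha>' = max \<alpha> (pi / 4)"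
  interpret exp_type f \<alpha>' \<rho> C
  proof
    fix z :: complex assume z: "Re z > 0"
    have "norm (f z) \<le> C * exp (\<alpha> * \<bar>Im z\<bar> + \<rho> * \<bar>Re z\<bar>)" using bd[OF z] by simp
    also have "\<dots> \<le> C * exp (\<alpha>' * \<bar>Im z\<bar> + \<rho> * Re z)"
      using E z by (intro mult_left_mono) (auto simp: \<alpha>'_def intro: mult_right_mono)
    finally show "norm (f z) \<le> C * exp (\<alpha>' * \<bar>Im z\<bar> + \<rho> * Re z)" .
  qed (use E in \<open>auto simp: \<alpha>'_def\<close>)
  \<comment> \<open>At a positive integer \<open>Gamma (1 - z)\<close> has the default value 0, so
    \<open>rhs f z\<close> itself says nothing. On a punctured neighbourhood \<open>rhs f\<close>
    agrees with \<open>psum\<close>, which is continuous at \<open>z\<close>.\<close>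
  have "(rhs f \<longlongrightarrow> indef_sum \<sigma> f z) (at z)" if "z \<in> \<nat>"
  proof -
    have "isCont psum z"
      using psum_holomorphic assms(3)
      by (intro field_differentiable_imp_continuous_at holomorphic_on_imp_differentiable_at[of _ "{z. Re z > -1}"])
         (auto intro: open_halfspace_Re_gt)
    then have "(psum \<longlongrightarrow> psum z) (at z)" by (simp add: isCont_def)
    moreover have "\<forall>\<^sub>F w in at z. psum w = rhs f w"
    proof -
      obtain n where n: "z = of_nat n" using \<open>z \<in> \<nat>\<close> by (rule Nats_cases)
      have "w \<notin> \<nat>" if "w \<noteq> z" "dist w z < 1" for w
      proof
        assume "w \<in> \<nat>"
        then obtain m where m: "w = of_nat m" by (rule Nats_cases)
        then have "dist (real m) (real n) < 1" using that n by (simp add: dist_of_nat)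
        then have "m = n" by (simp add: dist_real_def abs_less_iff)
        then show False using that m n by simp
      qed
      moreover have "Re w > 0" if "dist w z < Re z" for w
        using that abs_Re_le_cmod[of "w - z"] by (simp add: dist_norm)
      \<comment> \<open>Radius 1 excludes all other natural numbers, and radius Re z keeps
        \<open>w\<close> in the right half-plane.\<close>
      ultimately have "\<forall>w. w \<noteq> z \<and> dist w z < min 1 (Re z) \<longrightarrow> psum w = rhs f w"
        using rhs_converges_and_eq(3) by simp
      then show ?thesis
        unfolding eventually_at using assms(3) by (intro exI[of _ "min 1 (Re z)"]) auto
    qed
    ultimately have "(rhs f \<longlongrightarrow> psum z) (at z)" by (rule Lim_transform_eventually)
    then show ?thesis using indef_sum_converges_and_eq(2)[OF assms(2,3)] by simp
  qed
  then show ?thesis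
    using vartheta_summable vartheta_holomorphic indef_sum_converges_and_eq[OF assms(2,3)]
      rhs_converges_and_eq[OF assms(3)] by simp
qed

end
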